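(* Let $d\in\mathbb{N}$, let $X$ and $Y$ be Banach spaces, and let $p,q,r\in(1,\infty)$ be such that $\frac1r=\frac1p-\frac1q$. There is a constant $C_{d,p,q'}\ge0$ such that the following holds. Let $m:\mathbb{R}^d\to\mathcal{L}(X,Y)$ be of moderate growth at infinity and such that $m(\cdot)x\in L^1_{\rm loc}(\mathbb{R}^d;Y)$ for all $x\in X$. Fix $a>0$ and let $m_kx:=a^{-d}\int_{[0,a]^d}m(t+ka)x\,dt$ for $k\in\mathbb{Z}^d$, $x\in X$. If $T_m:L^p(\mathbb{R}^d;X)\to L^q(\mathbb{R}^d;Y)$ is bounded, with norm $\|T_m\|$, then for all $n\in\mathbb{N}$ and all $(x_k)_{|k|\le n}$ in $X$, $$a^{d/r}\Big\|\sum_{|k|\le n}e_km_kx_k\Big\|_{L^q(\mathbb{T}^d;Y)}\le C_{d,p,q'}\|T_m\|\,\Big\|\sum_{|k|\le n}e_kx_k\Big\|_{L^p(\mathbb{T}^d;X)}.$$ In particular, the Fourier multiplier operator with symbol $(m_k)_{k\in\mathbb{Z}^d}$ is bounded from $L^p(\mathbb{T}^d;X)$ to $L^q(\mathbb{T}^d;Y)$.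
   Context: Banach spaces are nonzero and over $\mathbb{C}$. $\mathbb{T}^d:=[0,1]^d$ with Lebesgue measure, and $e_k(t):=e^{2\pi ik\cdot t}$ for $k\in\mathbb{Z}^d$, $t\in\mathbb{T}^d$; sums over $|k|\le n$ run over $k\in\mathbb{Z}^d$. $q'$ is the Hölder conjugate of $q$. The Fourier multiplier operator with symbol $(m_k)_{k\in\mathbb{Z}^d}$ maps an $X$-valued trigonometric polynomial $\sum_ke_kx_k$ to $\sum_ke_km_kx_k$; it is bounded from $L^p(\mathbb{T}^d;X)$ to $L^q(\mathbb{T}^d;Y)$ if it extends to a bounded operator between these spaces. An $X$-strongly measurable $m:\mathbb{R}^d\to\mathcal{L}(X,Y)$ (i.e. $m(\cdot)x$ strongly measurable for all $x\in X$) is of moderate growth at infinity if there are $\alpha\in(0,\infty)$ and $g\in L^1(\mathbb{R}^d)$ with $(1+|\xi|)^{-\alpha}\|m(\xi)\|_{\mathcal{L}(X,Y)}\le g(\xi)$ for all $\xi$. The Fourier transform is $\widehat f(\xi)=\int_{\mathbb{R}^d}e^{-2\pi i\xi\cdot t}f(t)\,dt$; for $f\in\mathcal{S}(\mathbb{R}^d;X)$, $T_m(f):=\mathcal{F}^{-1}(m\widehat f\,)\in\mathcal{S}'(\mathbb{R}^d;Y)$. "$T_m:L^p(\mathbb{R}^d;X)\to L^q(\mathbb{R}^d;Y)$ is bounded" means $T_m(f)\in L^q(\mathbb{R}^d;Y)$ and $\|T_m(f)\|_{L^q(\mathbb{R}^d;Y)}\le C\|f\|_{L^p(\mathbb{R}^d;X)}$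 for all $f\in\mathcal{S}(\mathbb{R}^d;X)$ and some $C$; the least such $C$ is $\|T_m\|$. *)

theory Defs
  imports "HOL-Analysis.Analysis"
begin

section \<open>Complex Banach spaces\<close>

text \<open>The library only provides real Banach spaces.\<close>

class complex_banach = banach +
  fixes scaleC :: "complex \<Rightarrow> 'a \<Rightarrow> 'a" (infixr "*\<^sub>C" 75)
  assumes scaleC_add_right: "c *\<^sub>C (x + y) = c *\<^sub>C x + c *\<^sub>C y"
    and scaleC_add_left: "(b + c) *\<^sub>C x = b *\<^sub>C x + c *\<^sub>C x"
    and scaleC_scaleC: "b *\<^sub>C (c *\<^sub>C x) = (b * c) *\<^sub>C x"
    and scaleC_of_real: "complex_of_real s *\<^sub>C x = s *\<^sub>R x"
    and norm_scaleC: "norm (c *\<^sub>C x) = cmod c * norm x"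

instantiation complex :: complex_banach
begin

definition scaleC_complex :: "complex \<Rightarrow> complex \<Rightarrow> complex" where
  "scaleC_complex = (*)"

instance
  by standard (auto simp: scaleC_complex_def algebra_simps norm_mult scaleR_conv_of_real)

end

text \<open>The type \<open>('x, 'y) blinfun\<close> consists of the real-linear bounded operators, with the
  operator norm; its complex-linear elements form the space of bounded operators between the
  complex Banach spaces \<open>'x\<close> and \<open>'y\<close>.\<close>

definition complex_linear_op :: "('x::complex_banach, 'y::complex_banach) blinfun \<Rightarrow> bool" where
  "complex_linear_op A \<longleftrightarrow> (\<forall>c x. blinfun_apply A (c *\<^sub>C x) = c *\<^sub>C blinfun_apply A x)"

section \<open>Strong measurability, Bochner integral and vector-valued Lebesgue spaces\<close>

text \<open>The library's Bochner integral is restricted to second countable (hence separable) spaces.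
  The definitions below are the same, with Borel measurability replaced by strong measurability,
  so that the Banach space may be arbitrary. The measure \<open>M\<close> is always Lebesgue measure
  on a measurable subset of \<open>\<real>\<^sup>d\<close>, which is \<open>\<sigma>\<close>-finite and complete.\<close>

definition strongly_measurable :: "'a measure \<Rightarrow> ('a \<Rightarrow> 'b::real_normed_vector) \<Rightarrow> bool" where
  "strongly_measurable M f \<longleftrightarrow>
    (\<exists>s. (\<forall>i::nat. simple_function M (s i)) \<and> (AE x in M. (\<lambda>i. s i x) \<longlonglongrightarrow> f x))"

definition has_Bochner_integral :: "'a measure \<Rightarrow> ('a \<Rightarrow> 'b::banach) \<Rightarrow> 'b \<Rightarrow> bool" where
  "has_Bochner_integral M f y \<longleftrightarrow>
    strongly_measurable M f \<and>
    (\<exists>s. (\<forall>i::nat. Bochner_Integration.simple_bochner_integrable M (s i)) \<and>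
         (\<lambda>i. \<integral>\<^sup>+x. ennreal (norm (f x - s i x)) \<partial>M) \<longlonglongrightarrow> 0 \<and>
         (\<lambda>i. Bochner_Integration.simple_bochner_integral M (s i)) \<longlonglongrightarrow> y)"

definition Bochner_integral :: "'a measure \<Rightarrow> ('a \<Rightarrow> 'b::banach) \<Rightarrow> 'b" where
  "Bochner_integral M f = (THE y. has_Bochner_integral M f y)"

text \<open>Elements of \<open>L\<^sup>p\<close> are represented by functions; they are identified when equal almost
  everywhere. \<open>Lp_norm\<close> is only meaningful on \<open>Lp\<close>.\<close>

definition Lp :: "'a measure \<Rightarrow> real \<Rightarrow> ('a \<Rightarrow> 'b::real_normed_vector) set" where
  "Lp M p = {f. strongly_measurable M f \<and> integrable M (\<lambda>x. norm (f x) powr p)}"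

definition Lp_norm :: "'a measure \<Rightarrow> real \<Rightarrow> ('a \<Rightarrow> 'b::real_normed_vector) \<Rightarrow> real" where
  "Lp_norm M p f = (LINT x|M. norm (f x) powr p) powr (1 / p)"

definition L1_loc :: "((real^'d) \<Rightarrow> 'b::real_normed_vector) set" where
  "L1_loc = {f. strongly_measurable lebesgue f \<and>
                (\<forall>K. compact K \<longrightarrow> integrable (lebesgue_on K) (\<lambda>t. norm (f t)))}"

section \<open>Schwartz functions, Fourier transform and Fourier multipliers on Euclidean space\<close>

definition partial_deriv :: "'d \<Rightarrow> ((real^'d) \<Rightarrow> 'b::real_normed_vector) \<Rightarrow> (real^'d) \<Rightarrow> 'b" where
  "partial_deriv i f x = frechet_derivative f (at x) (axis i 1)"

text \<open>The list \<open>is\<close> of coordinates plays the role of a multi-index. A function is smooth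
  iff all its iterated partial derivatives are differentiable.\<close>

definition schwartz :: "((real^'d) \<Rightarrow> 'b::real_normed_vector) set" where
  "schwartz = {f. \<forall>is. (\<forall>x. foldr partial_deriv is f differentiable (at x)) \<and>
                  (\<forall>n::nat. bounded (range (\<lambda>x. norm x ^ n *\<^sub>R foldr partial_deriv is f x)))}"

definition fourier :: "((real^'d) \<Rightarrow> 'b::complex_banach) \<Rightarrow> (real^'d) \<Rightarrow> 'b" where
  "fourier f \<xi> = Bochner_integral lebesgue (\<lambda>t. cis (- 2 * pi * (\<xi> \<bullet> t)) *\<^sub>C f t)"

definition inv_fourier :: "((real^'d) \<Rightarrow> 'b::complex_banach) \<Rightarrow> (real^'d) \<Rightarrow> 'b" where
  "inv_fourier f t = Bochner_integral lebesgue (\<lambda>\<xi>. cis (2 * pi * (\<xi> \<bullet> t)) *\<^sub>C f \<xi>)"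

text \<open>Vector-valued tempered distributions are given by their action on scalar Schwartz functions:
  \<open>distr_of_fun h\<close> is the distribution induced by the function \<open>h\<close>, and \<open>inv_fourier_distr\<close> is
  the inverse Fourier transform on distributions, defined by duality.\<close>

definition distr_of_fun ::
  "((real^'d) \<Rightarrow> 'b::complex_banach) \<Rightarrow> ((real^'d) \<Rightarrow> complex) \<Rightarrow> 'b" where
  "distr_of_fun h \<phi> = Bochner_integral lebesgue (\<lambda>t. \<phi> t *\<^sub>C h t)"

definition inv_fourier_distr ::
  "(((real^'d) \<Rightarrow> complex) \<Rightarrow> 'b) \<Rightarrow> ((real^'d) \<Rightarrow> complex) \<Rightarrow> 'b" where
  "inv_fourier_distr u \<phi> = u (inv_fourier \<phi>)"

definition moderate_growth ::
  "((real^'d) \<Rightarrow> ('x::complex_banach, 'y::complex_banach) blinfun) \<Rightarrow> bool" where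
  "moderate_growth m \<longleftrightarrow>
    (\<forall>x. strongly_measurable lebesgue (\<lambda>\<xi>. blinfun_apply (m \<xi>) x)) \<and>
    (\<exists>\<alpha>>0. \<exists>g :: (real^'d) \<Rightarrow> real. integrable lebesgue g \<and>
       (\<forall>\<xi>. (1 + norm \<xi>) powr (- \<alpha>) * norm (m \<xi>) \<le> g \<xi>))"

definition T_mult ::
  "((real^'d) \<Rightarrow> ('x::complex_banach, 'y::complex_banach) blinfun) \<Rightarrow>
   ((real^'d) \<Rightarrow> 'x) \<Rightarrow> ((real^'d) \<Rightarrow> complex) \<Rightarrow> 'y" where
  "T_mult m f = inv_fourier_distr (distr_of_fun (\<lambda>\<xi>. blinfun_apply (m \<xi>) (fourier f \<xi>)))"

definition T_mult_bound ::
  "real \<Rightarrow> real \<Rightarrow> ((real^'d) \<Rightarrow> ('x::complex_banach, 'y::complex_banach) blinfun) \<Rightarrow> real \<Rightarrow> bool"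
where
  "T_mult_bound p q m C \<longleftrightarrow>
    0 \<le> C \<and>
    (\<forall>f\<in>schwartz. \<exists>g\<in>Lp lebesgue q.
       (\<forall>\<phi>\<in>schwartz. T_mult m f \<phi> = distr_of_fun g \<phi>) \<and>
       Lp_norm lebesgue q g \<le> C * Lp_norm lebesgue p f)"

definition T_mult_bounded ::
  "real \<Rightarrow> real \<Rightarrow> ((real^'d) \<Rightarrow> ('x::complex_banach, 'y::complex_banach) blinfun) \<Rightarrow> bool" where
  "T_mult_bounded p q m \<longleftrightarrow> (\<exists>C. T_mult_bound p q m C)"

text \<open>The infimum is attained, so this is the least admissible constant.\<close>

definition T_mult_norm ::
  "real \<Rightarrow> real \<Rightarrow> ((real^'d) \<Rightarrow> ('x::complex_banach, 'y::complex_banach) blinfun) \<Rightarrow> real" where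
  "T_mult_norm p q m = Inf {C. T_mult_bound p q m C}"

section \<open>Fourier multipliers on the torus\<close>

definition torus :: "(real^'d) measure" where
  "torus = lebesgue_on (cbox 0 1)"

definition int_vec :: "int^'d \<Rightarrow> real^'d" where
  "int_vec k = (\<chi> i. real_of_int (k $ i))"

definition trig_poly :: "(int^'d) set \<Rightarrow> (int^'d \<Rightarrow> 'b::complex_banach) \<Rightarrow> (real^'d) \<Rightarrow> 'b" where
  "trig_poly K x t = (\<Sum>k\<in>K. cis (2 * pi * (int_vec k \<bullet> t)) *\<^sub>C x k)"

text \<open>The three conditions on \<open>T\<close> say that it is a bounded operator \<open>L\<^sup>p \<rightarrow> L\<^sup>q\<close> (linearity holds
  up to null sets; together with the bound it implies that \<open>T\<close> respects equality almost
  everywhere), the last one that it extends the multiplier operator with symbol \<open>\<mu>\<close>.\<close>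

definition torus_multiplier_bounded ::
  "real \<Rightarrow> real \<Rightarrow> (int^'d \<Rightarrow> 'x::complex_banach \<Rightarrow> 'y::complex_banach) \<Rightarrow> bool" where
  "torus_multiplier_bounded p q \<mu> \<longleftrightarrow>
    (\<exists>(T :: ((real^'d) \<Rightarrow> 'x) \<Rightarrow> (real^'d) \<Rightarrow> 'y) C.
      (\<forall>f\<in>Lp torus p. T f \<in> Lp torus q \<and> Lp_norm torus q (T f) \<le> C * Lp_norm torus p f) \<and>
      (\<forall>f\<in>Lp torus p. \<forall>g\<in>Lp torus p.
         AE t in torus. T (\<lambda>s. f s + g s) t = T f t + T g t) \<and>
      (\<forall>f\<in>Lp torus p. \<forall>c. AE t in torus. T (\<lambda>s. c *\<^sub>C f s) t = c *\<^sub>C T f t) \<and>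
      (\<forall>K x. finite K \<longrightarrow>
         (AE t in torus. T (trig_poly K x) t = trig_poly K (\<lambda>k. \<mu> k (x k)) t)))"

definition cube_average ::
  "real \<Rightarrow> ((real^'d) \<Rightarrow> ('x::complex_banach, 'y::complex_banach) blinfun) \<Rightarrow>
   int^'d \<Rightarrow> 'x \<Rightarrow> 'y" where
  "cube_average a m k x =
    (1 / a ^ CARD('d)) *\<^sub>R
      Bochner_integral (lebesgue_on (cbox 0 (\<chi> i. a)))
        (\<lambda>t. blinfun_apply (m (t + a *\<^sub>R int_vec k)) x)"

text \<open>The constant depends on \<open>d\<close>, \<open>p\<close> and \<open>q'\<close> only. An existential quantifier inside a theorem
  with type variables \<open>'x\<close> and \<open>'y\<close> would let the constant depend on the Banach spaces, so an
  admissible value is named instead. With \<open>h\<close> the inverse Fourier transform of the indicator of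
  \<open>[0,1]\<^sup>d\<close>, transference yields the constant \<open>K d p * K d q'\<close> where \<open>K d s\<close> is the supremum over
  \<open>t\<close> of \<open>(\<Sum>k. \<bar>h (t + k)\<bar> powr s) powr (1 / s)\<close>, and
  \<open>K d s \<le> (2 + s / (s - 1)) powr (d / s) \<le> (3 * s / (s - 1)) ^ d\<close>.\<close>

definition transference_const :: "nat \<Rightarrow> real \<Rightarrow> real \<Rightarrow> real" where
  "transference_const d p q' = (16 * (p / (p - 1)) * (q' / (q' - 1))) ^ d"

end

theory Submission
  imports Defs "HOL-Probability.Probability" "HOL-Real_Asymp.Real_Asymp"
begin

text \<open>Write \<open>Q = [0,1]\<^sup>d\<close> and let \<open>h\<close> be the inverse Fourier transform of its indicator. If
  \<open>f(s) = h(a s) P(a s)\<close> for a trigonometric polynomial \<open>P\<close>, then the Fourier transform of \<open>f\<close> is, up to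
  a factor, the step function with value \<open>x\<^sub>k\<close> on \<open>a (k + Q)\<close>, so testing \<open>T\<^sub>m f\<close> against
  \<open>s \<mapsto> h(- a s) F\<^sub>N(t - a s)\<close>, with the Fejer kernel \<open>F\<^sub>N\<close>, yields the Fejer mean at \<open>t\<close> of the multiplied
  polynomial. This avoids duality: the \<open>L\<^sup>q\<close> norm in \<open>t\<close> is bounded by Hoelder's inequality with respect to
  \<open>F\<^sub>N\<close>, and both norms are controlled by the periodization of a power of \<open>\<Prod>\<^sub>i min 1 (1 / \<bar>t\<^sub>i\<bar>)\<close>, which
  dominates \<open>h\<close>. As \<open>h\<close> is not a Schwartz function, it is replaced by a Gaussian times a Riemann sum for
  \<open>h\<close>, whose Fourier transform is an explicit sum of Gaussians; no Fourier inversion theorem is needed.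
  Moderate growth of \<open>m\<close> dominates the passage to the limit, and Fatou's lemma gives the inequality. The
  multiplier extends to all of \<open>L\<^sup>p\<close> because trigonometric polynomials are dense.\<close>

section \<open>Strong measurability\<close>

text \<open>The hypothesis on \<open>T_mult m\<close> concerns only Schwartz inputs and pairings
  with scalar Schwartz functions, while \<open>Y\<close> is an arbitrary Banach space. Evaluating
  the pairing on a family of test functions indexed by \<open>t\<close> recovers a
  \<open>Y\<close>-valued polynomial directly. The pairing is a double sum over cells
  \<open>a (\<kappa> + Q)\<close> and \<open>a (k + Q)\<close>; distinct cells meet only in null
  sets, so removing the smoothing leaves the averages over single cells. This is done at a fixed
  Fejer order, where the sum is finite, and only then does the order grow. Hoelder's inequality
  splits the kernel as \<open>F^(1/q') F^(1/q)\<close>; the first factor is periodized together with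
  a power \<open>q'\<close>, which is how \<open>q'\<close> enters the constant. The input norm
  contributes \<open>a^(-d/p)\<close> and the pairing \<open>a^(d/q)\<close>, together
  \<open>a^(-d/r)\<close>. A periodization with exponent \<open>s\<close> costs
  \<open>(4 s / (s - 1))^d\<close>; the cases \<open>s = p\<close> and \<open>s = q'\<close> give
  the factor 16. Every estimate has to be uniform in the smoothing, and this couples the width of
  the Gaussian with the number of nodes of the Riemann sum.\<close>

lemma bounded_bilinear_scaleC: "bounded_bilinear ((*\<^sub>C) :: complex \<Rightarrow> 'b::complex_banach \<Rightarrow> 'b)"
proof
  fix s :: real and a :: complex and b :: 'b
  show "(s *\<^sub>R a) *\<^sub>C b = s *\<^sub>R a *\<^sub>C b"
    by (simp add: scaleR_conv_of_real[of s a] scaleC_of_real flip: scaleC_scaleC)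
  show "a *\<^sub>C s *\<^sub>R b = s *\<^sub>R a *\<^sub>C b"
    by (simp only: scaleC_of_real[symmetric] scaleC_scaleC mult.commute[of a])
qed (auto simp: scaleC_add_left scaleC_add_right norm_scaleC intro!: exI[of _ 1])

interpretation scaleC: bounded_bilinear "(*\<^sub>C) :: complex \<Rightarrow> 'b::complex_banach \<Rightarrow> 'b"
  by (rule bounded_bilinear_scaleC)

lemma scaleC_one [simp]: "1 *\<^sub>C x = (x::'b::complex_banach)"
  using scaleC_of_real[of 1 x] by simp

lemma strongly_measurable_simple: "simple_function M s \<Longrightarrow> strongly_measurable M s"
  unfolding strongly_measurable_def by (intro exI[of _ "\<lambda>_. s"]) auto

text \<open>Arbitrary pointwise combinations of simple functions are simple, so \<open>p\<close>
  needs only sequential continuity, and no separability of the value spaces enters.\<close>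

lemma strongly_measurable_compose2:
  assumes "strongly_measurable M f" "strongly_measurable M g"
    and p: "\<And>u v a b. u \<longlonglongrightarrow> a \<Longrightarrow> v \<longlonglongrightarrow> b \<Longrightarrow> (\<lambda>i. p (u i) (v i)) \<longlonglongrightarrow> p a b"
  shows "strongly_measurable M (\<lambda>x. p (f x) (g x))"
proof -
  obtain s where s: "\<And>i::nat. simple_function M (s i)" "AE x in M. (\<lambda>i. s i x) \<longlonglongrightarrow> f x"
    using assms(1) unfolding strongly_measurable_def by auto
  obtain t where t: "\<And>i::nat. simple_function M (t i)" "AE x in M. (\<lambda>i. t i x) \<longlonglongrightarrow> g x"
    using assms(2) unfolding strongly_measurable_def by auto
  show ?thesis
    unfolding strongly_measurable_def
  proof (rule exI[of _ "\<lambda>i x. p (s i x) (t i x)"], intro conjI allI)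
    show "simple_function M (\<lambda>x. p (s i x) (t i x))" for i
      by (rule simple_function_compose2[OF s(1) t(1)])
    show "AE x in M. (\<lambda>i. p (s i x) (t i x)) \<longlonglongrightarrow> p (f x) (g x)"
      using s(2) t(2) by eventually_elim (rule p)
  qed
qed

lemma strongly_measurable_compose1:
  assumes "strongly_measurable M f" and p: "\<And>u a. u \<longlonglongrightarrow> a \<Longrightarrow> (\<lambda>i. p (u i)) \<longlonglongrightarrow> p a"
  shows "strongly_measurable M (\<lambda>x. p (f x))"
  using strongly_measurable_compose2[OF assms(1,1), of "\<lambda>a b. p a"] p by auto

lemma strongly_measurable_zero: "strongly_measurable M (\<lambda>x. 0)"
  by (rule strongly_measurable_simple) simp

lemma strongly_measurable_add:
  "strongly_measurable M f \<Longrightarrow> strongly_measurable M g \<Longrightarrow> strongly_measurable M (\<lambda>x. f x + g x)"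
  by (rule strongly_measurable_compose2) (auto intro: tendsto_add)

lemma strongly_measurable_diff:
  "strongly_measurable M f \<Longrightarrow> strongly_measurable M g \<Longrightarrow> strongly_measurable M (\<lambda>x. f x - g x)"
  by (rule strongly_measurable_compose2) (auto intro: tendsto_diff)

lemma strongly_measurable_sum:
  "(\<And>i. i \<in> I \<Longrightarrow> strongly_measurable M (f i)) \<Longrightarrow> strongly_measurable M (\<lambda>x. \<Sum>i\<in>I. f i x)"
  by (induction I rule: infinite_finite_induct)
    (auto intro: strongly_measurable_add strongly_measurable_zero)

lemma strongly_measurable_scaleC:
  "strongly_measurable M f \<Longrightarrow> strongly_measurable M g \<Longrightarrow> strongly_measurable M (\<lambda>x. f x *\<^sub>C g x)"
  by (rule strongly_measurable_compose2) (auto intro: scaleC.tendsto)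

lemma strongly_measurable_scaleR:
  "strongly_measurable M f \<Longrightarrow> strongly_measurable M g \<Longrightarrow> strongly_measurable M (\<lambda>x. f x *\<^sub>R g x)"
  by (rule strongly_measurable_compose2) (auto intro: tendsto_scaleR)

lemma borel_imp_strongly_measurable:
  fixes f :: "'a \<Rightarrow> 'b::{real_normed_vector, second_countable_topology}"
  assumes "f \<in> borel_measurable M"
  shows "strongly_measurable M f"
proof -
  obtain s where "\<And>i. simple_function M (s i)" "\<And>x. x \<in> space M \<Longrightarrow> (\<lambda>i. s i x) \<longlonglongrightarrow> f x"
    using borel_measurable_implies_sequence_metric[OF assms, of 0] by blast
  then show ?thesis
    unfolding strongly_measurable_def by (intro exI[of _ s]) auto
qed

lemma strongly_measurable_const: "strongly_measurable M (\<lambda>x. c)"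
  by (rule strongly_measurable_simple) simp

text \<open>Strong measurability speaks of limits almost everywhere, so the norm of a strongly
  measurable function is a Borel function up to a null set. Completeness of the measure absorbs the
  exceptional set.\<close>

lemma (in complete_measure) borel_measurable_AE_cong:
  assumes f: "f \<in> borel_measurable M" and ae: "AE x in M. f x = g x"
  shows "g \<in> borel_measurable M"
proof (rule measurableI)
  fix A :: "'b set" assume A: "A \<in> sets borel"
  show "g -` A \<inter> space M \<in> sets M"
  proof (rule in_sets_AE)
    show "f -` A \<inter> space M \<in> sets M"
      using f A by (rule measurable_sets)
    show "AE x in M. x \<in> f -` A \<inter> space M \<longleftrightarrow> x \<in> g -` A \<inter> space M"
      using ae by eventually_elim auto
  qed auto
qed auto

lemma (in complete_measure) borel_measurable_AE_LIMSEQ: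
  fixes f :: "nat \<Rightarrow> 'a \<Rightarrow> real"
  assumes f: "\<And>i. f i \<in> borel_measurable M" and ae: "AE x in M. (\<lambda>i. f i x) \<longlonglongrightarrow> g x"
  shows "g \<in> borel_measurable M"
proof (rule borel_measurable_AE_cong)
  show "(\<lambda>x. lim (\<lambda>i. f i x)) \<in> borel_measurable M"
    using f by (rule borel_measurable_lim_metric)
  show "AE x in M. lim (\<lambda>i. f i x) = g x"
    using ae by eventually_elim (rule limI)
qed

lemma (in complete_measure) borel_measurable_norm_strongly_measurable:
  assumes "strongly_measurable M f"
  shows "(\<lambda>x. norm (f x)) \<in> borel_measurable M"
proof -
  obtain s where s: "\<And>i::nat. simple_function M (s i)" "AE x in M. (\<lambda>i. s i x) \<longlonglongrightarrow> f x"
    using assms unfolding strongly_measurable_def by auto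
  show ?thesis
  proof (rule borel_measurable_AE_LIMSEQ)
    show "(\<lambda>x. norm (s i x)) \<in> borel_measurable M" for i
      by (rule borel_measurable_simple_function[OF simple_function_compose1[OF s(1)]])
    show "AE x in M. (\<lambda>i. norm (s i x)) \<longlonglongrightarrow> norm (f x)"
      using s(2) by eventually_elim (rule tendsto_norm)
  qed
qed

lemma complete_measure_restrict_space:
  assumes "complete_measure M" "S \<in> sets M"
  shows "complete_measure (restrict_space M S)"
proof
  interpret complete_measure M by fact
  fix A B assume *: "A \<subseteq> B" "B \<in> null_sets (restrict_space M S)"
  then have "B \<subseteq> S" "B \<in> null_sets M"
    using assms(2) by (auto simp: null_sets_restrict_space)
  then show "A \<in> sets (restrict_space M S)"
    using * assms(2) complete[of A B] by (auto simp: sets_restrict_space_iff)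
qed

interpretation torus: complete_measure torus
  unfolding torus_def
  by (rule complete_measure_restrict_space) (auto intro: completion.complete_measure_axioms)

text \<open>Truncating at twice the norm of the limit makes dominated convergence applicable.\<close>

lemma (in complete_measure) strongly_measurable_dominated_approx:
  fixes f :: "'a \<Rightarrow> 'b::real_normed_vector"
  assumes "strongly_measurable M f"
  obtains s where "\<And>i::nat. simple_function M (s i)" "AE x in M. (\<lambda>i. s i x) \<longlonglongrightarrow> f x"
    "\<And>i x. x \<in> space M \<Longrightarrow> norm (s i x) \<le> 2 * norm (f x)"
proof -
  obtain s where s: "\<And>i::nat. simple_function M (s i)" "AE x in M. (\<lambda>i. s i x) \<longlonglongrightarrow> f x"
    using assms unfolding strongly_measurable_def by auto
  note [measurable] = borel_measurable_norm_strongly_measurable[OF assms]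
  define t where "t i x = (if norm (s i x) \<le> 2 * norm (f x) then s i x else 0)" for i x
  show ?thesis
  proof
    show "simple_function M (t i)" for i
    proof -
      have [measurable]: "(\<lambda>x. norm (s i x)) \<in> borel_measurable M"
        by (rule borel_measurable_simple_function[OF simple_function_compose1[OF s(1)]])
      have "simple_function M (\<lambda>x. if x \<in> {x\<in>space M. norm (s i x) \<le> 2 * norm (f x)} then s i x else 0)"
        using s(1) by (intro simple_function_If_set) auto
      then show ?thesis
        by (rule simple_function_cong[THEN iffD1, rotated]) (auto simp: t_def)
    qed
    show "AE x in M. (\<lambda>i. t i x) \<longlonglongrightarrow> f x"
      using s(2)
    proof eventually_elim
      case (elim x)
      show ?case
      proof (cases "f x = 0")
        case True
        then have "t i x = 0" for i
          by (auto simp: t_def)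
        with True show ?thesis by simp
      next
        case False
        have "(\<lambda>i. norm (s i x)) \<longlonglongrightarrow> norm (f x)"
          using elim by (rule tendsto_norm)
        then have "\<forall>\<^sub>F i in sequentially. norm (s i x) < 2 * norm (f x)"
          by (rule order_tendstoD(2)) (use False in simp)
        then have "\<forall>\<^sub>F i in sequentially. t i x = s i x"
          by eventually_elim (auto simp: t_def)
        then show ?thesis
          using elim by (simp add: tendsto_cong)
      qed
    qed
    show "norm (t i x) \<le> 2 * norm (f x)" for i x
      by (auto simp: t_def)
  qed
qed

section \<open>The Bochner integral in arbitrary Banach spaces\<close>

lemma simple_bochner_integral_norm_le_nn_integral:
  assumes "Bochner_Integration.simple_bochner_integrable M s"
  shows "ennreal (norm (Bochner_Integration.simple_bochner_integral M s)) \<le> (\<integral>\<^sup>+x. ennreal (norm (s x)) \<partial>M)"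
proof -
  have "ennreal (norm (Bochner_Integration.simple_bochner_integral M s)) \<le>
    ennreal (Bochner_Integration.simple_bochner_integral M (\<lambda>x. norm (s x)))"
    by (intro ennreal_leI simple_bochner_integral_norm_bound assms)
  also have "\<dots> = (\<integral>\<^sup>+x. ennreal (norm (s x)) \<partial>M)"
    using assms simple_bochner_integrable_compose2[of "\<lambda>x y. norm x" M s s]
    by (intro simple_bochner_integral_eq_nn_integral) auto
  finally show ?thesis .
qed

context complete_measure
begin

lemma measurable_norm_diff_simple:
  assumes "strongly_measurable M f" "simple_function M s"
  shows "(\<lambda>x. ennreal (norm (f x - s x))) \<in> borel_measurable M"
  using borel_measurable_norm_strongly_measurable[OF
      strongly_measurable_diff[OF assms(1) strongly_measurable_simple[OF assms(2)]]]
  by measurable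

text \<open>Both halves of the theory of the integral rest on this: it makes two limits of simple
  integrals agree, and it makes the simple integrals of an approximating sequence a Cauchy
  sequence.\<close>

lemma simple_bochner_integral_dist_le:
  assumes "strongly_measurable M f"
    and s: "Bochner_Integration.simple_bochner_integrable M s"
    and t: "Bochner_Integration.simple_bochner_integrable M t"
  shows "ennreal (norm (Bochner_Integration.simple_bochner_integral M s - Bochner_Integration.simple_bochner_integral M t)) \<le>
    (\<integral>\<^sup>+x. ennreal (norm (f x - s x)) \<partial>M) + (\<integral>\<^sup>+x. ennreal (norm (f x - t x)) \<partial>M)"
proof -
  have sf: "simple_function M s" "simple_function M t"
    using s t by (auto elim: simple_bochner_integrable.cases)
  have "ennreal (norm (Bochner_Integration.simple_bochner_integral M s - Bochner_Integration.simple_bochner_integral M t)) =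
    ennreal (norm (Bochner_Integration.simple_bochner_integral M (\<lambda>x. s x - t x)))"
    using s t by (subst simple_bochner_integral_diff) auto
  also have "\<dots> \<le> (\<integral>\<^sup>+x. ennreal (norm (s x - t x)) \<partial>M)"
    using simple_bochner_integrable_compose2[of "(-)" M s t] s t
    by (intro simple_bochner_integral_norm_le_nn_integral) auto
  also have "\<dots> \<le> (\<integral>\<^sup>+x. ennreal (norm (f x - s x)) + ennreal (norm (f x - t x)) \<partial>M)"
  proof (rule nn_integral_mono)
    fix x
    have "norm (s x - t x) \<le> norm (f x - s x) + norm (f x - t x)"
      using norm_triangle_ineq4[of "f x - t x" "f x - s x"] by simp
    then show "ennreal (norm (s x - t x)) \<le> ennreal (norm (f x - s x)) + ennreal (norm (f x - t x))"
      by (simp add: ennreal_leI flip: ennreal_plus)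
  qed
  also have "\<dots> = (\<integral>\<^sup>+x. ennreal (norm (f x - s x)) \<partial>M) + (\<integral>\<^sup>+x. ennreal (norm (f x - t x)) \<partial>M)"
    using sf assms(1) by (intro nn_integral_add measurable_norm_diff_simple)
  finally show ?thesis .
qed

lemma has_Bochner_integral_unique:
  assumes "has_Bochner_integral M f y" "has_Bochner_integral M f z"
  shows "y = z"
proof -
  obtain s where sm: "strongly_measurable M f"
    and s: "\<And>i. Bochner_Integration.simple_bochner_integrable M (s i)"
    "(\<lambda>i::nat. \<integral>\<^sup>+x. ennreal (norm (f x - s i x)) \<partial>M) \<longlonglongrightarrow> 0"
    "(\<lambda>i. Bochner_Integration.simple_bochner_integral M (s i)) \<longlonglongrightarrow> y"
    using assms(1) unfolding has_Bochner_integral_def by auto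
  obtain t where
    t: "\<And>i. Bochner_Integration.simple_bochner_integrable M (t i)"
    "(\<lambda>i::nat. \<integral>\<^sup>+x. ennreal (norm (f x - t i x)) \<partial>M) \<longlonglongrightarrow> 0"
    "(\<lambda>i. Bochner_Integration.simple_bochner_integral M (t i)) \<longlonglongrightarrow> z"
    using assms(2) unfolding has_Bochner_integral_def by auto
  have "(\<lambda>i. ennreal (norm (Bochner_Integration.simple_bochner_integral M (s i) -
      Bochner_Integration.simple_bochner_integral M (t i)))) \<longlonglongrightarrow> ennreal (norm (y - z))"
    by (intro tendsto_ennrealI tendsto_norm tendsto_diff s t)
  moreover have "(\<lambda>i. (\<integral>\<^sup>+x. ennreal (norm (f x - s i x)) \<partial>M) + (\<integral>\<^sup>+x. ennreal (norm (f x - t i x)) \<partial>M))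
      \<longlonglongrightarrow> 0 + 0"
    by (intro tendsto_add s t)
  ultimately have "ennreal (norm (y - z)) \<le> 0 + 0"
    by (rule LIMSEQ_le) (intro exI allI impI simple_bochner_integral_dist_le sm s t)
  then show ?thesis
    by simp
qed

lemma Bochner_integral_eqI: "has_Bochner_integral M f y \<Longrightarrow> Bochner_integral M f = y"
  unfolding Bochner_integral_def using has_Bochner_integral_unique by blast

lemma has_Bochner_integral_norm_le:
  assumes "has_Bochner_integral M f y"
  shows "ennreal (norm y) \<le> (\<integral>\<^sup>+x. ennreal (norm (f x)) \<partial>M)"
proof -
  obtain s where sm: "strongly_measurable M f"
    and s: "\<And>i. Bochner_Integration.simple_bochner_integrable M (s i)"
    "(\<lambda>i::nat. \<integral>\<^sup>+x. ennreal (norm (f x - s i x)) \<partial>M) \<longlonglongrightarrow> 0"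
    "(\<lambda>i. Bochner_Integration.simple_bochner_integral M (s i)) \<longlonglongrightarrow> y"
    using assms(1) unfolding has_Bochner_integral_def by auto
  have sf: "simple_function M (s i)" for i
    using s(1)[of i] by (auto elim: simple_bochner_integrable.cases)
  have le: "ennreal (norm (Bochner_Integration.simple_bochner_integral M (s i))) \<le>
      (\<integral>\<^sup>+x. ennreal (norm (f x - s i x)) \<partial>M) + (\<integral>\<^sup>+x. ennreal (norm (f x)) \<partial>M)" for i
  proof -
    have "ennreal (norm (Bochner_Integration.simple_bochner_integral M (s i))) \<le> (\<integral>\<^sup>+x. ennreal (norm (s i x)) \<partial>M)"
      by (rule simple_bochner_integral_norm_le_nn_integral) (rule s)
    also have "\<dots> \<le> (\<integral>\<^sup>+x. ennreal (norm (f x - s i x)) + ennreal (norm (f x)) \<partial>M)"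
    proof (rule nn_integral_mono)
      fix x
      have "norm (s i x) \<le> norm (f x - s i x) + norm (f x)"
        using norm_triangle_ineq4[of "f x" "f x - s i x"] by simp
      then show "ennreal (norm (s i x)) \<le> ennreal (norm (f x - s i x)) + ennreal (norm (f x))"
        by (simp add: ennreal_leI flip: ennreal_plus)
    qed
    also have "\<dots> = (\<integral>\<^sup>+x. ennreal (norm (f x - s i x)) \<partial>M) + (\<integral>\<^sup>+x. ennreal (norm (f x)) \<partial>M)"
      by (intro nn_integral_add measurable_norm_diff_simple sm sf measurable_compose[OF _ measurable_ennreal]
          borel_measurable_norm_strongly_measurable)
    finally show ?thesis .
  qed
  have "(\<lambda>i. ennreal (norm (Bochner_Integration.simple_bochner_integral M (s i)))) \<longlonglongrightarrow> ennreal (norm y)"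
    by (intro tendsto_ennrealI tendsto_norm s)
  moreover have "(\<lambda>i. (\<integral>\<^sup>+x. ennreal (norm (f x - s i x)) \<partial>M) + (\<integral>\<^sup>+x. ennreal (norm (f x)) \<partial>M))
      \<longlonglongrightarrow> 0 + (\<integral>\<^sup>+x. ennreal (norm (f x)) \<partial>M)"
    by (intro tendsto_add s tendsto_const)
  ultimately have "ennreal (norm y) \<le> 0 + (\<integral>\<^sup>+x. ennreal (norm (f x)) \<partial>M)"
    by (rule LIMSEQ_le) (intro exI allI impI le)
  then show ?thesis by simp
qed

lemma nn_integral_simple_approx_tendsto_0:
  fixes f :: "'a \<Rightarrow> 'b::real_normed_vector"
  assumes sm: "strongly_measurable M f" and fin: "(\<integral>\<^sup>+x. ennreal (norm (f x)) \<partial>M) < \<infinity>"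
    and s: "\<And>i::nat. simple_function M (s i)" "AE x in M. (\<lambda>i. s i x) \<longlonglongrightarrow> f x"
    "\<And>i x. x \<in> space M \<Longrightarrow> norm (s i x) \<le> 2 * norm (f x)"
  shows "(\<lambda>i. \<integral>\<^sup>+x. ennreal (norm (f x - s i x)) \<partial>M) \<longlonglongrightarrow> 0"
proof -
  have "(\<lambda>i. \<integral>\<^sup>+x. ennreal (norm (f x - s i x)) \<partial>M) \<longlonglongrightarrow> (\<integral>\<^sup>+x. 0 \<partial>M)"
  proof (rule nn_integral_dominated_convergence)
    show "(\<lambda>x. ennreal (norm (f x - s i x))) \<in> borel_measurable M" for i
      by (intro measurable_norm_diff_simple sm s)
    show "(\<lambda>x. ennreal (3 * norm (f x))) \<in> borel_measurable M"
      using borel_measurable_norm_strongly_measurable[OF sm] by measurable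
    have "(\<integral>\<^sup>+x. ennreal (3 * norm (f x)) \<partial>M) = 3 * (\<integral>\<^sup>+x. ennreal (norm (f x)) \<partial>M)"
      using borel_measurable_norm_strongly_measurable[OF sm]
      by (simp add: ennreal_mult nn_integral_cmult)
    also have "\<dots> < \<infinity>"
      using fin by (simp add: ennreal_mult_less_top)
    finally show "(\<integral>\<^sup>+x. ennreal (3 * norm (f x)) \<partial>M) < \<infinity>" .
    show "AE x in M. ennreal (norm (f x - s i x)) \<le> ennreal (3 * norm (f x))" for i
    proof (intro AE_I2 ennreal_leI)
      fix x assume "x \<in> space M"
      then show "norm (f x - s i x) \<le> 3 * norm (f x)"
        using s(3)[of x i] norm_triangle_ineq4[of "f x" "s i x"] by linarith
    qed
    show "AE x in M. (\<lambda>i. ennreal (norm (f x - s i x))) \<longlonglongrightarrow> 0"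
      using s(2)
    proof eventually_elim
      case (elim x)
      have "(\<lambda>i. ennreal (norm (f x - s i x))) \<longlonglongrightarrow> ennreal (norm (f x - f x))"
        by (intro tendsto_ennrealI tendsto_norm tendsto_diff tendsto_const elim)
      then show ?case by simp
    qed
  qed simp
  then show ?thesis by simp
qed

lemma has_Bochner_integral_ex:
  fixes f :: "'a \<Rightarrow> 'b::banach"
  assumes sm: "strongly_measurable M f" and fin: "(\<integral>\<^sup>+x. ennreal (norm (f x)) \<partial>M) < \<infinity>"
  shows "has_Bochner_integral M f (Bochner_integral M f)"
proof -
  obtain s where s: "\<And>i::nat. simple_function M (s i)" "AE x in M. (\<lambda>i. s i x) \<longlonglongrightarrow> f x"
    "\<And>i x. x \<in> space M \<Longrightarrow> norm (s i x) \<le> 2 * norm (f x)"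
    using strongly_measurable_dominated_approx[OF sm] by auto
  have lim: "(\<lambda>i. \<integral>\<^sup>+x. ennreal (norm (f x - s i x)) \<partial>M) \<longlonglongrightarrow> 0"
    by (rule nn_integral_simple_approx_tendsto_0) fact+
  have int: "Bochner_Integration.simple_bochner_integrable M (s i)" for i
  proof (rule simple_bochner_integrableI_bounded)
    have "(\<integral>\<^sup>+x. ennreal (norm (s i x)) \<partial>M) \<le> (\<integral>\<^sup>+x. 2 * ennreal (norm (f x)) \<partial>M)"
    proof (rule nn_integral_mono)
      fix x assume "x \<in> space M"
      then have "ennreal (norm (s i x)) \<le> ennreal (2 * norm (f x))"
        by (intro ennreal_leI s)
      then show "ennreal (norm (s i x)) \<le> 2 * ennreal (norm (f x))"
        by (simp add: ennreal_mult)
    qed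
    also have "\<dots> < \<infinity>"
      using fin borel_measurable_norm_strongly_measurable[OF sm]
      by (simp add: nn_integral_cmult ennreal_mult_less_top)
    finally show "(\<integral>\<^sup>+x. ennreal (norm (s i x)) \<partial>M) < \<infinity>" .
  qed fact
  have "Cauchy (\<lambda>i. Bochner_Integration.simple_bochner_integral M (s i))"
  proof (rule metric_CauchyI)
    fix e :: real assume "0 < e"
    then have "\<forall>\<^sub>F i in sequentially. (\<integral>\<^sup>+x. ennreal (norm (f x - s i x)) \<partial>M) < ennreal (e/2)"
      by (intro order_tendstoD(2)[OF lim]) simp
    then obtain N where N: "\<And>i. i \<ge> N \<Longrightarrow> (\<integral>\<^sup>+x. ennreal (norm (f x - s i x)) \<partial>M) < ennreal (e/2)"
      unfolding eventually_sequentially by blast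
    show "\<exists>N. \<forall>m\<ge>N. \<forall>n\<ge>N. dist (Bochner_Integration.simple_bochner_integral M (s m))
        (Bochner_Integration.simple_bochner_integral M (s n)) < e"
    proof (intro exI allI impI)
      fix m n assume mn: "m \<ge> N" "n \<ge> N"
      have "ennreal (dist (Bochner_Integration.simple_bochner_integral M (s m))
        (Bochner_Integration.simple_bochner_integral M (s n))) \<le>
        (\<integral>\<^sup>+x. ennreal (norm (f x - s m x)) \<partial>M) + (\<integral>\<^sup>+x. ennreal (norm (f x - s n x)) \<partial>M)"
        unfolding dist_norm by (intro simple_bochner_integral_dist_le sm int)
      also have "\<dots> < ennreal (e/2) + ennreal (e/2)"
        using N mn by (intro add_strict_mono) auto
      also have "\<dots> = ennreal e"
        using \<open>0 < e\<close> by (simp flip: ennreal_plus)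
      finally show "dist (Bochner_Integration.simple_bochner_integral M (s m))
        (Bochner_Integration.simple_bochner_integral M (s n)) < e"
        using \<open>0 < e\<close> by (simp add: ennreal_less_iff)
    qed
  qed
  then obtain y where "(\<lambda>i. Bochner_Integration.simple_bochner_integral M (s i)) \<longlonglongrightarrow> y"
    unfolding Cauchy_convergent_iff convergent_def by auto
  then have "has_Bochner_integral M f y"
    unfolding has_Bochner_integral_def using sm lim int by auto
  moreover from this have "Bochner_integral M f = y"
    by (rule Bochner_integral_eqI)
  ultimately show ?thesis
    by simp
qed

text \<open>If the function is not integrable, the right-hand side is infinite, so the value that
  \<open>THE\<close> then returns does not matter.\<close>

lemma norm_Bochner_integral_le:
  fixes f :: "'a \<Rightarrow> 'b::banach"
  assumes sm: "strongly_measurable M f"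
  shows "ennreal (norm (Bochner_integral M f)) \<le> (\<integral>\<^sup>+x. ennreal (norm (f x)) \<partial>M)"
proof (cases "(\<integral>\<^sup>+x. ennreal (norm (f x)) \<partial>M) < \<infinity>")
  case True
  then show ?thesis
    by (intro has_Bochner_integral_norm_le has_Bochner_integral_ex sm)
next
  case False
  then have "(\<integral>\<^sup>+x. ennreal (norm (f x)) \<partial>M) = \<top>"
    by (simp add: less_top[symmetric])
  then show ?thesis by simp
qed

lemma has_Bochner_integral_add:
  fixes f g :: "'a \<Rightarrow> 'b::banach"
  assumes "has_Bochner_integral M f y" "has_Bochner_integral M g z"
  shows "has_Bochner_integral M (\<lambda>x. f x + g x) (y + z)"
proof -
  obtain s where sm: "strongly_measurable M f"
    and s: "\<And>i. Bochner_Integration.simple_bochner_integrable M (s i)"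
    "(\<lambda>i::nat. \<integral>\<^sup>+x. ennreal (norm (f x - s i x)) \<partial>M) \<longlonglongrightarrow> 0"
    "(\<lambda>i. Bochner_Integration.simple_bochner_integral M (s i)) \<longlonglongrightarrow> y"
    using assms(1) unfolding has_Bochner_integral_def by auto
  obtain t where sm': "strongly_measurable M g"
    and t: "\<And>i. Bochner_Integration.simple_bochner_integrable M (t i)"
    "(\<lambda>i::nat. \<integral>\<^sup>+x. ennreal (norm (g x - t i x)) \<partial>M) \<longlonglongrightarrow> 0"
    "(\<lambda>i. Bochner_Integration.simple_bochner_integral M (t i)) \<longlonglongrightarrow> z"
    using assms(2) unfolding has_Bochner_integral_def by auto
  have sf: "simple_function M (s i)" "simple_function M (t i)" for i
    using s(1)[of i] t(1)[of i] by (auto elim: simple_bochner_integrable.cases)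
  show ?thesis
    unfolding has_Bochner_integral_def
  proof (intro conjI exI[of _ "\<lambda>i x. s i x + t i x"] allI)
    show "strongly_measurable M (\<lambda>x. f x + g x)"
      by (intro strongly_measurable_add sm sm')
    show "Bochner_Integration.simple_bochner_integrable M (\<lambda>x. s i x + t i x)" for i
      by (rule simple_bochner_integrable_compose2[of "(+)", OF _ s(1) t(1)]) simp
    have "(\<lambda>i. Bochner_Integration.simple_bochner_integral M (s i) + Bochner_Integration.simple_bochner_integral M (t i)) \<longlonglongrightarrow> y + z"
      by (intro tendsto_add s t)
    then show "(\<lambda>i. Bochner_Integration.simple_bochner_integral M (\<lambda>x. s i x + t i x)) \<longlonglongrightarrow> y + z"
      by (subst simple_bochner_integral_add) (auto intro: s t)
    have "(\<lambda>i. (\<integral>\<^sup>+x. ennreal (norm (f x - s i x)) \<partial>M) + (\<integral>\<^sup>+x. ennreal (norm (g x - t i x)) \<partial>M)) \<longlonglongrightarrow> 0 + 0"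
      by (intro tendsto_add s t)
    then have *: "(\<lambda>i. (\<integral>\<^sup>+x. ennreal (norm (f x - s i x)) \<partial>M) + (\<integral>\<^sup>+x. ennreal (norm (g x - t i x)) \<partial>M)) \<longlonglongrightarrow> 0"
      by simp
    show "(\<lambda>i. \<integral>\<^sup>+x. ennreal (norm (f x + g x - (s i x + t i x))) \<partial>M) \<longlonglongrightarrow> 0"
    proof (rule tendsto_sandwich[OF _ _ tendsto_const *])
      show "\<forall>\<^sub>F i in sequentially. (\<integral>\<^sup>+x. ennreal (norm (f x + g x - (s i x + t i x))) \<partial>M) \<le>
        (\<integral>\<^sup>+x. ennreal (norm (f x - s i x)) \<partial>M) + (\<integral>\<^sup>+x. ennreal (norm (g x - t i x)) \<partial>M)"
      proof (intro always_eventually allI)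
        fix i
        have "(\<integral>\<^sup>+x. ennreal (norm (f x + g x - (s i x + t i x))) \<partial>M) \<le>
          (\<integral>\<^sup>+x. ennreal (norm (f x - s i x)) + ennreal (norm (g x - t i x)) \<partial>M)"
          by (intro nn_integral_mono) (simp add: ennreal_leI norm_diff_triangle_ineq flip: ennreal_plus)
        also have "\<dots> = (\<integral>\<^sup>+x. ennreal (norm (f x - s i x)) \<partial>M) + (\<integral>\<^sup>+x. ennreal (norm (g x - t i x)) \<partial>M)"
          by (intro nn_integral_add measurable_norm_diff_simple sm sm' sf)
        finally show "(\<integral>\<^sup>+x. ennreal (norm (f x + g x - (s i x + t i x))) \<partial>M) \<le>
        (\<integral>\<^sup>+x. ennreal (norm (f x - s i x)) \<partial>M) + (\<integral>\<^sup>+x. ennreal (norm (g x - t i x)) \<partial>M)" .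
      qed
    qed auto
  qed
qed

lemma has_Bochner_integral_bounded_linear:
  fixes f :: "'a \<Rightarrow> 'b::banach" and A :: "'b \<Rightarrow> 'c::banach"
  assumes A: "bounded_linear A" and f: "has_Bochner_integral M f y"
  shows "has_Bochner_integral M (\<lambda>x. A (f x)) (A y)"
proof -
  interpret A: bounded_linear A by fact
  obtain s where sm: "strongly_measurable M f"
    and s: "\<And>i. Bochner_Integration.simple_bochner_integrable M (s i)"
    "(\<lambda>i::nat. \<integral>\<^sup>+x. ennreal (norm (f x - s i x)) \<partial>M) \<longlonglongrightarrow> 0"
    "(\<lambda>i. Bochner_Integration.simple_bochner_integral M (s i)) \<longlonglongrightarrow> y"
    using f unfolding has_Bochner_integral_def by auto
  have sf: "simple_function M (s i)" for i
    using s(1)[of i] by (auto elim: simple_bochner_integrable.cases)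
  obtain K where K: "0 < K" "\<And>x. norm (A x) \<le> norm x * K"
    using A.pos_bounded by blast
  show ?thesis
    unfolding has_Bochner_integral_def
  proof (intro conjI exI[of _ "\<lambda>i x. A (s i x)"] allI)
    show "strongly_measurable M (\<lambda>x. A (f x))"
      using sm A.tendsto by (rule strongly_measurable_compose1)
    show "Bochner_Integration.simple_bochner_integrable M (\<lambda>x. A (s i x))" for i
      by (rule simple_bochner_integrable_compose2[of "\<lambda>x y. A x", OF _ s(1) s(1)]) (simp add: A.zero)
    have "Bochner_Integration.simple_bochner_integral M (\<lambda>x. A (s i x)) = A (Bochner_Integration.simple_bochner_integral M (s i))" for i
      by (intro simple_bochner_integral_linear s A.linear)
    then show "(\<lambda>i. Bochner_Integration.simple_bochner_integral M (\<lambda>x. A (s i x))) \<longlonglongrightarrow> A y"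
      by (simp add: A.tendsto s)
    have *: "(\<lambda>i. ennreal K * (\<integral>\<^sup>+x. ennreal (norm (f x - s i x)) \<partial>M)) \<longlonglongrightarrow> 0"
      using ennreal_tendsto_cmult[OF _ s(2), of "ennreal K"] by simp
    show "(\<lambda>i. \<integral>\<^sup>+x. ennreal (norm (A (f x) - A (s i x))) \<partial>M) \<longlonglongrightarrow> 0"
    proof (rule tendsto_sandwich[OF _ _ tendsto_const *])
      show "\<forall>\<^sub>F i in sequentially. (\<integral>\<^sup>+x. ennreal (norm (A (f x) - A (s i x))) \<partial>M) \<le>
        ennreal K * (\<integral>\<^sup>+x. ennreal (norm (f x - s i x)) \<partial>M)"
      proof (intro always_eventually allI)
        fix i
        have "(\<integral>\<^sup>+x. ennreal (norm (A (f x) - A (s i x))) \<partial>M) \<le>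
          (\<integral>\<^sup>+x. ennreal K * ennreal (norm (f x - s i x)) \<partial>M)"
        proof (rule nn_integral_mono)
          fix x
          have "norm (A (f x) - A (s i x)) \<le> K * norm (f x - s i x)"
            using K(2)[of "f x - s i x"] by (simp add: A.diff mult.commute)
          then show "ennreal (norm (A (f x) - A (s i x))) \<le> ennreal K * ennreal (norm (f x - s i x))"
            using K(1) by (simp add: ennreal_leI flip: ennreal_mult)
        qed
        also have "\<dots> = ennreal K * (\<integral>\<^sup>+x. ennreal (norm (f x - s i x)) \<partial>M)"
          by (intro nn_integral_cmult measurable_norm_diff_simple sm sf)
        finally show "(\<integral>\<^sup>+x. ennreal (norm (A (f x) - A (s i x))) \<partial>M) \<le>
          ennreal K * (\<integral>\<^sup>+x. ennreal (norm (f x - s i x)) \<partial>M)" .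
      qed
    qed auto
  qed
qed

lemma has_Bochner_integral_zero: "has_Bochner_integral M (\<lambda>x. 0::'b::banach) 0"
proof -
  have "has_Bochner_integral M (\<lambda>x. 0::'b) (Bochner_integral M (\<lambda>x. 0::'b))"
    by (rule has_Bochner_integral_ex) (auto intro: strongly_measurable_zero)
  moreover from has_Bochner_integral_norm_le[OF this] have "Bochner_integral M (\<lambda>x. 0::'b) = 0"
    by simp
  ultimately show ?thesis by simp
qed

lemma has_Bochner_integral_sum:
  fixes f :: "'i \<Rightarrow> 'a \<Rightarrow> 'b::banach"
  assumes "\<And>i. i \<in> I \<Longrightarrow> has_Bochner_integral M (f i) (y i)"
  shows "has_Bochner_integral M (\<lambda>x. \<Sum>i\<in>I. f i x) (\<Sum>i\<in>I. y i)"
  using assms by (induction I rule: infinite_finite_induct)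
    (auto intro: has_Bochner_integral_add has_Bochner_integral_zero)

lemma has_Bochner_integral_diff:
  fixes f g :: "'a \<Rightarrow> 'b::banach"
  assumes "has_Bochner_integral M f y" "has_Bochner_integral M g z"
  shows "has_Bochner_integral M (\<lambda>x. f x - g x) (y - z)"
  using has_Bochner_integral_add[OF assms(1)
      has_Bochner_integral_bounded_linear[OF bounded_linear_minus[OF bounded_linear_ident] assms(2)]]
  by simp

text \<open>The difference of the integrals is bounded by the L^1 distance, which tends to 0 by
  scalar dominated convergence with majorant \<open>2 |w|\<close>.\<close>

lemma Bochner_integral_dominated_convergence:
  fixes f :: "'a \<Rightarrow> 'b::banach" and F :: "nat \<Rightarrow> 'a \<Rightarrow> 'b"
  assumes F: "\<And>i. strongly_measurable M (F i)" and f: "strongly_measurable M f"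
    and w: "integrable M w" "\<And>i. AE x in M. norm (F i x) \<le> w x" "AE x in M. norm (f x) \<le> w x"
    and lim: "AE x in M. (\<lambda>i. F i x) \<longlonglongrightarrow> f x"
  shows "(\<lambda>i. Bochner_integral M (F i)) \<longlonglongrightarrow> Bochner_integral M f"
proof -
  have wfin: "(\<integral>\<^sup>+x. ennreal (norm (w x)) \<partial>M) < \<infinity>"
    using w(1) by (simp add: integrable_iff_bounded)
  have fin: "(\<integral>\<^sup>+x. ennreal (norm (h x)) \<partial>M) < \<infinity>" if "AE x in M. norm (h x) \<le> w x" for h :: "'a \<Rightarrow> 'b"
    using that by (intro le_less_trans[OF nn_integral_mono_AE wfin], eventually_elim) (auto intro!: ennreal_leI)
  have hd: "has_Bochner_integral M (\<lambda>x. F i x - f x) (Bochner_integral M (F i) - Bochner_integral M f)" for i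
    by (intro has_Bochner_integral_diff has_Bochner_integral_ex F f fin w)
  have "(\<lambda>i. \<integral>\<^sup>+x. ennreal (norm (F i x - f x)) \<partial>M) \<longlonglongrightarrow> (\<integral>\<^sup>+x. 0 \<partial>M)"
  proof (rule nn_integral_dominated_convergence)
    show "(\<lambda>x. ennreal (norm (F i x - f x))) \<in> borel_measurable M" for i
      using borel_measurable_norm_strongly_measurable[OF strongly_measurable_diff[OF F f]] by measurable
    show "(\<lambda>x. ennreal (2 * norm (w x))) \<in> borel_measurable M"
      using w(1) by measurable
    have "(\<integral>\<^sup>+x. ennreal (2 * norm (w x)) \<partial>M) = 2 * (\<integral>\<^sup>+x. ennreal (norm (w x)) \<partial>M)"
      using w(1) by (simp add: ennreal_mult nn_integral_cmult)
    then show "(\<integral>\<^sup>+x. ennreal (2 * norm (w x)) \<partial>M) < \<infinity>"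
      using wfin by (simp add: ennreal_mult_less_top)
    show "AE x in M. ennreal (norm (F i x - f x)) \<le> ennreal (2 * norm (w x))" for i
      using w(2)[of i] w(3)
    proof eventually_elim
      case (elim x)
      then show ?case
        using norm_triangle_ineq4[of "F i x" "f x"] by (intro ennreal_leI) (auto simp: abs_if)
    qed
    show "AE x in M. (\<lambda>i. ennreal (norm (F i x - f x))) \<longlonglongrightarrow> 0"
      using lim
    proof eventually_elim
      case (elim x)
      have "(\<lambda>i. ennreal (norm (F i x - f x))) \<longlonglongrightarrow> ennreal (norm (f x - f x))"
        by (intro tendsto_ennrealI tendsto_norm tendsto_diff tendsto_const elim)
      then show ?case by simp
    qed
  qed simp
  then have lim0: "(\<lambda>i. \<integral>\<^sup>+x. ennreal (norm (F i x - f x)) \<partial>M) \<longlonglongrightarrow> 0"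
    by simp
  have "(\<lambda>i. ennreal (norm (Bochner_integral M (F i) - Bochner_integral M f))) \<longlonglongrightarrow> 0"
  proof (rule tendsto_sandwich[OF _ _ tendsto_const lim0])
    show "\<forall>\<^sub>F i in sequentially. ennreal (norm (Bochner_integral M (F i) - Bochner_integral M f))
        \<le> (\<integral>\<^sup>+x. ennreal (norm (F i x - f x)) \<partial>M)"
      by (intro always_eventually allI has_Bochner_integral_norm_le hd)
  qed simp
  then have "(\<lambda>i. ennreal (norm (Bochner_integral M (F i) - Bochner_integral M f))) \<longlonglongrightarrow> ennreal 0"
    by (simp only: ennreal_0)
  then have "(\<lambda>i. norm (Bochner_integral M (F i) - Bochner_integral M f)) \<longlonglongrightarrow> 0"
    by (subst (asm) tendsto_ennreal_iff) auto
  then show ?thesis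
    by (simp add: LIM_zero_cancel tendsto_norm_zero_iff)
qed

lemma has_Bochner_integral_of_integrable:
  fixes f :: "'a \<Rightarrow> 'b::{banach, second_countable_topology}"
  assumes "integrable M f"
  shows "has_Bochner_integral M f (integral\<^sup>L M f)"
proof -
  have "has_bochner_integral M f (integral\<^sup>L M f)"
    using assms by (rule has_bochner_integral_integrable)
  then obtain s where s: "\<And>i. Bochner_Integration.simple_bochner_integrable M (s i)"
    "(\<lambda>i. \<integral>\<^sup>+x. ennreal (norm (f x - s i x)) \<partial>M) \<longlonglongrightarrow> 0"
    "(\<lambda>i. Bochner_Integration.simple_bochner_integral M (s i)) \<longlonglongrightarrow> integral\<^sup>L M f"
    by (auto elim!: has_bochner_integral.cases)
  then show ?thesis
    unfolding has_Bochner_integral_def using assms by (auto intro!: borel_imp_strongly_measurable)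
qed

end

text \<open>The explicit Fourier transforms below are finite sums of scalar functions times fixed
  vectors; this reduces them to scalar integrals.\<close>

lemma Bochner_integral_scaleC_right:
  assumes "complete_measure M" and u: "integrable M u"
  shows "has_Bochner_integral M (\<lambda>x. u x *\<^sub>C (y::'b::complex_banach)) (integral\<^sup>L M u *\<^sub>C y)"
proof -
  interpret complete_measure M by fact
  show ?thesis
    using has_Bochner_integral_bounded_linear[OF scaleC.bounded_linear_left has_Bochner_integral_of_integrable[OF u]]
    by blast
qed

section \<open>Smoothed indicator of the unit interval\<close>

text \<open>The centred normal density of variance \<open>e^2 / (2 pi)\<close>, normalised so that
  its Fourier transform at \<open>t\<close> is \<open>exp (- pi e^2 t^2)\<close>.\<close>

definition gauss :: "real \<Rightarrow> real \<Rightarrow> real" where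
  "gauss e w = exp (- pi * w\<^sup>2 / e\<^sup>2) / e"

lemma gauss_nonneg: "0 < e \<Longrightarrow> 0 \<le> gauss e w"
  by (simp add: gauss_def)

lemma gauss_eq_normal_density: "0 < e \<Longrightarrow> gauss e = normal_density 0 (e / sqrt (2 * pi))"
  by (auto simp: gauss_def normal_density_def fun_eq_iff power_divide real_sqrt_divide field_simps)

lemma integrable_gauss: "0 < e \<Longrightarrow> integrable lborel (gauss e)"
  by (simp add: gauss_eq_normal_density integrable_normal_density)

lemma integral_gauss: "0 < e \<Longrightarrow> integral\<^sup>L lborel (gauss e) = 1"
  by (simp add: gauss_eq_normal_density integral_normal_density)

lemma exp_neg_le: "0 \<le> y \<Longrightarrow> exp (- y) \<le> 1 / (1 + y)" for y :: real
  using exp_ge_add_one_self[of y] by (simp add: exp_minus field_simps add_pos_nonneg)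

text \<open>In the scaled variable \<open>z = |w| / e\<close> the absolute value of the derivative
  is \<open>2 pi / e^2\<close> times \<open>z exp (- pi z^2)\<close>, and the latter is at most
  1.\<close>

lemma gauss_lipschitz:
  assumes "0 < e"
  shows "\<bar>gauss e x - gauss e y\<bar> \<le> 2 * pi / e\<^sup>2 * \<bar>x - y\<bar>"
proof -
  have "norm (gauss e x - gauss e y) \<le> (2 * pi / e\<^sup>2) * norm (x - y)"
  proof (rule field_differentiable_bound[where S=UNIV and f'="\<lambda>w. (- 2 * pi * w / e\<^sup>2) * gauss e w"])
    show "(gauss e has_field_derivative (- 2 * pi * w / e\<^sup>2) * gauss e w) (at w within UNIV)" for w
      unfolding gauss_def[abs_def] using assms
      by (auto intro!: derivative_eq_intros simp: field_simps power2_eq_square)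
    show "norm ((- 2 * pi * w / e\<^sup>2) * gauss e w) \<le> 2 * pi / e\<^sup>2" for w
    proof -
      define z where "z = \<bar>w\<bar> / e"
      have z: "0 \<le> z" using assms by (simp add: z_def)
      have "exp (- (pi * z\<^sup>2)) \<le> 1 / (1 + pi * z\<^sup>2)"
        using exp_neg_le[of "pi * z\<^sup>2"] by simp
      then have "z * exp (- (pi * z\<^sup>2)) \<le> z / (1 + pi * z\<^sup>2)"
        using mult_left_mono[OF _ z] by fastforce
      also have "\<dots> \<le> 1"
      proof -
        have "2 * z \<le> 1 + z\<^sup>2"
          using zero_le_power2[of "z - 1"] by (simp add: power2_eq_square algebra_simps)
        moreover have "z\<^sup>2 \<le> pi * z\<^sup>2"
          using pi_ge_two mult_right_mono[of 1 pi "z\<^sup>2"] by simp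
        ultimately have "z \<le> 1 + pi * z\<^sup>2"
          using z by linarith
        then show ?thesis
          by (subst divide_le_eq_1_pos) (auto intro: add_pos_nonneg)
      qed
      finally have "z * exp (- (pi * z\<^sup>2)) \<le> 1" .
      then have "2 * pi / e\<^sup>2 * (z * exp (- (pi * z\<^sup>2))) \<le> 2 * pi / e\<^sup>2 * 1"
        by (intro mult_left_mono) auto
      moreover have "norm ((- 2 * pi * w / e\<^sup>2) * gauss e w) = 2 * pi / e\<^sup>2 * (z * exp (- (pi * z\<^sup>2)))"
        using assms by (simp add: gauss_def z_def abs_mult power_divide field_simps)
      ultimately show ?thesis by linarith
    qed
  qed auto
  then show ?thesis by simp
qed

text \<open>Chebyshev's inequality with the second moment \<open>e^2 / (2 pi)\<close>.\<close>

lemma gauss_integral_tail: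
  assumes "0 < e" "0 < \<delta>"
  shows "(LINT x|lborel. gauss e x * indicator {x. \<delta> \<le> \<bar>x\<bar>} x) \<le> e\<^sup>2 / \<delta>\<^sup>2"
proof -
  have *: "has_bochner_integral lborel (\<lambda>x. gauss e x * x\<^sup>2) (e\<^sup>2 / (2 * pi))"
    using normal_moment_even[of "e / sqrt (2 * pi)" 0 1] assms
    by (simp add: gauss_eq_normal_density power_divide fact_2)
  have "(LINT x|lborel. gauss e x * indicator {x. \<delta> \<le> \<bar>x\<bar>} x) \<le> (LINT x|lborel. gauss e x * x\<^sup>2 / \<delta>\<^sup>2)"
  proof (rule integral_mono)
    show "integrable lborel (\<lambda>x. gauss e x * indicator {x. \<delta> \<le> \<bar>x\<bar>} x)"
      using assms integrable_gauss by (intro integrable_real_mult_indicator) auto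
    show "integrable lborel (\<lambda>x. gauss e x * x\<^sup>2 / \<delta>\<^sup>2)"
      using * by (intro integrable_divide) (simp add: has_bochner_integral_iff)
    have "x\<^sup>2 / \<delta>\<^sup>2 \<ge> 1" if "\<delta> \<le> \<bar>x\<bar>" for x
      using that assms power_mono[of \<delta> "\<bar>x\<bar>" 2] by simp
    then show "gauss e x * indicator {x. \<delta> \<le> \<bar>x\<bar>} x \<le> gauss e x * x\<^sup>2 / \<delta>\<^sup>2" for x
      using mult_left_mono[OF _ gauss_nonneg[OF assms(1)], of 1 "x\<^sup>2 / \<delta>\<^sup>2" x]
      by (auto simp: indicator_def gauss_nonneg assms)
  qed
  also have "\<dots> = e\<^sup>2 / (2 * pi) / \<delta>\<^sup>2"
    using has_bochner_integral_integral_eq[OF *] by simp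
  also have "\<dots> \<le> e\<^sup>2 / 1 / \<delta>\<^sup>2"
    using pi_ge_two by (intro divide_right_mono divide_left_mono) auto
  finally show ?thesis by simp
qed

text \<open>Each sample point is charged with the cell of length \<open>1 / M\<close> to its left.
  There the Gaussian varies by at most its Lipschitz constant times \<open>1 / M\<close>, so every
  cell contributes an error of at most \<open>2 pi / e^2 / M^2\<close>. For \<open>J = M\<close> the
  integral is the convolution of the Gaussian with the indicator of the unit interval.\<close>

lemma gauss_riemann_sum:
  assumes e: "0 < e" and M: "0 < M"
  shows "\<bar>(\<Sum>j<J. gauss e (v - real j / real M) / real M) -
    (LINT x|lborel. gauss e x * indicator {v - real J / real M <.. v} x)\<bar> \<le> real J * (2 * pi / e\<^sup>2 / (real M)\<^sup>2)"
proof (induction J)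
  case 0
  then show ?case by simp
next
  case (Suc J)
  define c where "c = v - real J / real M"
  define d where "d = v - real (Suc J) / real M"
  have cd: "c - d = 1 / real M" "d < c" "c \<le> v"
    using M by (auto simp: c_def d_def field_simps)
  have int: "integrable lborel (\<lambda>x. gauss e x * indicator {a<..b} x)" for a b :: real
    using integrable_gauss[OF e] by (intro integrable_real_mult_indicator) auto
  have ind: "integrable lborel (\<lambda>x. indicator {d<..c} x :: real)"
    using cd by (intro integrable_real_indicator) auto
  have int1: "integrable lborel (\<lambda>x. gauss e c * indicator {d<..c} x)"
    using ind by (rule integrable_mult_right)
  have "(LINT x|lborel. gauss e x * indicator {d<..v} x) =
     (LINT x|lborel. gauss e x * indicator {c<..v} x + gauss e x * indicator {d<..c} x)"
    using cd by (intro Bochner_Integration.integral_cong) (auto simp: indicator_def)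
  also have "\<dots> = (LINT x|lborel. gauss e x * indicator {c<..v} x) + (LINT x|lborel. gauss e x * indicator {d<..c} x)"
    using int int by (rule Bochner_Integration.integral_add)
  finally have split: "(LINT x|lborel. gauss e x * indicator {d<..v} x) = \<dots>" .
  have c_int: "gauss e c / real M = (LINT x|lborel. gauss e c * indicator {d<..c} x)"
    using cd by simp
  have d_int: "(LINT x|lborel. gauss e c * indicator {d<..c} x) - (LINT x|lborel. gauss e x * indicator {d<..c} x) =
    (LINT x|lborel. gauss e c * indicator {d<..c} x - gauss e x * indicator {d<..c} x)"
    using int1 int by (rule Bochner_Integration.integral_diff[symmetric])
  have "\<bar>gauss e c / real M - (LINT x|lborel. gauss e x * indicator {d<..c} x)\<bar> =
      norm (LINT x|lborel. gauss e c * indicator {d<..c} x - gauss e x * indicator {d<..c} x)"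
    by (simp only: real_norm_def c_int d_int)
  also have "\<dots> \<le> (LINT x|lborel. norm (gauss e c * indicator {d<..c} x - gauss e x * indicator {d<..c} x))"
    by (rule integral_norm_bound)
  also have "\<dots> \<le> (LINT x|lborel. (2 * pi / e\<^sup>2 / real M) * indicator {d<..c} x)"
  proof (rule integral_mono)
    show "integrable lborel (\<lambda>x. norm (gauss e c * indicator {d<..c} x - gauss e x * indicator {d<..c} x))"
      by (intro integrable_norm Bochner_Integration.integrable_diff int1 int)
    show "integrable lborel (\<lambda>x. (2 * pi / e\<^sup>2 / real M) * indicator {d<..c} x)"
      using ind by (rule integrable_mult_right)
    fix x
    have "\<bar>gauss e c - gauss e x\<bar> \<le> 2 * pi / e\<^sup>2 / real M" if "x \<in> {d<..c}"
    proof -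
      have "\<bar>gauss e c - gauss e x\<bar> \<le> 2 * pi / e\<^sup>2 * \<bar>c - x\<bar>"
        by (rule gauss_lipschitz[OF e])
      also have "\<dots> \<le> 2 * pi / e\<^sup>2 * (1 / real M)"
        using that cd by (intro mult_left_mono) auto
      finally show ?thesis by simp
    qed
    then show "norm (gauss e c * indicator {d<..c} x - gauss e x * indicator {d<..c} x) \<le> (2 * pi / e\<^sup>2 / real M) * indicator {d<..c} x"
      by (auto simp: indicator_def)
  qed
  also have "\<dots> = 2 * pi / e\<^sup>2 / (real M)\<^sup>2"
    using cd by (simp add: power2_eq_square)
  finally have "\<bar>gauss e c / real M - (LINT x|lborel. gauss e x * indicator {d<..c} x)\<bar> \<le> 2 * pi / e\<^sup>2 / (real M)\<^sup>2" .
  moreover have "\<bar>(\<Sum>j<J. gauss e (v - real j / real M) / real M) - (LINT x|lborel. gauss e x * indicator {c<..v} x)\<bar> \<le> real J * (2 * pi / e\<^sup>2 / (real M)\<^sup>2)"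
    using Suc by (simp add: c_def)
  ultimately have "\<bar>(\<Sum>j<Suc J. gauss e (v - real j / real M) / real M) - (LINT x|lborel. gauss e x * indicator {d<..v} x)\<bar>
    \<le> real J * (2 * pi / e\<^sup>2 / (real M)\<^sup>2) + 2 * pi / e\<^sup>2 / (real M)\<^sup>2"
    unfolding split by (simp add: c_def[symmetric])
  moreover have "real (Suc J) * (2 * pi / e\<^sup>2 / (real M)\<^sup>2) = real J * (2 * pi / e\<^sup>2 / (real M)\<^sup>2) + 2 * pi / e\<^sup>2 / (real M)\<^sup>2"
    by (simp only: of_nat_Suc distrib_right mult_1)
  ultimately show ?case
    by (simp only: d_def)
qed

definition wid :: "nat \<Rightarrow> real" where "wid n = 1 / real (Suc n)"
text \<open>With \<open>M\<close> nodes the error of the Riemann sum is at most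
  \<open>2 pi (n + 1)^2 / M\<close>. The cube leaves \<open>1 / (n + 1)\<close>, that is
  \<open>wid n\<close>, and 7 exceeds \<open>2 pi\<close>. The number must also be large for the
  decay of \<open>box_kernel\<close>, because a sum with few nodes would return to size 1 too
  early.\<close>

definition nodes :: "nat \<Rightarrow> nat" where "nodes n = 7 * Suc n ^ 3"

text \<open>A Riemann sum is used instead of the convolution of the indicator with the Gaussian, so that
  \<open>box_kernel\<close> is a finite sum of modulated Gaussians.\<close>

definition box_symbol :: "nat \<Rightarrow> real \<Rightarrow> real" where
  "box_symbol n v = (\<Sum>j<nodes n. gauss (wid n) (v - real j / real (nodes n)) / real (nodes n))"

definition box_kernel :: "nat \<Rightarrow> real \<Rightarrow> complex" where
  "box_kernel n t = exp (- pi * (wid n)\<^sup>2 * t\<^sup>2) *\<^sub>R ((\<Sum>j<nodes n. cis (2 * pi * (t * (real j / real (nodes n))))) / real (nodes n))"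

lemma wid: "0 < wid n" "wid n \<le> 1"
  by (auto simp: wid_def)

lemma nodes_pos: "0 < nodes n"
  by (simp add: nodes_def)

lemma box_symbol_nonneg: "0 \<le> box_symbol n v"
  unfolding box_symbol_def by (intro sum_nonneg divide_nonneg_nonneg gauss_nonneg wid) auto

lemma box_symbol_integral:
  "\<bar>box_symbol n v - (LINT x|lborel. gauss (wid n) x * indicator {v - 1 <.. v} x)\<bar> \<le> wid n"
proof -
  have "real (nodes n) * (2 * pi / (wid n)\<^sup>2 / (real (nodes n))\<^sup>2) = 2 * pi / (wid n)\<^sup>2 / real (nodes n)"
    using nodes_pos[of n] by (simp add: power2_eq_square)
  also have "\<dots> = (2 * pi / 7) / real (Suc n)"
  proof -
    have "2 * pi / (1 / k)\<^sup>2 / (7 * k ^ 3) = 2 * pi / 7 / k" if "0 < k" for k :: real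
      using that by (simp add: power2_eq_square power3_eq_cube field_simps)
    from this[of "real (Suc n)"] show ?thesis
      by (simp add: nodes_def wid_def)
  qed
  also have "\<dots> \<le> 1 / real (Suc n)"
    using pi_approx by (intro divide_right_mono) (auto simp: pi_def)
  finally have "real (nodes n) * (2 * pi / (wid n)\<^sup>2 / (real (nodes n))\<^sup>2) \<le> wid n"
    by (simp add: wid_def)
  with gauss_riemann_sum[OF wid(1)[of n] nodes_pos[of n], where J="nodes n" and v=v] nodes_pos[of n] show ?thesis
    by (simp add: box_symbol_def)
qed

text \<open>The total mass 1 of the Gaussian plus the error of the Riemann sum, which is at most
  \<open>wid n\<close> and hence at most 1.\<close>

lemma box_symbol_le_2: "box_symbol n v \<le> 2"
proof -
  have "(LINT x|lborel. gauss (wid n) x * indicator {v - 1 <.. v} x) \<le> (LINT x|lborel. gauss (wid n) x)"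
    using wid[of n] by (intro integral_mono integrable_real_mult_indicator integrable_gauss)
      (auto simp: indicator_def gauss_nonneg)
  with integral_gauss[OF wid(1)[of n]] box_symbol_integral[of n v] wid[of n] show ?thesis
    by linarith
qed

text \<open>The value is an average of the Gaussian over points \<open>v - u\<close> with
  \<open>u\<close> in \<open>[0,1)\<close>; all of them have distance at least
  \<open>\<delta>\<close> from 0.\<close>

lemma box_symbol_tail:
  assumes "0 \<le> \<delta>" "\<And>u. 0 \<le> u \<Longrightarrow> u \<le> 1 \<Longrightarrow> \<delta> \<le> \<bar>v - u\<bar>"
  shows "box_symbol n v \<le> gauss (wid n) \<delta>"
proof -
  have "box_symbol n v \<le> (\<Sum>j<nodes n. gauss (wid n) \<delta> / real (nodes n))"
    unfolding box_symbol_def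
  proof (intro sum_mono divide_right_mono)
    fix j assume "j \<in> {..<nodes n}"
    then have "\<delta> \<le> \<bar>v - real j / real (nodes n)\<bar>"
      using assms by auto
    then have "\<delta>\<^sup>2 \<le> (v - real j / real (nodes n))\<^sup>2"
      using assms(1) by (metis abs_ge_zero abs_of_nonneg abs_le_square_iff)
    then show "gauss (wid n) (v - real j / real (nodes n)) \<le> gauss (wid n) \<delta>"
      using wid[of n] by (auto simp: gauss_def intro!: divide_right_mono mult_left_mono)
  qed auto
  also have "\<dots> = gauss (wid n) \<delta>"
    using nodes_pos[of n] by simp
  finally show ?thesis .
qed

lemma tendsto_wid: "wid \<longlonglongrightarrow> 0"
  unfolding wid_def[abs_def] by real_asymp

lemma gauss_wid_tendsto_0:
  assumes "0 < \<delta>" shows "(\<lambda>n. gauss (wid n) \<delta>) \<longlonglongrightarrow> 0"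
proof -
  have "(\<lambda>n. exp (- pi * \<delta>\<^sup>2 * (real (Suc n))\<^sup>2) * real (Suc n)) \<longlonglongrightarrow> 0"
    using assms by real_asymp
  then show ?thesis
    by (simp add: gauss_def wid_def power_divide)
qed

lemma box_symbol_tendsto_0:
  assumes "v < 0 \<or> 1 < v" shows "(\<lambda>n. box_symbol n v) \<longlonglongrightarrow> 0"
proof -
  define \<delta> where "\<delta> = (if v < 0 then - v else v - 1)"
  have \<delta>: "0 < \<delta>" using assms by (auto simp: \<delta>_def)
  show ?thesis
  proof (rule tendsto_sandwich[OF _ _ tendsto_const gauss_wid_tendsto_0[OF \<delta>]])
    show "\<forall>\<^sub>F n in sequentially. box_symbol n v \<le> gauss (wid n) \<delta>"
      using assms by (intro always_eventually allI box_symbol_tail) (auto simp: \<delta>_def)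
  qed (simp add: box_symbol_nonneg)
qed

lemma box_symbol_tendsto_1:
  assumes "0 < v" "v < 1" shows "(\<lambda>n. box_symbol n v) \<longlonglongrightarrow> 1"
proof -
  define \<delta> where "\<delta> = min v (1 - v)"
  have \<delta>: "0 < \<delta>" using assms by (auto simp: \<delta>_def)
  \<comment> \<open>By the choice of \<open>\<delta>\<close> the interval \<open>{v - 1<..v}\<close>
    contains every \<open>x\<close> with \<open>|x| < \<delta>\<close>, so the mass it misses is at
    most a Gaussian tail.\<close>
  have low: "1 - (wid n)\<^sup>2 / \<delta>\<^sup>2 - wid n \<le> box_symbol n v" for n
  proof -
    have int: "integrable lborel (\<lambda>x. gauss (wid n) x * indicator A x)" if "A \<in> sets borel" for A
      using that integrable_gauss[OF wid(1)] by (intro integrable_real_mult_indicator) auto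
    have "1 = (LINT x|lborel. gauss (wid n) x)"
      using integral_gauss[OF wid(1)] by simp
    also have "\<dots> \<le> (LINT x|lborel. gauss (wid n) x * indicator {v - 1<..v} x + gauss (wid n) x * indicator {x. \<delta> \<le> \<bar>x\<bar>} x)"
      using assms
      by (intro integral_mono integrable_gauss wid Bochner_Integration.integrable_add int)
        (auto simp: indicator_def gauss_nonneg wid \<delta>_def)
    also have "\<dots> = (LINT x|lborel. gauss (wid n) x * indicator {v - 1<..v} x) +
        (LINT x|lborel. gauss (wid n) x * indicator {x. \<delta> \<le> \<bar>x\<bar>} x)"
      by (intro Bochner_Integration.integral_add int) auto
    also have "\<dots> \<le> (LINT x|lborel. gauss (wid n) x * indicator {v - 1<..v} x) + (wid n)\<^sup>2 / \<delta>\<^sup>2"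
      by (intro add_left_mono gauss_integral_tail wid \<delta>)
    finally show ?thesis
      using box_symbol_integral[of n v] by linarith
  qed
  have up: "box_symbol n v \<le> 1 + wid n" for n
  proof -
    have "(LINT x|lborel. gauss (wid n) x * indicator {v - 1 <.. v} x) \<le> (LINT x|lborel. gauss (wid n) x)"
      using wid[of n] by (intro integral_mono integrable_real_mult_indicator integrable_gauss)
        (auto simp: indicator_def gauss_nonneg)
    with integral_gauss[OF wid(1)[of n]] box_symbol_integral[of n v] show ?thesis
      by linarith
  qed
  have "(\<lambda>n. 1 - (wid n)\<^sup>2 / \<delta>\<^sup>2 - wid n) \<longlonglongrightarrow> 1 - 0\<^sup>2 / \<delta>\<^sup>2 - 0"
    using \<delta> by (intro tendsto_intros tendsto_wid) auto
  moreover have "(\<lambda>n. 1 + wid n) \<longlonglongrightarrow> 1 + 0"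
    by (intro tendsto_intros tendsto_wid)
  ultimately show ?thesis
    using low up by (intro tendsto_sandwich[of "\<lambda>n. 1 - (wid n)\<^sup>2 / \<delta>\<^sup>2 - wid n" "\<lambda>n. box_symbol n v" sequentially "\<lambda>n. 1 + wid n" 1])
      simp_all
qed

lemma bounded_power_exp:
  assumes c: "0 < c"
  shows "\<exists>B. \<forall>y\<ge>0. (1 + y) ^ N * exp (- c * y\<^sup>2) \<le> (B::real)"
proof -
  have "((\<lambda>y::real. (1 + y) ^ N * exp (- c * y\<^sup>2)) \<longlongrightarrow> 0) at_top"
    using c by real_asymp
  then have "\<forall>\<^sub>F y in at_top. (1 + y) ^ N * exp (- c * y\<^sup>2) < (1::real)"
    by (rule order_tendstoD) simp
  then obtain R where R: "\<And>y. y \<ge> R \<Longrightarrow> (1 + y) ^ N * exp (- c * y\<^sup>2) < (1::real)"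
    unfolding eventually_at_top_linorder by blast
  define h where "h y = (1 + y) ^ N * exp (- c * y\<^sup>2)" for y :: real
  have "compact (h ` {0..R})"
    unfolding h_def by (intro compact_continuous_image continuous_intros) auto
  then have "bdd_above (h ` {0..R})"
    by (intro bounded_imp_bdd_above compact_imp_bounded)
  then obtain B where "\<And>y. y \<in> {0..R} \<Longrightarrow> h y \<le> B"
    unfolding bdd_above_def by blast
  then have B: "\<And>y. y \<in> {0..R} \<Longrightarrow> (1 + y) ^ N * exp (- c * y\<^sup>2) \<le> B"
    by (simp only: h_def)
  show ?thesis
  proof (intro exI allI impI)
    fix y :: real assume "0 \<le> y"
    then show "(1 + y) ^ N * exp (- c * y\<^sup>2) \<le> max B 1"
      using R[of y] B[of y] by (cases "y \<le> R") (auto simp: max_def)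
  qed
qed

text \<open>Uniformity in \<open>n\<close> is the point. For \<open>|v| > 2\<close> every node is at
  distance at least \<open>|v| / 2\<close> from \<open>v\<close>, and the prefactor
  \<open>1 / wid n\<close> of the Gaussian is absorbed into the scaled variable \<open>y\<close>,
  which is at least \<open>1 / wid n\<close>. Near the origin the crude bound 2 suffices.\<close>

lemma box_symbol_decay: "\<exists>C. \<forall>n v. box_symbol n v * (1 + \<bar>v\<bar>) ^ N \<le> C"
proof -
  obtain C where C': "\<And>y. y \<ge> 0 \<Longrightarrow> (1 + y) ^ Suc N * exp (- (pi / 4) * y\<^sup>2) \<le> (C::real)"
    using bounded_power_exp[of "pi / 4" "Suc N"] by auto
  have C: "y * (1 + y) ^ N * exp (- pi * y\<^sup>2 / 4) \<le> C" if "0 \<le> y" for y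
  proof -
    have "y * (1 + y) ^ N * exp (- pi * y\<^sup>2 / 4) \<le> (1 + y) * (1 + y) ^ N * exp (- pi * y\<^sup>2 / 4)"
      using that by (intro mult_right_mono) auto
    also have "\<dots> = (1 + y) ^ Suc N * exp (- (pi / 4) * y\<^sup>2)"
      by simp
    finally show ?thesis
      using C'[OF that] by linarith
  qed
  show ?thesis
  proof (intro exI allI)
    fix n v
    show "box_symbol n v * (1 + \<bar>v\<bar>) ^ N \<le> max (2 * 3 ^ N) C"
    proof (cases "\<bar>v\<bar> \<le> 2")
      case True
      then have "box_symbol n v * (1 + \<bar>v\<bar>) ^ N \<le> 2 * 3 ^ N"
        by (intro mult_mono box_symbol_le_2 power_mono) (auto simp: box_symbol_nonneg)
      then show ?thesis by simp
    next
      case False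
      define y where "y = \<bar>v\<bar> / wid n"
      have "\<bar>v\<bar> * wid n \<le> \<bar>v\<bar> * 1"
        using wid[of n] by (intro mult_left_mono) auto
      then have vy: "\<bar>v\<bar> \<le> y"
        using wid[of n] by (simp add: y_def field_simps)
      have "1 \<le> \<bar>v\<bar>" using False by simp
      then have wy: "1 / wid n \<le> y"
        using wid[of n] by (simp add: y_def divide_right_mono)
      have "box_symbol n v \<le> gauss (wid n) (\<bar>v\<bar> / 2)"
      proof (rule box_symbol_tail)
        show "\<bar>v\<bar> / 2 \<le> \<bar>v - u\<bar>" if "0 \<le> u" "u \<le> 1" for u
          using that False by linarith
      qed simp
      also have "\<dots> = exp (- pi * y\<^sup>2 / 4) * (1 / wid n)"
        using wid[of n] by (simp add: gauss_def y_def power_divide field_simps)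
      also have "\<dots> \<le> exp (- pi * y\<^sup>2 / 4) * y"
        using wy by (intro mult_left_mono) auto
      finally have "box_symbol n v * (1 + \<bar>v\<bar>) ^ N \<le> (exp (- pi * y\<^sup>2 / 4) * y) * (1 + y) ^ N"
        using vy by (intro mult_mono power_mono) (auto simp: box_symbol_nonneg)
      also have "\<dots> \<le> C"
        using C[of y] vy by (simp add: mult_ac)
      finally show ?thesis by simp
    qed
  qed
qed

section \<open>Fourier transform of the smoothed kernel\<close>

lemma integrable_gaussian_exp:
  assumes "0 < (c::real)" shows "integrable lborel (\<lambda>t. exp (- c * t\<^sup>2))"
proof -
  have "integrable lborel (\<lambda>t. gauss (sqrt (pi / c)) t * sqrt (pi / c))"
    using assms by (intro integrable_mult_left integrable_gauss) auto
  then show ?thesis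
    using assms by (simp add: gauss_def mult.commute)
qed

text \<open>The characteristic function of the standard normal distribution at
  \<open>\<tau> = 2 pi b / s\<close>, after the substitution \<open>x = s t\<close> with
  \<open>s = sqrt (2 pi) e\<close>.\<close>

lemma integral_modulated_gaussian:
  assumes e: "0 < (e::real)"
  shows "(LINT t|lborel. exp (- pi * e\<^sup>2 * t\<^sup>2) *\<^sub>R cis (2 * pi * (b * t))) = of_real (gauss e b)"
proof -
  define s where "s = sqrt (2 * pi) * e"
  have s: "0 < s" using e by (simp add: s_def)
  have s2: "s\<^sup>2 = 2 * pi * e\<^sup>2" by (simp add: s_def power_mult_distrib)
  define \<tau> where "\<tau> = 2 * pi * b / s"
  have "of_real (exp (- (\<tau>\<^sup>2) / 2)) = char std_normal_distribution \<tau>"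
    by (simp add: char_std_normal_distribution)
  also have "\<dots> = (LINT x|lborel. std_normal_density x *\<^sub>R iexp (\<tau> * x))"
    unfolding char_def by (subst integral_density) (auto simp: normal_density_nonneg)
  also have "\<dots> = \<bar>s\<bar> *\<^sub>R (LINT t|lborel. std_normal_density (0 + s * t) *\<^sub>R iexp (\<tau> * (0 + s * t)))"
    using s by (intro lborel_integral_real_affine) auto
  also have "\<dots> = \<bar>s\<bar> *\<^sub>R (LINT t|lborel. (1 / sqrt (2 * pi)) *\<^sub>R (exp (- pi * e\<^sup>2 * t\<^sup>2) *\<^sub>R cis (2 * pi * (b * t))))"
  proof (intro arg_cong[where f="\<lambda>x. \<bar>s\<bar> *\<^sub>R x"] Bochner_Integration.integral_cong refl)
    fix t
    have "\<tau> * (0 + s * t) = 2 * pi * (b * t)"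
      using s by (simp add: \<tau>_def)
    moreover have "std_normal_density (0 + s * t) = (1 / sqrt (2 * pi)) * exp (- pi * e\<^sup>2 * t\<^sup>2)"
      by (simp add: std_normal_density_def power_mult_distrib s2)
    ultimately show "std_normal_density (0 + s * t) *\<^sub>R iexp (\<tau> * (0 + s * t)) =
        (1 / sqrt (2 * pi)) *\<^sub>R (exp (- pi * e\<^sup>2 * t\<^sup>2) *\<^sub>R cis (2 * pi * (b * t)))"
      by (simp only: cis_conv_exp scaleR_scaleR)
  qed
  also have "\<dots> = e *\<^sub>R (LINT t|lborel. exp (- pi * e\<^sup>2 * t\<^sup>2) *\<^sub>R cis (2 * pi * (b * t)))"
    using s by (subst integral_scaleR_right) (simp add: s_def)
  finally have "e *\<^sub>R (LINT t|lborel. exp (- pi * e\<^sup>2 * t\<^sup>2) *\<^sub>R cis (2 * pi * (b * t))) = of_real (exp (- (\<tau>\<^sup>2) / 2))"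
    by simp
  moreover have "\<tau>\<^sup>2 / 2 = pi * b\<^sup>2 / e\<^sup>2"
    using e unfolding \<tau>_def power_divide power_mult_distrib s2 by (simp add: power2_eq_square)
  ultimately show ?thesis
    using e by (simp add: gauss_def scaleR_conv_of_real field_simps)
qed

lemma integrable_modulated_gaussian:
  assumes e: "0 < (e::real)"
  shows "integrable lborel (\<lambda>t. exp (- pi * e\<^sup>2 * t\<^sup>2) *\<^sub>R cis (2 * pi * (b * t)))"
proof (rule Bochner_Integration.integrable_bound)
  show "integrable lborel (\<lambda>t. exp (- (pi * e\<^sup>2) * t\<^sup>2))"
    using e by (intro integrable_gaussian_exp) auto
  show "AE t in lborel. norm (exp (- pi * e\<^sup>2 * t\<^sup>2) *\<^sub>R cis (2 * pi * (b * t))) \<le> norm (exp (- (pi * e\<^sup>2) * t\<^sup>2))"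
    by auto
  have "continuous_on UNIV (\<lambda>t. exp (- pi * e\<^sup>2 * t\<^sup>2) *\<^sub>R cis (2 * pi * (b * t)))"
    by (intro continuous_intros)
  then show "(\<lambda>t. exp (- pi * e\<^sup>2 * t\<^sup>2) *\<^sub>R cis (2 * pi * (b * t))) \<in> borel_measurable lborel"
    by (simp add: borel_measurable_continuous_onI)
qed

lemma box_kernel_modulate:
  "cis (- 2 * pi * (v * t)) * box_kernel n t =
    (\<Sum>j<nodes n. (exp (- pi * (wid n)\<^sup>2 * t\<^sup>2) *\<^sub>R cis (2 * pi * ((real j / real (nodes n) - v) * t))) / real (nodes n))"
proof -
  have *: "cis (2 * pi * ((b - v) * t)) = cis (- 2 * pi * (v * t)) * cis (2 * pi * (t * b))" for b
    by (simp add: cis_mult algebra_simps)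
  show ?thesis
    unfolding * box_kernel_def
    by (simp add: sum_distrib_left sum_divide_distrib scaleR_conv_of_real mult_ac)
qed

lemma integrable_box_kernel: "integrable lborel (\<lambda>t. cis (- 2 * pi * (v * t)) * box_kernel n t)"
  unfolding box_kernel_modulate
  by (intro Bochner_Integration.integrable_sum integrable_divide integrable_modulated_gaussian wid)

text \<open>Each term is a modulated Gaussian with frequency \<open>j / nodes n - v\<close>, and the
  Gaussian is even. This closed form replaces Fourier inversion.\<close>

lemma integral_box_kernel: "(LINT t|lborel. cis (- 2 * pi * (v * t)) * box_kernel n t) = of_real (box_symbol n v)"
proof -
  have "(LINT t|lborel. cis (- 2 * pi * (v * t)) * box_kernel n t) =
    (\<Sum>j<nodes n. of_real (gauss (wid n) (real j / real (nodes n) - v)) / real (nodes n))"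
    unfolding box_kernel_modulate
    by (subst Bochner_Integration.integral_sum)
      (simp_all add: integrable_divide integrable_modulated_gaussian[OF wid(1), simplified]
        integral_modulated_gaussian[OF wid(1), simplified])
  also have "\<dots> = of_real (box_symbol n v)"
    by (simp add: box_symbol_def gauss_def power2_commute)
  finally show ?thesis .
qed

section \<open>Pointwise decay of the smoothed kernel\<close>

lemma norm_cis_minus_1: "norm (cis x - 1) = 2 * \<bar>sin (x / 2)\<bar>"
proof -
  have "(norm (cis x - 1))\<^sup>2 = (cos x - 1)\<^sup>2 + (sin x)\<^sup>2"
    by (simp add: cmod_power2)
  also have "\<dots> = 2 - 2 * cos x"
    using sin_cos_squared_add[of x] by (simp add: power2_eq_square algebra_simps)
  also have "\<dots> = (2 * \<bar>sin (x / 2)\<bar>)\<^sup>2"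
    using cos_double_sin[of "x / 2"] by (simp add: power_mult_distrib)
  finally show ?thesis
    by (rule power2_eq_imp_eq) auto
qed

text \<open>A weak form of Jordan's inequality: the third-order Taylor bound gives
  \<open>sin x >= x - x^3 / 6 >= x / 2\<close> on this range.\<close>

lemma sin_lower_bound:
  assumes "0 \<le> x" "x \<le> pi / 2" shows "x / pi \<le> sin x"
proof -
  have "\<bar>sin x - (\<Sum>m<3. sin_coeff m * x ^ m)\<bar> \<le> inverse (fact 3) * \<bar>x\<bar> ^ 3"
    by (rule Maclaurin_sin_bound)
  then have "x - x ^ 3 / 6 \<le> sin x"
    using assms by (simp add: sin_coeff_def numeral_3_eq_3 fact_numeral abs_le_iff field_simps abs_if split: if_splits)
  moreover have "x ^ 3 / 6 \<le> x / 2"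
  proof -
    have "pi / 2 \<le> 16 / 10" using pi_less_4 pi_approx by simp
    then have "x * x \<le> (16/10) * (16/10)" using assms by (intro mult_mono) auto
    then have "x * (x * x) \<le> x * 3" using assms by (intro mult_left_mono) auto
    then show ?thesis by (simp add: power3_eq_cube)
  qed
  moreover have "x / pi \<le> x / 2"
    using assms pi_ge_two by (intro divide_left_mono) auto
  ultimately show ?thesis by linarith
qed

lemma norm_box_kernel_le_1: "norm (box_kernel n t) \<le> 1"
proof -
  have "norm (\<Sum>j<nodes n. cis (2 * pi * (t * (real j / real (nodes n))))) \<le> (\<Sum>j<nodes n. 1)"
    by (intro order_trans[OF norm_sum] sum_mono) simp
  then have "norm ((\<Sum>j<nodes n. cis (2 * pi * (t * (real j / real (nodes n))))) / real (nodes n)) \<le> 1"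
    using nodes_pos[of n] by (simp add: norm_divide divide_simps)
  then show ?thesis
    unfolding box_kernel_def norm_scaleR by (intro mult_le_one) auto
qed

text \<open>As a function of \<open>t\<close> the Riemann sum has period \<open>nodes n\<close>, so
  it cannot decay on its own. Up to half a period it is a geometric sum with ratio \<open>z\<close>,
  where \<open>|1 - z| >= 2 |t| / nodes n\<close>. Beyond half a period the sum is only bounded by
  1, and the Gaussian factor supplies the decay.\<close>

lemma norm_box_kernel_le_inverse:
  assumes "t \<noteq> 0" shows "norm (box_kernel n t) \<le> 1 / \<bar>t\<bar>"
proof (cases "\<bar>t\<bar> \<le> real (nodes n) / 2")
  case True
  define M where "M = real (nodes n)"
  have M: "0 < M" using nodes_pos[of n] by (simp add: M_def)
  define z where "z = cis (2 * pi * (t / M))"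
  have half: "\<bar>sin (2 * pi * (t / M) / 2)\<bar> = sin (pi * \<bar>t\<bar> / M)"
  proof -
    have "0 \<le> sin (pi * \<bar>t\<bar> / M)"
      using True M by (intro sin_ge_zero) (auto simp: M_def field_simps)
    then show ?thesis
      by (cases "0 \<le> t") auto
  qed
  have lower: "\<bar>t\<bar> / M \<le> sin (pi * \<bar>t\<bar> / M)"
    using sin_lower_bound[of "pi * \<bar>t\<bar> / M"] True M by (simp add: M_def field_simps)
  have pos: "0 < \<bar>t\<bar> / M" using assms M by simp
  have z1: "2 * (\<bar>t\<bar> / M) \<le> norm (z - 1)"
    unfolding z_def norm_cis_minus_1 half using lower by simp
  then have "z \<noteq> 1" using pos by auto
  have "(\<Sum>j<nodes n. cis (2 * pi * (t * (real j / real (nodes n))))) = (\<Sum>j<nodes n. z ^ j)"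
  proof (intro sum.cong refl)
    show "cis (2 * pi * (t * (real j / real (nodes n)))) = z ^ j" for j
      unfolding z_def Complex.DeMoivre by (rule arg_cong[where f=cis]) (simp add: M_def)
  qed
  also have "\<dots> = (1 - z ^ nodes n) / (1 - z)"
    using \<open>z \<noteq> 1\<close> by (simp add: sum_gp_strict)
  finally have "norm (\<Sum>j<nodes n. cis (2 * pi * (t * (real j / real (nodes n))))) = norm (1 - z ^ nodes n) / norm (1 - z)"
    by (simp add: norm_divide)
  also have "\<dots> \<le> 2 / (2 * (\<bar>t\<bar> / M))"
  proof (intro frac_le)
    show "norm (1 - z ^ nodes n) \<le> 2"
      using norm_triangle_ineq4[of 1 "z ^ nodes n"] by (simp add: z_def norm_power)
    show "2 * (\<bar>t\<bar> / M) \<le> norm (1 - z)"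
      using z1 by (simp add: norm_minus_commute)
  qed (use pos in auto)
  finally have "norm ((\<Sum>j<nodes n. cis (2 * pi * (t * (real j / real (nodes n))))) / real (nodes n)) \<le> 1 / \<bar>t\<bar>"
    using M assms by (simp add: norm_divide M_def field_simps)
  then have "norm (box_kernel n t) \<le> 1 * (1 / \<bar>t\<bar>)"
    unfolding box_kernel_def norm_scaleR by (intro mult_mono) auto
  then show ?thesis by simp
next
  case False
  have "norm ((\<Sum>j<nodes n. cis (2 * pi * (t * (real j / real (nodes n))))) / real (nodes n)) \<le> 1"
  proof -
    have "norm (\<Sum>j<nodes n. cis (2 * pi * (t * (real j / real (nodes n))))) \<le> (\<Sum>j<nodes n. 1)"
      by (intro order_trans[OF norm_sum] sum_mono) simp
    then show ?thesis
      using nodes_pos[of n] by (simp add: norm_divide divide_simps)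
  qed
  then have "norm (box_kernel n t) \<le> exp (- pi * (wid n)\<^sup>2 * t\<^sup>2) * 1"
    unfolding box_kernel_def norm_scaleR by (intro mult_mono) auto
  also have "\<dots> \<le> 1 / (1 + pi * (wid n)\<^sup>2 * t\<^sup>2)"
    using exp_neg_le[of "pi * (wid n)\<^sup>2 * t\<^sup>2"] by simp
  also have "\<dots> \<le> 1 / \<bar>t\<bar>"
  proof (rule divide_left_mono)
    \<comment> \<open>Half a period must already be so large that \<open>(wid n)^2 t^2\<close>
      dominates \<open>|t|\<close> from there on.\<close>
    have "1 \<le> (wid n)\<^sup>2 * (real (nodes n) / 2)"
    proof -
      have "1 \<le> (1 / k)\<^sup>2 * (7 * k ^ 3 / 2)" if "1 \<le> k" for k :: real
        using that by (simp add: power2_eq_square power3_eq_cube)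
      from this[of "real (Suc n)"] show ?thesis
        by (simp add: wid_def nodes_def)
    qed
    also have "\<dots> \<le> (wid n)\<^sup>2 * \<bar>t\<bar>"
      using False by (intro mult_left_mono) auto
    also have "\<dots> \<le> pi * ((wid n)\<^sup>2 * \<bar>t\<bar>)"
      using pi_ge_two mult_right_mono[of 1 pi "(wid n)\<^sup>2 * \<bar>t\<bar>"] by simp
    finally have "\<bar>t\<bar> * 1 \<le> \<bar>t\<bar> * (pi * ((wid n)\<^sup>2 * \<bar>t\<bar>))"
      by (intro mult_left_mono) auto
    also have "\<dots> = pi * (wid n)\<^sup>2 * t\<^sup>2"
    proof -
      have "\<bar>t\<bar> * \<bar>t\<bar> = t\<^sup>2"
        by (simp add: power2_eq_square)
      then show ?thesis
        by (metis mult.assoc mult.left_commute)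
    qed
    finally show "\<bar>t\<bar> \<le> 1 + pi * (wid n)\<^sup>2 * t\<^sup>2" by simp
    show "0 < (1 + pi * (wid n)\<^sup>2 * t\<^sup>2) * \<bar>t\<bar>"
      using assms by (intro mult_pos_pos add_pos_nonneg) auto
  qed simp
  finally show ?thesis .
qed

section \<open>Integration and summation in product form\<close>

text \<open>Fubini's theorem for products of one-variable functions. Lebesgue measure is an image of
  a product measure indexed by the basis vectors, so coordinates are matched with basis vectors
  through \<open>ax\<close>.\<close>

lemma
  fixes u :: "'d::finite \<Rightarrow> real \<Rightarrow> complex"
  assumes u: "\<And>i. integrable lborel (u i)"
  shows integrable_prod_vec: "integrable lborel (\<lambda>t::real^'d. \<Prod>i\<in>UNIV. u i (t $ i))" (is ?I)
    and integral_prod_vec: "(LINT t|lborel. (\<Prod>i\<in>UNIV. u i ((t::real^'d) $ i))) = (\<Prod>i\<in>UNIV. integral\<^sup>L lborel (u i))" (is ?E)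
proof -
  interpret product_sigma_finite "\<lambda>_::real^'d. lborel :: real measure"
    by standard
  define ax where "ax i = (axis i 1 :: real^'d)" for i :: 'd
  have inj: "inj ax"
    by (auto simp: inj_def ax_def axis_eq_axis)
  have Basis: "(Basis :: (real^'d) set) = range ax"
    by (auto simp: Basis_vec_def ax_def)
  define w where "w b = u (inv ax b)" for b
  have [measurable]: "u i \<in> borel_measurable borel" for i
    using u[of i] by (auto dest: borel_measurable_integrable)
  have eq: "(\<Prod>i\<in>UNIV. u i ((\<Sum>b\<in>Basis. f b *\<^sub>R b) $ i)) = (\<Prod>b\<in>Basis. w b (f b))" for f :: "real^'d \<Rightarrow> real"
  proof -
    have "(\<Sum>b\<in>Basis. f b *\<^sub>R b) $ i = f (ax i)" for i
    proof -
      have "(\<Sum>b\<in>Basis. f b *\<^sub>R b) $ i = (\<Sum>b\<in>Basis. f b *\<^sub>R b) \<bullet> ax i"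
        by (simp add: ax_def inner_axis)
      also have "\<dots> = f (ax i)"
        by (rule inner_sum_left_Basis) (simp add: Basis)
      finally show ?thesis .
    qed
    moreover have "(\<Prod>b\<in>Basis. w b (f b)) = (\<Prod>i\<in>UNIV. u i (f (ax i)))"
      unfolding Basis by (subst prod.reindex[OF inj]) (simp add: w_def inj)
    ultimately show ?thesis by simp
  qed
  have w: "integrable lborel (w b)" for b
    unfolding w_def by (rule u)
  have wp: "integrable (\<Pi>\<^sub>M b\<in>(Basis::(real^'d) set). lborel) (\<lambda>f. \<Prod>b\<in>Basis. w b (f b))"
    by (rule product_integrable_prod) (auto intro: w)
  have meas: "(\<lambda>f. \<Sum>b\<in>Basis. f b *\<^sub>R b) \<in> (\<Pi>\<^sub>M b\<in>(Basis::(real^'d) set). lborel) \<rightarrow>\<^sub>M borel"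
    by measurable
  have meas2: "(\<lambda>t::real^'d. \<Prod>i\<in>UNIV. u i (t $ i)) \<in> borel_measurable borel"
    by measurable
  show ?I
    by (subst lborel_eq, subst integrable_distr_eq[OF meas meas2]) (simp only: eq wp)
  have "(LINT t|lborel. (\<Prod>i\<in>UNIV. u i ((t::real^'d) $ i))) =
      (LINT f|(\<Pi>\<^sub>M b\<in>(Basis::(real^'d) set). lborel). (\<Prod>b\<in>Basis. w b (f b)))"
    by (subst lborel_eq, subst integral_distr[OF meas meas2]) (simp only: eq)
  also have "\<dots> = (\<Prod>b\<in>Basis. integral\<^sup>L lborel (w b))"
    by (rule product_integral_prod) (auto intro: w)
  also have "\<dots> = (\<Prod>i\<in>UNIV. integral\<^sup>L lborel (u i))"
    unfolding Basis by (subst prod.reindex[OF inj]) (simp add: w_def inj)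
  finally show ?E .
qed

text \<open>Vectors over a box correspond to dependent functions, which makes sums over boxes of
  frequencies factor over the coordinates.\<close>

lemma bij_betw_vec_nth_PiE:
  "bij_betw vec_nth {k::'a^'d. \<forall>i. k $ i \<in> A i} (PiE UNIV A)"
proof (rule bij_betwI[where g=vec_lambda])
  show "vec_nth \<in> {k. \<forall>i. k $ i \<in> A i} \<rightarrow> Pi\<^sub>E UNIV A" by auto
  show "vec_lambda \<in> Pi\<^sub>E UNIV A \<rightarrow> {k. \<forall>i. k $ i \<in> A i}" by (auto simp: PiE_def Pi_def)
qed (auto simp: vec_eq_iff)

lemma finite_vec_box:
  assumes "\<And>i::'d::finite. finite (A i)" shows "finite {k::'a^'d. \<forall>i. k $ i \<in> A i}"
  using bij_betw_finite[OF bij_betw_vec_nth_PiE[of A]] finite_PiE[of UNIV A] assms by simp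

lemma sum_prod_vec:
  fixes f :: "'d::finite \<Rightarrow> 'a \<Rightarrow> 'c::comm_semiring_1"
  assumes "\<And>i. finite (A i)"
  shows "(\<Sum>k\<in>{k::'a^'d. \<forall>i. k $ i \<in> A i}. \<Prod>i\<in>UNIV. f i (k $ i)) = (\<Prod>i\<in>UNIV. \<Sum>j\<in>A i. f i j)"
proof -
  have "(\<Sum>k\<in>{k::'a^'d. \<forall>i. k $ i \<in> A i}. \<Prod>i\<in>UNIV. f i (k $ i)) = (\<Sum>g\<in>PiE UNIV A. \<Prod>i\<in>UNIV. f i (g i))"
    by (rule sum.reindex_bij_betw[OF bij_betw_vec_nth_PiE])
  also have "\<dots> = (\<Prod>i\<in>UNIV. \<Sum>j\<in>A i. f i j)"
    using assms by (intro prod_sum_PiE[symmetric]) auto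
  finally show ?thesis .
qed

lemma card_vec_box:
  assumes "\<And>i::'d::finite. finite (A i)"
  shows "card {k::'a^'d. \<forall>i. k $ i \<in> A i} = (\<Prod>i\<in>UNIV. card (A i))"
  using sum_prod_vec[OF assms, where f="\<lambda>i j. 1::nat"] by simp

section \<open>Substitutions, Fatou's lemma and Hoelder's inequality for extended integrals\<close>

lemma nn_integral_torus: "nn_integral torus f = (\<integral>\<^sup>+t. f t * indicator (cbox 0 1) t \<partial>lborel)"
  unfolding torus_def by (subst nn_integral_restrict_space) (auto simp: nn_integral_completion)

lemma nn_integral_lborel_translate:
  fixes c :: "'a::euclidean_space"
  assumes [measurable]: "f \<in> borel_measurable borel"
  shows "(\<integral>\<^sup>+t. f (c + t) \<partial>lborel) = (\<integral>\<^sup>+t. f t \<partial>lborel)"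
proof -
  have "(\<integral>\<^sup>+t. f t \<partial>lborel) = (\<integral>\<^sup>+t. f t \<partial>(distr lborel borel ((+) c)))"
    by (simp add: lborel_distr_plus)
  also have "\<dots> = (\<integral>\<^sup>+t. f (c + t) \<partial>lborel)"
    by (subst nn_integral_distr) auto
  finally show ?thesis ..
qed

lemma nn_integral_lborel_scale:
  fixes f :: "real^'d \<Rightarrow> ennreal"
  assumes [measurable]: "f \<in> borel_measurable borel" and a: "0 < a"
  shows "(\<integral>\<^sup>+t. f t \<partial>lborel) = ennreal (a ^ CARD('d)) * (\<integral>\<^sup>+t. f (a *\<^sub>R t) \<partial>lborel)"
proof -
  have "(\<integral>\<^sup>+t. f t \<partial>lborel) = (\<integral>\<^sup>+t. f t \<partial>(density (distr lborel borel (\<lambda>x. 0 + a *\<^sub>R x)) (\<lambda>_. \<bar>a\<bar>^DIM(real^'d))))"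
    using a by (subst lborel_affine[of a 0]) auto
  also have "\<dots> = ennreal (a ^ CARD('d)) * (\<integral>\<^sup>+t. f (a *\<^sub>R t) \<partial>lborel)"
    using a by (simp add: nn_integral_density nn_integral_distr nn_integral_cmult ennreal_power)
  finally show ?thesis .
qed

text \<open>Fatou's lemma in the form that carries a uniform bound through a limit: the exhaustion
  by cubes, the removal of the smoothing and the growth of the Fejer order all use it.\<close>

lemma nn_integral_liminf_bound:
  fixes u :: "nat \<Rightarrow> 'a \<Rightarrow> ennreal"
  assumes "\<And>n. u n \<in> borel_measurable M" "AE x in M. (\<lambda>n. u n x) \<longlonglongrightarrow> v x"
    "\<And>n. (\<integral>\<^sup>+x. u n x \<partial>M) \<le> B"
  shows "(\<integral>\<^sup>+x. v x \<partial>M) \<le> B"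
proof -
  have "(\<integral>\<^sup>+x. v x \<partial>M) = (\<integral>\<^sup>+x. liminf (\<lambda>n. u n x) \<partial>M)"
    using assms(2) by (intro nn_integral_cong_AE, eventually_elim) (simp add: lim_imp_Liminf)
  also have "\<dots> \<le> liminf (\<lambda>n. \<integral>\<^sup>+x. u n x \<partial>M)"
    by (rule nn_integral_liminf[OF assms(1)])
  also have "\<dots> \<le> liminf (\<lambda>n. B)"
    by (intro Liminf_mono always_eventually allI assms(3))
  also have "\<dots> = B"
    by (intro lim_imp_Liminf) auto
  finally show ?thesis .
qed

text \<open>Working with positive upper bounds \<open>a\<close> and \<open>b\<close> instead of the
  norms themselves avoids division by a vanishing or infinite norm in the normalisation for Young's
  inequality.\<close>

lemma nn_integral_Holder_le:
  fixes f g :: "'a \<Rightarrow> real"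
  assumes p: "1 < p" "1 < q" "1 / p + 1 / q = 1"
    and meas: "f \<in> borel_measurable M" "g \<in> borel_measurable M"
    and nonneg: "\<And>x. 0 \<le> f x" "\<And>x. 0 \<le> g x"
    and ab: "0 < a" "0 < b"
    and f: "(\<integral>\<^sup>+x. ennreal (f x powr p) \<partial>M) \<le> ennreal a"
    and g: "(\<integral>\<^sup>+x. ennreal (g x powr q) \<partial>M) \<le> ennreal b"
  shows "(\<integral>\<^sup>+x. ennreal (f x * g x) \<partial>M) \<le> ennreal (a powr (1 / p) * b powr (1 / q))"
proof -
  define A where "A = a powr (1 / p)"
  define B where "B = b powr (1 / q)"
  have AB: "0 < A" "0 < B" using ab by (auto simp: A_def B_def)
  have Ap: "A powr p = a" "B powr q = b"
    using p ab by (auto simp: A_def B_def powr_powr)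
  have "(\<integral>\<^sup>+x. ennreal (f x * g x) \<partial>M) \<le>
    (\<integral>\<^sup>+x. ennreal (A * B / (a * p)) * ennreal (f x powr p) + ennreal (A * B / (b * q)) * ennreal (g x powr q) \<partial>M)"
  proof (rule nn_integral_mono)
    fix x
    have "f x / A * (g x / B) \<le> (f x / A) powr p / p + (g x / B) powr q / q"
      using p AB nonneg by (intro Youngs_inequality) auto
    also have "\<dots> = f x powr p / a / p + g x powr q / b / q"
      using AB nonneg by (simp add: powr_divide Ap)
    finally have "A * B * (f x / A * (g x / B)) \<le> A * B * (f x powr p / a / p + g x powr q / b / q)"
      using AB by (intro mult_left_mono) auto
    then have "f x * g x \<le> A * B / (a * p) * f x powr p + A * B / (b * q) * g x powr q"
      using AB by (simp add: field_simps)
    moreover have "0 \<le> A * B / (a * p)" "0 \<le> A * B / (b * q)"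
      using AB p ab by auto
    ultimately show "ennreal (f x * g x) \<le> ennreal (A * B / (a * p)) * ennreal (f x powr p) + ennreal (A * B / (b * q)) * ennreal (g x powr q)"
    proof -
      have "ennreal (A * B / (a * p)) * ennreal (f x powr p) + ennreal (A * B / (b * q)) * ennreal (g x powr q) =
        ennreal (A * B / (a * p) * f x powr p + A * B / (b * q) * g x powr q)"
        using \<open>0 \<le> A * B / (a * p)\<close> \<open>0 \<le> A * B / (b * q)\<close>
        by (subst ennreal_plus) (simp_all only: ennreal_mult powr_ge_zero mult_nonneg_nonneg)
      with \<open>f x * g x \<le> _\<close> show ?thesis
        by (simp only: ennreal_leI)
    qed
  qed
  also have "\<dots> = ennreal (A * B / (a * p)) * (\<integral>\<^sup>+x. ennreal (f x powr p) \<partial>M) + ennreal (A * B / (b * q)) * (\<integral>\<^sup>+x. ennreal (g x powr q) \<partial>M)"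
    using meas by (simp add: nn_integral_add nn_integral_cmult)
  also have "\<dots> \<le> ennreal (A * B / (a * p)) * ennreal a + ennreal (A * B / (b * q)) * ennreal b"
    using f g by (intro add_mono mult_left_mono) auto
  also have "\<dots> = ennreal (A * B / (a * p) * a + A * B / (b * q) * b)"
    using AB p ab by (simp flip: ennreal_mult ennreal_plus)
  also have "A * B / (a * p) * a + A * B / (b * q) * b = A * B * (1 / p + 1 / q)"
    using ab p by (simp add: field_simps)
  finally show ?thesis
    using p by (simp add: A_def B_def)
qed

section \<open>Periodization\<close>

definition decay :: "real \<Rightarrow> real" where "decay v = 1 / max 1 \<bar>v\<bar>"

definition decay_vec :: "real^'d \<Rightarrow> real" where "decay_vec t = (\<Prod>i\<in>UNIV. decay (t $ i))"

lemma decay_nonneg: "0 \<le> decay v" "0 < decay v"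
  by (auto simp: decay_def)

lemma decay_vec_nonneg: "0 \<le> decay_vec t"
  by (auto simp: decay_vec_def intro!: prod_nonneg decay_nonneg)

lemma decay_borel [measurable]: "decay \<in> borel_measurable borel"
  unfolding decay_def[abs_def] by measurable

lemma decay_vec_borel [measurable]: "decay_vec \<in> borel_measurable borel"
  unfolding decay_vec_def[abs_def] by measurable

lemma decay_vec_uminus: "decay_vec (- t) = decay_vec t"
  by (simp add: decay_vec_def decay_def)

lemma norm_box_kernel_le_decay: "norm (box_kernel n t) \<le> decay t"
  using norm_box_kernel_le_1[of n t] norm_box_kernel_le_inverse[of t n]
  by (cases "t = 0") (auto simp: decay_def max_def)

text \<open>The maximum of \<open>decay v powr s\<close> over \<open>k \<le> v \<le> k + 1\<close>
  (for \<open>s \<ge> 0\<close>), taken at the endpoint closest to 0: this is \<open>k\<close> for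
  nonnegative \<open>k\<close> and \<open>k + 1\<close> for negative \<open>k\<close>.\<close>

definition cell_bound :: "real \<Rightarrow> int \<Rightarrow> real" where
  "cell_bound s k = decay (real_of_int (if 0 \<le> k then k else k + 1)) powr s"

lemma decay_le_cell_bound:
  assumes "real_of_int k \<le> v" "v \<le> real_of_int k + 1" "0 \<le> s"
  shows "decay v powr s \<le> cell_bound s k"
proof -
  have "\<bar>real_of_int (if 0 \<le> k then k else k + 1)\<bar> \<le> \<bar>v\<bar>"
    using assms by (auto simp: abs_if)
  then have "decay v \<le> decay (real_of_int (if 0 \<le> k then k else k + 1))"
    unfolding decay_def by (intro divide_left_mono) auto
  then show ?thesis
    unfolding cell_bound_def using assms by (intro powr_mono2 decay_nonneg) auto
qed

lemma sum_powr_le: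
  assumes s: "1 < s"
  shows "(\<Sum>j<N. decay (real j) powr s) \<le> 2 * s / (s - 1)"
proof (cases "N \<le> 1")
  case True
  then have "(\<Sum>j<N. decay (real j) powr s) \<le> 1"
    by (cases N) (auto simp: decay_def)
  also have "\<dots> \<le> 2 * s / (s - 1)" using s by (simp add: field_simps)
  finally show ?thesis .
next
  case False
  have *: "(\<Sum>j<Suc (Suc n). decay (real j) powr s) \<le> 2 + 1 / (s - 1) - (real (Suc n)) powr (1 - s) / (s - 1)" for n
  proof (induction n)
    case 0
    show ?case using s by (simp add: decay_def)
  next
    case (Suc n)
    define x where "x = real (Suc n)"
    have x: "1 \<le> x" by (simp add: x_def)
    have "\<exists>\<xi>. x < \<xi> \<and> \<xi> < x + 1 \<and> (x + 1) powr (1 - s) - x powr (1 - s) = ((x + 1) - x) * ((1 - s) * \<xi> powr (1 - s - 1))"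
      using x by (intro MVT2) (auto intro!: derivative_eq_intros)
    then obtain \<xi> where \<xi>: "x < \<xi>" "\<xi> < x + 1" "(x + 1) powr (1 - s) - x powr (1 - s) = (1 - s) * \<xi> powr (- s)"
      by auto
    have "(x + 1) powr (- s) \<le> \<xi> powr (- s)"
      using \<xi> x s by (intro powr_mono2') auto
    then have "(s - 1) * (x + 1) powr (- s) \<le> (s - 1) * \<xi> powr (- s)"
      using s by (intro mult_left_mono) auto
    also have "\<dots> = x powr (1 - s) - (x + 1) powr (1 - s)"
      using \<xi>(3) by (simp add: algebra_simps)
    finally have "(x + 1) powr (- s) \<le> (x powr (1 - s) - (x + 1) powr (1 - s)) / (s - 1)"
      using s by (simp add: field_simps)
    moreover have "decay (real (Suc (Suc n))) powr s = (x + 1) powr (- s)"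
      using x by (simp add: decay_def x_def powr_divide powr_minus_divide)
    ultimately show ?case
      using Suc.IH by (simp add: x_def diff_divide_distrib add_ac)
  qed
  obtain n where n: "N = Suc (Suc n)"
    using False by (metis One_nat_def Suc_leI less_one linorder_not_le not0_implies_Suc le_SucE le_0_eq)
  have "(\<Sum>j<N. decay (real j) powr s) \<le> 2 + 1 / (s - 1)"
    using *[of n] s unfolding n by (smt (verit) divide_nonneg_pos powr_ge_zero)
  also have "\<dots> \<le> 2 * s / (s - 1)"
    using s by (simp add: field_simps)
  finally show ?thesis .
qed

text \<open>The reflection \<open>k \<mapsto> - k - 1\<close> maps the negative cells onto the
  nonnegative ones, so the bound \<open>2 * s / (s - 1)\<close> for one side is doubled.\<close>

lemma sum_cell_bound_le:
  assumes s: "1 < s"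
  shows "(\<Sum>k\<in>{- int N..<int N}. cell_bound s k) \<le> 4 * (s / (s - 1))"
proof -
  have "{- int N..<int N} = {- int N..<0} \<union> {0..<int N}" by auto
  then have "(\<Sum>k\<in>{- int N..<int N}. cell_bound s k) = (\<Sum>k\<in>{- int N..<0}. cell_bound s k) + (\<Sum>k\<in>{0..<int N}. cell_bound s k)"
    by (simp add: sum.union_disjoint)
  also have "(\<Sum>k\<in>{0..<int N}. cell_bound s k) = (\<Sum>j<N. decay (real j) powr s)"
    by (rule sum.reindex_bij_witness[of _ int nat]) (auto simp: cell_bound_def)
  also have "(\<Sum>k\<in>{- int N..<0}. cell_bound s k) = (\<Sum>j<N. decay (real j) powr s)"
    by (rule sum.reindex_bij_witness[of _ "\<lambda>j. - int j - 1" "\<lambda>k. nat (- k - 1)"]) (auto simp: cell_bound_def decay_def)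
  finally show ?thesis
    using sum_powr_le[OF s, of N] by simp
qed

text \<open>On the cell \<open>k + Q\<close> the decaying factor is at most \<open>c k\<close>, and
  by periodicity the remaining integral is always the one over the torus. The sum of the
  \<open>c k\<close> factors over the coordinates, which produces the power \<open>CARD('d)\<close>.
  The cutoff to the cubes \<open>U N\<close> keeps all sums finite.\<close>

lemma periodization:
  fixes \<Phi> :: "real^'d \<Rightarrow> ennreal"
  assumes [measurable]: "\<Phi> \<in> borel_measurable borel"
    and per: "\<And>t k. \<Phi> (int_vec k + t) = \<Phi> t" and s: "1 < s"
  shows "(\<integral>\<^sup>+t. ennreal (decay_vec t powr s) * \<Phi> t \<partial>lborel)
    \<le> ennreal ((4 * (s / (s - 1))) ^ CARD('d)) * nn_integral torus \<Phi>"
proof (rule nn_integral_liminf_bound)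
  \<comment> \<open>Half-open on the right, so that rounding down a coordinate lands in
    \<open>{- int N..<int N}\<close>.\<close>
  define U where "U N = {t::real^'d. \<forall>i. - real N \<le> t $ i \<and> t $ i < real N}" for N
  have [measurable]: "U N \<in> sets borel" for N
    unfolding U_def by measurable
  let ?f = "\<lambda>t. ennreal (decay_vec t powr s) * \<Phi> t"
  show "(\<lambda>t. ?f t * indicator (U N) t) \<in> borel_measurable lborel" for N
    by measurable
  show "AE t in lborel. (\<lambda>N. ?f t * indicator (U N) t) \<longlonglongrightarrow> ?f t"
  proof (rule AE_I2)
    fix t :: "real^'d"
    obtain N where N: "norm t < real N"
      using reals_Archimedean2 by blast
    have "t \<in> U n" if "n \<ge> N" for n
    proof -
      have "\<bar>t $ i\<bar> < real n" for i
        using component_le_norm_cart[of t i] N that by linarith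
      then show ?thesis
        unfolding U_def by (auto simp: abs_less_iff less_imp_le) (smt (verit))
    qed
    then have "\<forall>\<^sub>F n in sequentially. ?f t * indicator (U n) t = ?f t"
      unfolding eventually_sequentially by (intro exI[of _ N]) auto
    then show "(\<lambda>N. ?f t * indicator (U N) t) \<longlonglongrightarrow> ?f t"
      by (rule tendsto_eventually)
  qed
  fix N
  define B where "B = {k::int^'d. \<forall>i. k $ i \<in> {- int N..<int N}}"
  have finB: "finite B"
    unfolding B_def by (rule finite_vec_box) simp
  define c where "c k = (\<Prod>i\<in>UNIV. cell_bound s (k $ i))" for k :: "int^'d"
  have c0: "0 \<le> c k" for k
    unfolding c_def cell_bound_def by (intro prod_nonneg) auto
  have "(\<integral>\<^sup>+t. ?f t * indicator (U N) t \<partial>lborel) \<le>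
    (\<integral>\<^sup>+t. (\<Sum>k\<in>B. ennreal (c k) * (\<Phi> (- int_vec k + t) * indicator (cbox 0 1) (- int_vec k + t))) \<partial>lborel)"
  proof (rule nn_integral_mono)
    fix t :: "real^'d"
    show "?f t * indicator (U N) t \<le> (\<Sum>k\<in>B. ennreal (c k) * (\<Phi> (- int_vec k + t) * indicator (cbox 0 1) (- int_vec k + t)))"
    proof (cases "t \<in> U N")
      case True
      define k where "k = (\<chi> i. \<lfloor>t $ i\<rfloor>)"
      have kB: "k \<in> B"
        using True by (auto simp: B_def U_def k_def le_floor_iff floor_less_iff)
      have cell: "- int_vec k + t \<in> cbox 0 1"
      proof -
        have "0 \<le> - real_of_int \<lfloor>x\<rfloor> + x \<and> - real_of_int \<lfloor>x\<rfloor> + x \<le> 1" for x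
          by linarith
        then show ?thesis
          by (simp add: mem_box_cart int_vec_def k_def)
      qed
      have "decay_vec t powr s = (\<Prod>i\<in>UNIV. decay (t $ i) powr s)"
        unfolding decay_vec_def by (simp add: prod_powr_distrib decay_nonneg)
      also have "\<dots> \<le> c k"
        unfolding c_def
      proof (rule prod_mono, rule conjI)
        fix i
        show "decay (t $ i) powr s \<le> cell_bound s (k $ i)"
          using s by (intro decay_le_cell_bound; simp add: k_def; linarith)
      qed simp
      finally have "decay_vec t powr s \<le> c k" .
      moreover have "\<Phi> (- int_vec k + t) = \<Phi> t"
        using per[of k "- int_vec k + t"] by simp
      ultimately have "?f t * indicator (U N) t \<le> ennreal (c k) * (\<Phi> (- int_vec k + t) * indicator (cbox 0 1) (- int_vec k + t))"
        using True cell by (simp add: ennreal_leI mult_right_mono)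
      also have "\<dots> \<le> (\<Sum>k\<in>B. ennreal (c k) * (\<Phi> (- int_vec k + t) * indicator (cbox 0 1) (- int_vec k + t)))"
        using kB finB by (intro member_le_sum) auto
      finally show ?thesis .
    qed auto
  qed
  also have "\<dots> = (\<Sum>k\<in>B. ennreal (c k) * (\<integral>\<^sup>+t. \<Phi> (- int_vec k + t) * indicator (cbox 0 1) (- int_vec k + t) \<partial>lborel))"
    by (simp add: nn_integral_sum nn_integral_cmult)
  also have "\<dots> = (\<Sum>k\<in>B. ennreal (c k) * nn_integral torus \<Phi>)"
    by (subst nn_integral_lborel_translate[where f="\<lambda>t. \<Phi> t * indicator (cbox 0 1) t"]) (auto simp: nn_integral_torus)
  also have "\<dots> = ennreal (\<Sum>k\<in>B. c k) * nn_integral torus \<Phi>"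
    by (simp add: sum_distrib_right[symmetric] sum_ennreal c0)
  also have "(\<Sum>k\<in>B. c k) = (\<Prod>i\<in>(UNIV::'d set). \<Sum>j\<in>{- int N..<int N}. cell_bound s j)"
    unfolding B_def c_def by (rule sum_prod_vec) simp
  also have "\<dots> = (\<Sum>j\<in>{- int N..<int N}. cell_bound s j) ^ CARD('d)"
    by simp
  also have "ennreal ((\<Sum>j\<in>{- int N..<int N}. cell_bound s j) ^ CARD('d)) * nn_integral torus \<Phi> \<le>
      ennreal ((4 * (s / (s - 1))) ^ CARD('d)) * nn_integral torus \<Phi>"
    by (intro mult_right_mono ennreal_leI power_mono sum_cell_bound_le s sum_nonneg) (auto simp: cell_bound_def)
  finally show "(\<integral>\<^sup>+t. ?f t * indicator (U N) t \<partial>lborel) \<le> ennreal ((4 * (s / (s - 1))) ^ CARD('d)) * nn_integral torus \<Phi>" .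
qed

section \<open>The Fejer kernel\<close>

definition chr :: "int^'d \<Rightarrow> real^'d \<Rightarrow> complex" where
  "chr k t = cis (2 * pi * (int_vec k \<bullet> t))"

lemma trig_poly_chr: "trig_poly K x t = (\<Sum>k\<in>K. chr k t *\<^sub>C x k)"
  by (simp add: trig_poly_def chr_def)

lemma int_vec_diff: "int_vec (j - l) = int_vec j - int_vec l"
  by (simp add: int_vec_def vec_eq_iff)

lemma int_vec_add: "int_vec (j + l) = int_vec j + int_vec l"
  by (simp add: int_vec_def vec_eq_iff)

lemma int_vec_0 [simp]: "int_vec 0 = 0"
  by (simp add: int_vec_def vec_eq_iff)

lemma norm_chr [simp]: "norm (chr k t) = 1"
  by (simp add: chr_def)

lemma chr_0 [simp]: "chr 0 t = 1"
  by (simp add: chr_def)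

lemma chr_diff: "chr (j - l) t = chr j t * cnj (chr l t)"
  by (simp add: chr_def int_vec_diff inner_diff_left right_diff_distrib cis_cnj cis_mult)

lemma chr_add_arg: "chr k (s + t) = chr k s * chr k t"
  by (simp add: chr_def inner_add_right distrib_left cis_mult)

lemma chr_minus_arg: "chr k (- t) = cnj (chr k t)"
  by (simp add: chr_def cis_cnj)

lemma chr_int_vec [simp]: "chr k (int_vec j) = 1"
proof -
  have "int_vec k \<bullet> int_vec j = real_of_int (\<Sum>i\<in>UNIV. k $ i * j $ i)"
    by (simp add: int_vec_def inner_vec_def)
  then show ?thesis
    unfolding chr_def by (simp only: cis_multiple_2pi Ints_of_int)
qed

lemma cis_sum: "cis (\<Sum>i\<in>I. f i) = (\<Prod>i\<in>I. cis (f i))"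
  by (induction I rule: infinite_finite_induct) (simp_all flip: cis_mult)

lemma chr_prod: "chr k t = (\<Prod>i\<in>UNIV. cis (2 * pi * (real_of_int (k $ i) * t $ i)))"
  by (simp add: chr_def inner_vec_def int_vec_def sum_distrib_left cis_sum)

lemma continuous_on_chr [continuous_intros]: "continuous_on S f \<Longrightarrow> continuous_on S (\<lambda>x. chr k (f x))"
  unfolding chr_def by (intro continuous_intros)

lemma chr_borel [measurable]: "chr k \<in> borel_measurable borel"
  by (intro borel_measurable_continuous_onI continuous_intros)

lemma integral_cis_period:
  "(LINT v|lborel. indicator {0..1} v *\<^sub>R cis (2 * pi * (real_of_int m * v))) = (if m = 0 then 1 else 0)"
proof (cases "m = 0")
  case True
  have "(LINT v|lborel. indicator {0..1::real} v *\<^sub>R (1::complex)) = (LINT v|lborel. complex_of_real (indicator {0..1::real} v))"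
    by (intro Bochner_Integration.integral_cong refl) (simp add: scaleR_conv_of_real)
  also have "\<dots> = complex_of_real (LINT v|lborel. indicator {0..1::real} v)"
    by (rule integral_complex_of_real)
  also have "\<dots> = 1" by simp
  finally show ?thesis using True by simp
next
  case False
  let ?w = "2 * pi * real_of_int m"
  let ?F = "\<lambda>v. cis (?w * v) / (\<i> * complex_of_real ?w)"
  have "(LINT v|lborel. indicator {0..1} v *\<^sub>R cis (?w * v)) = ?F 1 - ?F 0"
  proof (rule integral_FTC_atLeastAtMost)
    show "(?F has_vector_derivative cis (?w * v)) (at v within {0..1})" for v
    proof -
      have "((\<lambda>v. cis (?w * v)) has_vector_derivative (?w *\<^sub>R (\<i> * cis (?w * v)))) (at v within {0..1})"
        unfolding cis_conv_exp
        by (rule has_vector_derivative_eq_rhs, (rule derivative_eq_intros refl has_vector_derivative_real_field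
              exp_scaleR_has_vector_derivative_left | simp add: scaleR_conv_of_real mult_ac)+)
      then have "(?F has_vector_derivative (?w *\<^sub>R (\<i> * cis (?w * v))) / (\<i> * complex_of_real ?w)) (at v within {0..1})"
        by (rule has_vector_derivative_divide)
      then show ?thesis
        using False by (simp add: scaleR_conv_of_real field_simps)
    qed
  qed (auto intro!: continuous_intros)
  also have "cis (?w * 1) = 1"
    using cis_multiple_2pi[of "real_of_int m"] by (simp add: mult_ac)
  finally show ?thesis
    using False by (simp add: mult_ac)
qed

lemma integrable_cis_period: "integrable lborel (\<lambda>v. indicator {0..1} v *\<^sub>R cis (2 * pi * (real_of_int m * v)))"
  by (rule borel_integrable_atLeastAtMost'[unfolded set_integrable_def]) (intro continuous_intros)

lemma indicator_cbox_01: "indicator (cbox 0 (1::real^'d)) t = (\<Prod>i\<in>UNIV. indicator {0..1} (t $ i) :: real)"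
proof (cases "t \<in> cbox 0 1")
  case True
  then show ?thesis by (auto simp: mem_box_cart)
next
  case False
  then obtain i where "t $ i \<notin> {0..1}" by (auto simp: mem_box_cart)
  then have "(\<Prod>i\<in>UNIV. indicator {0..1} (t $ i) :: real) = 0"
    by (intro prod_zero) (auto simp: indicator_def)
  with False show ?thesis by simp
qed

lemma
  fixes k :: "int^'d"
  shows integrable_chr: "integrable lborel (\<lambda>t. indicator (cbox 0 1) t *\<^sub>R chr k t)"
    and integral_chr: "(LINT t|lborel. indicator (cbox 0 1) t *\<^sub>R chr k t) = (if k = 0 then 1 else 0)"
proof -
  have eq: "indicator (cbox 0 1) t *\<^sub>R chr k t =
      (\<Prod>i\<in>UNIV. indicator {0..1} (t $ i) *\<^sub>R cis (2 * pi * (real_of_int (k $ i) * t $ i)))" for t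
    by (simp add: indicator_cbox_01 chr_prod scaleR_conv_of_real prod.distrib)
  show "integrable lborel (\<lambda>t. indicator (cbox 0 1) t *\<^sub>R chr k t)"
    unfolding eq by (rule integrable_prod_vec[OF integrable_cis_period])
  have "(LINT t|lborel. indicator (cbox 0 1) t *\<^sub>R chr k t) = (\<Prod>i\<in>UNIV. if k $ i = 0 then 1 else 0)"
    unfolding eq by (subst integral_prod_vec[OF integrable_cis_period]) (simp add: integral_cis_period)
  also have "\<dots> = (if k = 0 then 1 else 0)"
    by (auto simp: vec_eq_iff)
  finally show "(LINT t|lborel. indicator (cbox 0 1) t *\<^sub>R chr k t) = (if k = 0 then 1 else 0)" .
qed

definition freqs :: "nat \<Rightarrow> (int^'d) set" where
  "freqs N = {j. \<forall>i. j $ i \<in> {0..<int N}}"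

lemma finite_freqs [simp]: "finite (freqs N)"
  unfolding freqs_def by (rule finite_vec_box) simp

lemma card_freqs: "card (freqs N :: (int^'d) set) = N ^ CARD('d)"
  unfolding freqs_def by (subst card_vec_box) auto

text \<open>The product of one-dimensional Fejer kernels, written as a normalised square of an
  exponential sum so that nonnegativity is immediate.\<close>

definition fejer :: "nat \<Rightarrow> real^'d \<Rightarrow> real" where
  "fejer N t = (norm (\<Sum>j\<in>freqs N. chr j t))\<^sup>2 / real N ^ CARD('d)"

lemma fejer_nonneg: "0 \<le> fejer N t"
  by (simp add: fejer_def)

lemma fejer_expand:
  "complex_of_real (fejer N (t::real^'d)) = (\<Sum>j\<in>freqs N. \<Sum>l\<in>freqs N. chr (j - l) t) / real N ^ CARD('d)"
proof -
  have "complex_of_real ((norm (\<Sum>j\<in>freqs N. chr j t))\<^sup>2) = (\<Sum>j\<in>freqs N. chr j t) * cnj (\<Sum>j\<in>freqs N. chr j t)"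
    by (simp only: complex_norm_square)
  also have "\<dots> = (\<Sum>j\<in>freqs N. \<Sum>l\<in>freqs N. chr (j - l) t)"
    by (simp add: sum_product chr_diff)
  finally show ?thesis
    by (simp add: fejer_def)
qed

lemma fejer_borel [measurable]: "fejer N \<in> borel_measurable borel"
  unfolding fejer_def[abs_def] by measurable

lemma fejer_uminus: "fejer N (- t) = fejer N t"
proof -
  have "(\<Sum>j\<in>freqs N. chr j (- t)) = cnj (\<Sum>j\<in>freqs N. chr j t)"
    by (simp add: chr_minus_arg)
  then show ?thesis
    by (simp only: fejer_def complex_mod_cnj)
qed

lemma fejer_periodic: "fejer N (int_vec k + t) = fejer N t"
  by (simp add: fejer_def chr_add_arg)

text \<open>Only the pairs \<open>j = l\<close> survive integration, and there are
  \<open>N ^ CARD('d)\<close> of them; the shift by \<open>c\<close> multiplies the vanishing terms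
  by numbers of modulus 1. Shifts are included because the kernel is later centred at a moving
  point.\<close>

lemma nn_integral_fejer:
  fixes c :: "real^'d"
  assumes N: "0 < N"
  shows "(\<integral>\<^sup>+t. ennreal (fejer N (c + t)) \<partial>torus) = 1" 
proof -
  let ?d = "CARD('d)"
  have eq: "indicator (cbox 0 1) t *\<^sub>R complex_of_real (fejer N (c + t)) =
    (\<Sum>j\<in>freqs N. \<Sum>l\<in>freqs N. (chr (j - l) c / real N ^ ?d) * (indicator (cbox 0 1) t *\<^sub>R chr (j - l) t))" for t
    unfolding fejer_expand
    by (simp add: chr_add_arg sum_divide_distrib sum_distrib_left scaleR_conv_of_real mult_ac)
  have int: "integrable lborel (\<lambda>t. indicator (cbox 0 1) t *\<^sub>R complex_of_real (fejer N (c + t)))"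
    unfolding eq by (intro Bochner_Integration.integrable_sum integrable_mult_right integrable_chr)
  have "(LINT t|lborel. indicator (cbox 0 1) t *\<^sub>R complex_of_real (fejer N (c + t))) =
    (\<Sum>j\<in>freqs N. \<Sum>l\<in>freqs N. (chr (j - l) c / real N ^ ?d) * (if j - l = 0 then 1 else 0))"
  proof -
    have "(LINT t|lborel. indicator (cbox 0 1) t *\<^sub>R complex_of_real (fejer N (c + t))) =
      (\<Sum>j\<in>freqs N. LINT t|lborel. (\<Sum>l\<in>freqs N. (chr (j - l) c / real N ^ ?d) * (indicator (cbox 0 1) t *\<^sub>R chr (j - l) t)))"
      unfolding eq by (intro Bochner_Integration.integral_sum Bochner_Integration.integrable_sum integrable_mult_right integrable_chr)
    also have "\<dots> = (\<Sum>j\<in>freqs N. \<Sum>l\<in>freqs N. LINT t|lborel. (chr (j - l) c / real N ^ ?d) * (indicator (cbox 0 1) t *\<^sub>R chr (j - l) t))"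
      by (intro sum.cong refl Bochner_Integration.integral_sum integrable_mult_right integrable_chr)
    also have "\<dots> = (\<Sum>j\<in>freqs N. \<Sum>l\<in>freqs N. (chr (j - l) c / real N ^ ?d) * (if j - l = 0 then 1 else 0))"
      by (intro sum.cong refl) (simp only: integral_mult_right_zero integral_chr)
    finally show ?thesis .
  qed
  also have "\<dots> = (\<Sum>j\<in>(freqs N::(int^'d) set). \<Sum>l\<in>freqs N. if j = l then 1 / real N ^ ?d else 0)"
    unfolding of_real_sum by (intro sum.cong refl) auto
  also have "\<dots> = 1"
    using N by (simp add: card_freqs)
  finally have I: "(LINT t|lborel. indicator (cbox 0 1) t *\<^sub>R complex_of_real (fejer N (c + t))) = 1" .
  have eq': "indicator (cbox 0 1) t *\<^sub>R complex_of_real (fejer N (c + t)) = complex_of_real (indicator (cbox 0 1) t * fejer N (c + t))" for t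
    by (simp add: scaleR_conv_of_real)
  have int': "integrable lborel (\<lambda>t. indicator (cbox 0 1) t * fejer N (c + t))"
    using int unfolding eq' by (simp only: complex_of_real_integrable_eq)
  have I': "(LINT t|lborel. indicator (cbox 0 1) t * fejer N (c + t)) = 1"
    using I unfolding eq' by (simp only: integral_complex_of_real of_real_eq_1_iff)
  have "(\<integral>\<^sup>+t. ennreal (fejer N (c + t)) \<partial>torus) = (\<integral>\<^sup>+t. ennreal (indicator (cbox 0 1) t * fejer N (c + t)) \<partial>lborel)"
    unfolding nn_integral_torus by (intro nn_integral_cong) (auto simp: indicator_def)
  also have "\<dots> = ennreal (LINT t|lborel. indicator (cbox 0 1) t * fejer N (c + t))"
    using int' by (rule nn_integral_eq_integral) (auto simp: fejer_nonneg)
  finally show ?thesis by (simp add: I')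
qed

text \<open>Coordinatewise, two integer intervals of length \<open>N\<close> displaced by
  \<open>k $ i\<close> overlap in \<open>N - |k $ i|\<close> points; truncated subtraction gives 0
  once they are disjoint.\<close>

lemma card_freqs_shift:
  "card {l \<in> freqs N. l + k \<in> freqs N} = (\<Prod>i\<in>UNIV. N - nat \<bar>(k :: int^'d) $ i\<bar>)"
proof -
  have "{l \<in> freqs N. l + k \<in> freqs N} = {l. \<forall>i. l $ i \<in> {max 0 (- k $ i)..<min (int N) (int N - k $ i)}}"
  proof -
    have "(0 \<le> x \<and> x < int N) \<and> (0 \<le> x + m \<and> x + m < int N) \<longleftrightarrow> max 0 (- m) \<le> x \<and> x < min (int N) (int N - m)" for x m
      by linarith
    then have "l \<in> freqs N \<and> l + k \<in> freqs N \<longleftrightarrow> (\<forall>i. max 0 (- k $ i) \<le> l $ i \<and> l $ i < min (int N) (int N - k $ i))" for l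
      unfolding freqs_def by (simp only: mem_Collect_eq atLeastLessThan_iff vector_add_component flip: all_conj_distrib)
    then show ?thesis by auto
  qed
  also have "card \<dots> = (\<Prod>i\<in>UNIV. card {max 0 (- k $ i)..<min (int N) (int N - k $ i)})"
    by (rule card_vec_box) simp
  also have "\<dots> = (\<Prod>i\<in>UNIV. N - nat \<bar>k $ i\<bar>)"
    by (intro prod.cong refl) auto
  finally show ?thesis .
qed

text \<open>The pairs are grouped by their difference. The finite set \<open>K\<close> turns the
  choice of the difference into a finite sum that can be moved outside.\<close>

lemma sum_freqs_diff:
  fixes z :: "int^'d \<Rightarrow> 'b::real_normed_vector"
  assumes K: "finite K" "\<And>k. k \<notin> K \<Longrightarrow> z k = 0"
  shows "(\<Sum>j\<in>freqs N. \<Sum>l\<in>freqs N. z (j - l)) = (\<Sum>k\<in>K. real (\<Prod>i\<in>UNIV. N - nat \<bar>k $ i\<bar>) *\<^sub>R z k)"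
proof -
  have "(\<Sum>j\<in>freqs N. \<Sum>l\<in>freqs N. z (j - l)) = (\<Sum>j\<in>freqs N. \<Sum>l\<in>freqs N. \<Sum>k\<in>K. if j = l + k then z k else 0)"
  proof (intro sum.cong refl)
    fix j l :: "int^'d"
    have "(\<Sum>k\<in>K. if j = l + k then z k else 0) = (\<Sum>k\<in>K. if k = j - l then z k else 0)"
      by (intro sum.cong refl if_cong) (auto simp: algebra_simps)
    also have "\<dots> = z (j - l)"
      using K by (cases "j - l \<in> K") auto
    finally show "z (j - l) = (\<Sum>k\<in>K. if j = l + k then z k else 0)" ..
  qed
  also have "\<dots> = (\<Sum>k\<in>K. \<Sum>l\<in>freqs N. \<Sum>j\<in>freqs N. if j = l + k then z k else 0)"
  proof -
    have "(\<Sum>j\<in>freqs N. \<Sum>l\<in>freqs N. \<Sum>k\<in>K. if j = l + k then z k else 0) =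
      (\<Sum>j\<in>freqs N. \<Sum>k\<in>K. \<Sum>l\<in>freqs N. if j = l + k then z k else 0)"
      by (intro sum.cong refl sum.swap)
    also have "\<dots> = (\<Sum>k\<in>K. \<Sum>j\<in>freqs N. \<Sum>l\<in>freqs N. if j = l + k then z k else 0)"
      by (rule sum.swap)
    also have "\<dots> = (\<Sum>k\<in>K. \<Sum>l\<in>freqs N. \<Sum>j\<in>freqs N. if j = l + k then z k else 0)"
      by (intro sum.cong refl sum.swap)
    finally show ?thesis .
  qed
  also have "\<dots> = (\<Sum>k\<in>K. \<Sum>l\<in>freqs N. if l + k \<in> freqs N then z k else 0)"
    by (intro sum.cong refl) simp
  also have "\<dots> = (\<Sum>k\<in>K. \<Sum>l\<in>{l\<in>freqs N. l + k \<in> freqs N}. z k)"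
    by (rule sum.cong[OF refl]) (simp add: sum.inter_filter)
  also have "\<dots> = (\<Sum>k\<in>K. real (\<Prod>i\<in>UNIV. N - nat \<bar>k $ i\<bar>) *\<^sub>R z k)"
    by (intro sum.cong refl) (simp add: card_freqs_shift sum_constant_scaleR)
  finally show ?thesis .
qed

text \<open>For each fixed frequency the weight is a product of factors
  \<open>1 - |k $ i| / N\<close> for large \<open>N\<close>, hence tends to 1; only finitely many
  frequencies occur.\<close>

lemma fejer_mean_tendsto:
  fixes z :: "int^'d \<Rightarrow> 'b::real_normed_vector"
  assumes K: "finite K" "\<And>k. k \<notin> K \<Longrightarrow> z k = 0"
  shows "(\<lambda>N. (\<Sum>j\<in>freqs N. \<Sum>l\<in>freqs N. z (j - l)) /\<^sub>R real N ^ CARD('d)) \<longlonglongrightarrow> (\<Sum>k\<in>K. z k)"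
proof -
  have count: "(\<Sum>j\<in>freqs N. \<Sum>l\<in>freqs N. z (j - l)) = (\<Sum>k\<in>K. real (\<Prod>i\<in>UNIV. N - nat \<bar>k $ i\<bar>) *\<^sub>R z k)" for N
    using K by (rule sum_freqs_diff)
  have ratio: "(\<lambda>N. real (\<Prod>i\<in>UNIV. N - nat \<bar>k $ i\<bar>) / real N ^ CARD('d)) \<longlonglongrightarrow> 1" for k :: "int^'d"
  proof -
    have one: "(\<lambda>N. real (N - m) / real N) \<longlonglongrightarrow> 1" for m :: nat
    proof -
      have "(\<lambda>N. 1 - real m / real N) \<longlonglongrightarrow> 1"
        by real_asymp
      moreover have "\<forall>\<^sub>F N in sequentially. 1 - real m / real N = real (N - m) / real N"
        using eventually_gt_at_top[of m] by eventually_elim (simp add: of_nat_diff field_simps)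
      ultimately show ?thesis
        by (rule Lim_transform_eventually)
    qed
    have "(\<lambda>N. \<Prod>i\<in>UNIV. real (N - nat \<bar>k $ i\<bar>) / real N) \<longlonglongrightarrow> (\<Prod>i\<in>(UNIV::'d set). 1)"
      by (intro tendsto_prod one)
    then show ?thesis
      by (simp add: prod_dividef)
  qed
  have "(\<lambda>N. \<Sum>k\<in>K. (real (\<Prod>i\<in>UNIV. N - nat \<bar>k $ i\<bar>) / real N ^ CARD('d)) *\<^sub>R z k) \<longlonglongrightarrow> (\<Sum>k\<in>K. 1 *\<^sub>R z k)"
    by (intro tendsto_sum tendsto_scaleR ratio tendsto_const)
  then show ?thesis
    unfolding count by (simp add: scaleR_sum_right divide_inverse_commute)
qed

text \<open>\<open>nn_integral_Holder_le\<close> needs strictly positive bounds, while the integral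
  it is applied to may vanish. The bound is enlarged there, and the enlargement is removed
  here.\<close>

lemma le_mult_of_forall_gt:
  fixes v c b :: real
  assumes "0 \<le> c" "\<And>b'. b < b' \<Longrightarrow> v \<le> c * b'" shows "v \<le> c * b"
proof (rule tendsto_lowerbound)
  show "((\<lambda>b'. c * b') \<longlongrightarrow> c * b) (at_right b)"
    by (intro tendsto_intros)
  show "\<forall>\<^sub>F b' in at_right b. v \<le> c * b'"
    using assms(2) by (simp add: eventually_at_filter)
qed simp

text \<open>The factor \<open>fejer N (t - u) powr (1 / q')\<close> stays with
  \<open>decay_vec\<close>, and its \<open>q'\<close>-th power is integrated by
  \<open>periodization\<close> and the unit mass of the kernel; this gives a constant independent of
  \<open>N\<close> and \<open>t\<close>. The factor \<open>fejer N (t - u) powr (1 / q)\<close>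
  stays with \<open>G\<close>. Integrating its \<open>q\<close>-th power over \<open>t\<close> by
  Tonelli's theorem uses the unit mass once more and leaves the integral of
  \<open>G u powr q\<close> over the whole space.\<close>

lemma fejer_convolution_bound:
  fixes V G :: "real^'d \<Rightarrow> real"
  assumes pq: "1 < q" "1 < q'" "1 / q' + 1 / q = 1" and N: "0 < N"
    and [measurable]: "G \<in> borel_measurable borel"
    and G0: "\<And>u. 0 \<le> G u" and V0: "\<And>t. 0 \<le> V t"
    and V: "\<And>t. ennreal (V t) \<le> (\<integral>\<^sup>+u. ennreal (decay_vec u * fejer N (t - u) * G u) \<partial>lborel)"
  shows "(\<integral>\<^sup>+t. ennreal (V t powr q) \<partial>torus) \<le>
    ennreal (((4 * (q' / (q' - 1))) ^ CARD('d)) powr (q / q')) * (\<integral>\<^sup>+u. ennreal (G u powr q) \<partial>lborel)"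
proof -
  define \<kappa> where "\<kappa> = (4 * (q' / (q' - 1))) ^ CARD('d)"
  have \<kappa>: "0 < \<kappa>" using pq by (simp add: \<kappa>_def)
  define b where "b t = (\<integral>\<^sup>+u. ennreal (fejer N (t - u) * G u powr q) \<partial>lborel)" for t
  have fshift: "fejer N (t - u) = fejer N (- t + u)" for t u :: "real^'d"
    using fejer_uminus[of N "t - u"] by simp
  have pt: "ennreal (V t powr q) \<le> ennreal (\<kappa> powr (q / q')) * b t" for t
  proof (cases "b t = \<top>")
    case True
    then show ?thesis using \<kappa> by (simp add: ennreal_mult_top)
  next
    case False
    then obtain B where B: "b t = ennreal B" "0 \<le> B"
      by (cases "b t") auto
    let ?f = "\<lambda>u. decay_vec u * fejer N (t - u) powr (1 / q')"
    let ?g = "\<lambda>u. fejer N (t - u) powr (1 / q) * G u"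
    have "V t powr q \<le> \<kappa> powr (q / q') * b'" if b': "B < b'" for b'
    proof -
      have "(\<integral>\<^sup>+u. ennreal (?f u * ?g u) \<partial>lborel) \<le> ennreal (\<kappa> powr (1 / q') * b' powr (1 / q))"
      proof (rule nn_integral_Holder_le)
        have "(\<integral>\<^sup>+u. ennreal (?f u powr q') \<partial>lborel) = (\<integral>\<^sup>+u. ennreal (decay_vec u powr q') * ennreal (fejer N (- t + u)) \<partial>lborel)"
          unfolding fshift[symmetric] using pq
          by (intro nn_integral_cong) (simp add: powr_mult powr_powr fejer_nonneg decay_vec_nonneg ennreal_mult)
        also have "\<dots> \<le> ennreal \<kappa> * (\<integral>\<^sup>+u. ennreal (fejer N (- t + u)) \<partial>torus)"
          unfolding \<kappa>_def
        proof (rule periodization)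
          show "ennreal (fejer N (- t + (int_vec k + u))) = ennreal (fejer N (- t + u))" for k u
            by (simp only: add.left_commute[of "- t"] fejer_periodic)
        qed (use pq in auto)
        also have "\<dots> = ennreal \<kappa>"
          by (simp only: nn_integral_fejer[OF N] mult_1_right)
        finally show "(\<integral>\<^sup>+u. ennreal (?f u powr q') \<partial>lborel) \<le> ennreal \<kappa>" .
        have "(\<integral>\<^sup>+u. ennreal (?g u powr q) \<partial>lborel) = b t"
          unfolding b_def using pq
          by (intro nn_integral_cong) (simp add: powr_mult powr_powr fejer_nonneg G0)
        also have "\<dots> \<le> ennreal b'"
          using B b' by (simp add: ennreal_leI)
        finally show "(\<integral>\<^sup>+u. ennreal (?g u powr q) \<partial>lborel) \<le> ennreal b'" .
      qed (use pq \<kappa> B b' in \<open>auto simp: decay_vec_nonneg G0\<close>)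
      moreover have "?f u * ?g u = decay_vec u * fejer N (t - u) * G u" for u
      proof -
        have "fejer N (t - u) powr (1 / q') * fejer N (t - u) powr (1 / q) = fejer N (t - u)"
          using pq(3) fejer_nonneg[of N "t - u"] by (simp add: powr_add[symmetric])
        then show ?thesis
          by (simp add: mult.assoc[symmetric])
      qed
      ultimately have "(\<integral>\<^sup>+u. ennreal (decay_vec u * fejer N (t - u) * G u) \<partial>lborel) \<le> ennreal (\<kappa> powr (1 / q') * b' powr (1 / q))"
        by (simp only:)
      with V[of t] have "ennreal (V t) \<le> ennreal (\<kappa> powr (1 / q') * b' powr (1 / q))"
        by (rule order_trans)
      then have "V t \<le> \<kappa> powr (1 / q') * b' powr (1 / q)"
        by (simp add: ennreal_le_iff)
      then have "V t powr q \<le> (\<kappa> powr (1 / q') * b' powr (1 / q)) powr q"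
        using pq V0 by (intro powr_mono2) auto
      also have "\<dots> = \<kappa> powr (q / q') * b'"
        using pq b' B by (simp add: powr_mult powr_powr)
      finally show ?thesis .
    qed
    then have "V t powr q \<le> \<kappa> powr (q / q') * B"
      by (rule le_mult_of_forall_gt[rotated]) auto
    then show ?thesis
      using B by (simp add: ennreal_leI flip: ennreal_mult)
  qed
  have bint: "(\<integral>\<^sup>+t. b t \<partial>torus) = (\<integral>\<^sup>+u. ennreal (G u powr q) \<partial>lborel)"
  proof -
    have "(\<integral>\<^sup>+t. b t \<partial>torus) = (\<integral>\<^sup>+t. (\<integral>\<^sup>+u. ennreal (fejer N (t - u) * G u powr q) * indicator (cbox 0 1) t \<partial>lborel) \<partial>lborel)"
      unfolding nn_integral_torus b_def by (intro nn_integral_cong nn_integral_multc[symmetric]) measurable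
    also have "\<dots> = (\<integral>\<^sup>+u. (\<integral>\<^sup>+t. ennreal (fejer N (t - u) * G u powr q) * indicator (cbox 0 1) t \<partial>lborel) \<partial>lborel)"
      by (rule lborel_pair.Fubini') measurable
    also have "\<dots> = (\<integral>\<^sup>+u. ennreal (G u powr q) * (\<integral>\<^sup>+t. ennreal (fejer N (- u + t)) \<partial>torus) \<partial>lborel)"
    proof (rule nn_integral_cong)
      fix u :: "real^'d"
      have "(\<integral>\<^sup>+t. ennreal (fejer N (t - u) * G u powr q) * indicator (cbox 0 1) t \<partial>lborel) =
        (\<integral>\<^sup>+t. ennreal (G u powr q) * (ennreal (fejer N (- u + t)) * indicator (cbox 0 1) t) \<partial>lborel)"
        by (intro nn_integral_cong) (simp add: ennreal_mult fejer_nonneg mult_ac)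
      also have "\<dots> = ennreal (G u powr q) * (\<integral>\<^sup>+t. ennreal (fejer N (- u + t)) \<partial>torus)"
        unfolding nn_integral_torus by (rule nn_integral_cmult) measurable
      finally show "(\<integral>\<^sup>+t. ennreal (fejer N (t - u) * G u powr q) * indicator (cbox 0 1) t \<partial>lborel) =
        ennreal (G u powr q) * (\<integral>\<^sup>+t. ennreal (fejer N (- u + t)) \<partial>torus)" .
    qed
    also have "\<dots> = (\<integral>\<^sup>+u. ennreal (G u powr q) \<partial>lborel)"
      by (simp only: nn_integral_fejer[OF N] mult_1_right)
    finally show ?thesis .
  qed
  have "(\<integral>\<^sup>+t. ennreal (V t powr q) \<partial>torus) \<le> (\<integral>\<^sup>+t. ennreal (\<kappa> powr (q / q')) * b t \<partial>torus)"
    by (intro nn_integral_mono pt)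
  also have "\<dots> = ennreal (\<kappa> powr (q / q')) * (\<integral>\<^sup>+t. b t \<partial>torus)"
  proof (rule nn_integral_cmult)
    have "b \<in> borel_measurable lborel"
      unfolding b_def by measurable
    then show "b \<in> borel_measurable torus"
      unfolding torus_def by (intro measurable_restrict_space1 measurable_completion)
  qed
  finally show ?thesis
    by (simp add: bint \<kappa>_def)
qed

section \<open>A class of Schwartz functions closed under partial derivatives\<close>

text \<open>An algebra containing the exponential sums of the box kernels and the characters,
  together with the coordinates that appear when a Gaussian is differentiated.\<close>

inductive_set osc :: "(real^'d \<Rightarrow> complex) set" where
  osc_const: "(\<lambda>t. c) \<in> osc"
| osc_coord: "(\<lambda>t. complex_of_real (t $ i)) \<in> osc"
| osc_wave: "(\<lambda>t. cis (b \<bullet> t)) \<in> osc"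
| osc_add: "p \<in> osc \<Longrightarrow> q \<in> osc \<Longrightarrow> (\<lambda>t. p t + q t) \<in> osc"
| osc_mult: "p \<in> osc \<Longrightarrow> q \<in> osc \<Longrightarrow> (\<lambda>t. p t * q t) \<in> osc"

lemma osc_sum: "(\<And>i. i \<in> I \<Longrightarrow> p i \<in> osc) \<Longrightarrow> (\<lambda>t. \<Sum>i\<in>I. p i t) \<in> osc"
  by (induction I rule: infinite_finite_induct) (auto intro: osc_const osc_add)

lemma osc_prod: "(\<And>i. i \<in> I \<Longrightarrow> p i \<in> osc) \<Longrightarrow> (\<lambda>t. \<Prod>i\<in>I. p i t) \<in> osc"
  by (induction I rule: infinite_finite_induct) (auto intro: osc_const osc_mult)

lemma osc_inner: "(\<lambda>t::real^'d. complex_of_real (t \<bullet> v)) \<in> osc"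
proof -
  have "(\<lambda>t::real^'d. \<Sum>i\<in>UNIV. complex_of_real (t $ i) * complex_of_real (v $ i)) \<in> osc"
    by (intro osc_sum osc_mult osc_coord osc_const)
  then show ?thesis
    by (simp add: inner_vec_def)
qed

lemma has_derivative_cis_inner:
  "((\<lambda>t. cis (b \<bullet> t)) has_derivative (\<lambda>v. cis (b \<bullet> t) * (\<i> * complex_of_real (b \<bullet> v)))) (at t)"
proof -
  have "((\<lambda>t. exp (\<i> * complex_of_real (b \<bullet> t))) has_derivative
      (\<lambda>v. exp (\<i> * complex_of_real (b \<bullet> t)) * (\<i> * complex_of_real (b \<bullet> v)))) (at t)"
  proof (rule has_derivative_compose[where g=exp and g'="\<lambda>z. exp (\<i> * complex_of_real (b \<bullet> t)) * z", rotated])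
    show "(exp has_derivative (\<lambda>z. exp (\<i> * complex_of_real (b \<bullet> t)) * z)) (at (\<i> * complex_of_real (b \<bullet> t)))"
      using DERIV_exp[of "\<i> * complex_of_real (b \<bullet> t)"] by (simp add: has_field_derivative_def)
    show "((\<lambda>t. \<i> * complex_of_real (b \<bullet> t)) has_derivative (\<lambda>v. \<i> * complex_of_real (b \<bullet> v))) (at t)"
      by (auto intro!: derivative_eq_intros)
  qed
  then show ?thesis
    by (simp add: cis_conv_exp)
qed

text \<open>The total derivative is recorded, since \<open>partial_deriv\<close> is defined through
  \<open>frechet_derivative\<close>; membership in \<open>osc\<close> is claimed for each fixed
  direction \<open>v\<close>.\<close>

lemma osc_has_derivative:
  assumes "p \<in> osc"
  shows "\<exists>D. (\<forall>t. (p has_derivative D t) (at t)) \<and> (\<forall>v. (\<lambda>t. D t v) \<in> osc)"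
  using assms
proof induction
  case (osc_const c)
  show ?case
    by (rule exI[of _ "\<lambda>t v. 0"]) (auto intro: osc.osc_const)
next
  case (osc_coord i)
  have "((\<lambda>t. complex_of_real (t $ i)) has_derivative (\<lambda>v. complex_of_real (v $ i))) (at t)" for t :: "real^'a"
    by (intro has_derivative_of_real bounded_linear_imp_has_derivative bounded_linear_vec_nth)
  then show ?case
    by (intro exI[of _ "\<lambda>t v. complex_of_real (v $ i)"]) (auto intro: osc.osc_const)
next
  case (osc_wave b)
  show ?case
    by (rule exI[of _ "\<lambda>t v. cis (b \<bullet> t) * (\<i> * complex_of_real (b \<bullet> v))"])
      (auto intro: has_derivative_cis_inner osc.osc_mult osc.osc_wave osc.osc_const)
next
  case (osc_add p q)
  then obtain D E where "\<And>t. (p has_derivative D t) (at t)" "\<And>v. (\<lambda>t. D t v) \<in> osc"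
    "\<And>t. (q has_derivative E t) (at t)" "\<And>v. (\<lambda>t. E t v) \<in> osc" by auto
  then show ?case
    by (intro exI[of _ "\<lambda>t v. D t v + E t v"]) (auto intro: has_derivative_add osc.osc_add)
next
  case (osc_mult p q)
  then obtain D E where "\<And>t. (p has_derivative D t) (at t)" "\<And>v. (\<lambda>t. D t v) \<in> osc"
    "\<And>t. (q has_derivative E t) (at t)" "\<And>v. (\<lambda>t. E t v) \<in> osc" by auto
  note DE = this
  show ?case
  proof (intro exI[of _ "\<lambda>t v. p t * E t v + D t v * q t"] conjI allI)
    show "((\<lambda>t. p t * q t) has_derivative (\<lambda>v. p t * E t v + D t v * q t)) (at t)" for t
      by (rule has_derivative_mult[OF DE(1) DE(3)])
    show "(\<lambda>t. p t * E t v + D t v * q t) \<in> osc" for v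
      by (rule osc.osc_add[OF osc.osc_mult[OF osc_mult.hyps(1) DE(4)] osc.osc_mult[OF DE(2) osc_mult.hyps(2)]])
  qed
qed

lemma osc_growth:
  assumes "p \<in> osc"
  shows "\<exists>C N. \<forall>t. norm (p t) \<le> C * (1 + norm t) ^ N"
  using assms
proof induction
  case (osc_const c)
  show ?case by (rule exI[of _ "norm c"], rule exI[of _ 0]) auto
next
  case (osc_coord i)
  show ?case
    by (rule exI[of _ 1], rule exI[of _ 1]) (auto intro: add_increasing component_le_norm_cart)
next
  case (osc_wave b)
  show ?case by (rule exI[of _ 1], rule exI[of _ 0]) auto
next
  case (osc_add p q)
  then obtain C N C' N' where *: "\<And>t. norm (p t) \<le> C * (1 + norm t) ^ N" "\<And>t. norm (q t) \<le> C' * (1 + norm t) ^ N'"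
    by auto
  have mono: "C * (1 + norm t) ^ N \<le> \<bar>C\<bar> * (1 + norm t) ^ M" if "N \<le> M" for C N M and t :: "real^'a"
  proof -
    have "C * (1 + norm t) ^ N \<le> \<bar>C\<bar> * (1 + norm t) ^ N"
      by (intro mult_right_mono) auto
    also have "\<dots> \<le> \<bar>C\<bar> * (1 + norm t) ^ M"
      using that by (intro mult_left_mono power_increasing) auto
    finally show ?thesis .
  qed
  show ?case
  proof (rule exI[of _ "\<bar>C\<bar> + \<bar>C'\<bar>"], rule exI[of _ "max N N'"], rule allI)
    fix t
    have "norm (p t + q t) \<le> norm (p t) + norm (q t)" by (rule norm_triangle_ineq)
    also have "\<dots> \<le> \<bar>C\<bar> * (1 + norm t) ^ max N N' + \<bar>C'\<bar> * (1 + norm t) ^ max N N'"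
      by (intro add_mono order_trans[OF *(1) mono] order_trans[OF *(2) mono]) auto
    finally show "norm (p t + q t) \<le> (\<bar>C\<bar> + \<bar>C'\<bar>) * (1 + norm t) ^ max N N'"
      by (simp add: distrib_right)
  qed
next
  case (osc_mult p q)
  then obtain C N C' N' where *: "\<And>t. norm (p t) \<le> C * (1 + norm t) ^ N" "\<And>t. norm (q t) \<le> C' * (1 + norm t) ^ N'"
    by auto
  show ?case
  proof (rule exI[of _ "C * C'"], rule exI[of _ "N + N'"], rule allI)
    fix t
    have "norm (p t * q t) \<le> (C * (1 + norm t) ^ N) * (C' * (1 + norm t) ^ N')"
      unfolding norm_mult by (intro mult_mono *) (auto intro: order_trans[OF norm_ge_zero *(1)])
    then show "norm (p t * q t) \<le> C * C' * (1 + norm t) ^ (N + N')"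
      by (simp add: power_add mult_ac)
  qed
qed

text \<open>The rate \<open>c\<close> is a fixed parameter, as differentiation changes only the
  factor in front of the Gaussian. Closure under sums lets the terms carry different
  vectors.\<close>

inductive_set gaussian_osc :: "real \<Rightarrow> (real^'d \<Rightarrow> 'b::complex_banach) set" for c where
  gaussian_osc_base: "p \<in> osc \<Longrightarrow> (\<lambda>t. (p t * complex_of_real (exp (- c * (t \<bullet> t)))) *\<^sub>C x) \<in> gaussian_osc c"
| gaussian_osc_add: "f \<in> gaussian_osc c \<Longrightarrow> g \<in> gaussian_osc c \<Longrightarrow> (\<lambda>t. f t + g t) \<in> gaussian_osc c"

lemma gaussian_osc_sum:
  fixes f :: "'i \<Rightarrow> real^'d \<Rightarrow> 'b::complex_banach"
  shows "finite I \<Longrightarrow> (\<And>i. i \<in> I \<Longrightarrow> f i \<in> gaussian_osc c) \<Longrightarrow> (\<lambda>t. \<Sum>i\<in>I. f i t) \<in> gaussian_osc c"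
proof (induction I rule: finite_induct)
  case empty
  have "(\<lambda>t::real^'d. (0 * complex_of_real (exp (- c * (t \<bullet> t)))) *\<^sub>C (0::'b)) \<in> gaussian_osc c"
    by (intro gaussian_osc_base osc_const)
  then show ?case by (simp add: scaleC.zero_left)
qed (auto intro: gaussian_osc_add)

lemma gaussian_osc_has_derivative:
  fixes f :: "real^'d \<Rightarrow> 'b::complex_banach"
  assumes "f \<in> gaussian_osc c"
  shows "\<exists>D. (\<forall>t. (f has_derivative D t) (at t)) \<and> (\<forall>v. (\<lambda>t. D t v) \<in> gaussian_osc c)"
  using assms
proof induction
  case (gaussian_osc_base p x)
  then obtain D where D: "\<And>t. (p has_derivative D t) (at t)" "\<And>v. (\<lambda>t. D t v) \<in> osc"
    using osc_has_derivative by blast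
  let ?E = "\<lambda>t::real^'d. complex_of_real (exp (- c * (t \<bullet> t)))"
  let ?D = "\<lambda>t v. (D t v + p t * (complex_of_real (- 2 * c) * complex_of_real (t \<bullet> v)))"
  have E: "(?E has_derivative (\<lambda>v. complex_of_real (exp (- c * (t \<bullet> t)) * (- c * (2 * (t \<bullet> v)))))) (at t)" for t
    by (intro has_derivative_of_real) (auto intro!: derivative_eq_intros simp: inner_commute)
  have "((\<lambda>t. (p t * ?E t) *\<^sub>C x) has_derivative (\<lambda>v. (?D t v * ?E t) *\<^sub>C x)) (at t)" for t
  proof -
    have "((\<lambda>t. p t * ?E t) has_derivative (\<lambda>v. p t * complex_of_real (exp (- c * (t \<bullet> t)) * (- c * (2 * (t \<bullet> v)))) + D t v * ?E t)) (at t)"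
      by (rule has_derivative_mult[OF D(1) E])
    then have "((\<lambda>t. p t * ?E t) has_derivative (\<lambda>v. ?D t v * ?E t)) (at t)"
      by (rule has_derivative_eq_rhs) (auto simp: algebra_simps)
    then show ?thesis
      by (rule bounded_linear.has_derivative[OF scaleC.bounded_linear_left])
  qed
  moreover have "(\<lambda>t. (?D t v * ?E t) *\<^sub>C x) \<in> gaussian_osc c" for v
    by (intro gaussian_osc.gaussian_osc_base osc_add D osc_mult osc_const osc_inner gaussian_osc_base)
  ultimately show ?case
    by (intro exI[of _ "\<lambda>t v. (?D t v * ?E t) *\<^sub>C x"]) auto
next
  case (gaussian_osc_add f g)
  then obtain D E where "\<And>t. (f has_derivative D t) (at t)" "\<And>v. (\<lambda>t. D t v) \<in> gaussian_osc c"
    "\<And>t. (g has_derivative E t) (at t)" "\<And>v. (\<lambda>t. E t v) \<in> gaussian_osc c" by auto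
  then show ?case
    by (intro exI[of _ "\<lambda>t v. D t v + E t v"]) (auto intro: has_derivative_add gaussian_osc.gaussian_osc_add)
qed

lemma gaussian_osc_bounded:
  fixes f :: "real^'d \<Rightarrow> 'b::complex_banach"
  assumes "f \<in> gaussian_osc c" and c: "0 < c"
  shows "\<exists>B. \<forall>t. norm t ^ n * norm (f t) \<le> B"
  using assms(1)
proof induction
  case (gaussian_osc_base p x)
  obtain C N where CN: "\<And>t. norm (p t) \<le> C * (1 + norm t) ^ N"
    using osc_growth[OF gaussian_osc_base] by blast
  have C0: "0 \<le> C"
    using order_trans[OF norm_ge_zero CN[of 0]] by simp
  obtain B where B: "\<And>y. y \<ge> 0 \<Longrightarrow> (1 + y) ^ (n + N) * exp (- c * y\<^sup>2) \<le> (B::real)"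
    using bounded_power_exp[OF c] by blast
  show ?case
  proof (intro exI allI)
    fix t
    have "norm t ^ n * norm ((p t * complex_of_real (exp (- c * (t \<bullet> t)))) *\<^sub>C x) =
      norm t ^ n * norm (p t) * exp (- c * (norm t)\<^sup>2) * norm x"
      by (simp add: norm_scaleC norm_mult power2_norm_eq_inner)
    also have "\<dots> \<le> (1 + norm t) ^ n * (C * (1 + norm t) ^ N) * exp (- c * (norm t)\<^sup>2) * norm x"
      by (intro mult_right_mono mult_mono power_mono CN) auto
    also have "\<dots> = C * ((1 + norm t) ^ (n + N) * exp (- c * (norm t)\<^sup>2)) * norm x"
      by (simp add: power_add mult_ac)
    also have "\<dots> \<le> C * B * norm x"
      using C0 B by (intro mult_right_mono mult_left_mono) auto
    finally show "norm t ^ n * norm ((p t * complex_of_real (exp (- c * (t \<bullet> t)))) *\<^sub>C x) \<le> C * B * norm x" .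
  qed
next
  case (gaussian_osc_add f g)
  then obtain A B where *: "\<And>t. norm t ^ n * norm (f t) \<le> A" "\<And>t. norm t ^ n * norm (g t) \<le> B"
    by auto
  show ?case
  proof (intro exI allI)
    fix t
    have "norm t ^ n * norm (f t + g t) \<le> norm t ^ n * (norm (f t) + norm (g t))"
      by (intro mult_left_mono norm_triangle_ineq) auto
    also have "\<dots> \<le> A + B"
      using *[of t] by (simp add: distrib_left add_mono)
    finally show "norm t ^ n * norm (f t + g t) \<le> A + B" .
  qed
qed

lemma gaussian_osc_schwartz:
  fixes f :: "real^'d \<Rightarrow> 'b::complex_banach"
  assumes f: "f \<in> gaussian_osc c" and c: "0 < c"
  shows "f \<in> schwartz"
proof -
  have "foldr partial_deriv is f \<in> gaussian_osc c" for "is"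
  proof (induction "is")
    case Nil
    show ?case using f by simp
  next
    case (Cons i "is")
    obtain D where D: "\<And>t. (foldr partial_deriv is f has_derivative D t) (at t)"
      "\<And>v. (\<lambda>t. D t v) \<in> gaussian_osc c"
      using gaussian_osc_has_derivative[OF Cons.IH] by blast
    have "frechet_derivative (foldr partial_deriv is f) (at t) = D t" for t
      using frechet_derivative_at[OF D(1)] by simp
    then have "partial_deriv i (foldr partial_deriv is f) = (\<lambda>t. D t (axis i 1))"
      by (simp add: partial_deriv_def fun_eq_iff)
    with D(2) show ?case by simp
  qed
  then show ?thesis
    unfolding schwartz_def
  proof (intro CollectI allI conjI)
    fix "is" assume g: "\<And>is. foldr partial_deriv is f \<in> gaussian_osc c"
    show "foldr partial_deriv is f differentiable (at t)" for t
      using gaussian_osc_has_derivative[OF g[of "is"]] unfolding differentiable_def by blast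
    show "bounded (range (\<lambda>t. norm t ^ n *\<^sub>R foldr partial_deriv is f t))" for n
    proof -
      obtain B where "\<And>t. norm t ^ n * norm (foldr partial_deriv is f t) \<le> B"
        using gaussian_osc_bounded[OF g c] by blast
      then show ?thesis
        by (intro boundedI[of _ B]) auto
    qed
  qed
qed

section \<open>Test functions\<close>

definition box_kernel_vec :: "nat \<Rightarrow> real^'d \<Rightarrow> complex" where
  "box_kernel_vec n t = (\<Prod>i\<in>UNIV. box_kernel n (t $ i))"

definition box_symbol_vec :: "nat \<Rightarrow> real^'d \<Rightarrow> real" where
  "box_symbol_vec n \<xi> = (\<Prod>i\<in>UNIV. box_symbol n (\<xi> $ i))"

text \<open>The scale \<open>b\<close> may be negative: \<open>b = a\<close> gives the input of the
  multiplier, \<open>b = - a\<close> the function it is paired with. The index \<open>n\<close>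
  controls the smoothing.\<close>

definition test_fun :: "nat \<Rightarrow> real \<Rightarrow> (int^'d) set \<Rightarrow> (int^'d \<Rightarrow> 'b::complex_banach) \<Rightarrow> real^'d \<Rightarrow> 'b" where
  "test_fun n b K y s = box_kernel_vec n (b *\<^sub>R s) *\<^sub>C trig_poly K y (b *\<^sub>R s)"

lemma norm_box_kernel_vec_le: "norm (box_kernel_vec n t) \<le> decay_vec t"
  unfolding box_kernel_vec_def decay_vec_def prod_norm[symmetric]
  by (intro prod_mono conjI norm_box_kernel_le_decay norm_ge_zero)

lemma test_fun_alt: "test_fun n b K y s = (\<Sum>k\<in>K. (box_kernel_vec n (b *\<^sub>R s) * chr k (b *\<^sub>R s)) *\<^sub>C y k)"
  by (simp add: test_fun_def trig_poly_chr scaleC.sum_right scaleC_scaleC)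

text \<open>The Gaussians of the coordinates multiply to \<open>exp (- c * (s \<bullet> s))\<close>;
  the remaining factors are finite products of finite exponential sums and lie in
  \<open>osc\<close>.\<close>

lemma test_fun_schwartz:
  fixes y :: "int^'d \<Rightarrow> 'b::complex_banach"
  assumes K: "finite K" and b: "b \<noteq> 0"
  shows "test_fun n b K y \<in> schwartz"
proof -
  define c where "c = pi * (wid n)\<^sup>2 * b\<^sup>2"
  have c: "0 < c" using wid[of n] b by (simp add: c_def)
  define p where "p k s = (\<Prod>i\<in>UNIV. \<Sum>j<nodes n. cis (axis i (2 * pi * (b * (real j / real (nodes n)))) \<bullet> s) * (1 / complex_of_real (real (nodes n)))) * cis ((2 * pi * b) *\<^sub>R int_vec k \<bullet> s)"
    for k :: "int^'d" and s
  have p: "p k \<in> osc" for k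
    unfolding p_def by (intro osc_mult osc_prod osc_sum osc_wave osc_const)
  have eq: "box_kernel_vec n (b *\<^sub>R s) * chr k (b *\<^sub>R s) = p k s * complex_of_real (exp (- c * (s \<bullet> s)))" for k s
  proof -
    have "box_kernel_vec n (b *\<^sub>R s) = (\<Prod>i\<in>UNIV. complex_of_real (exp (- c * (s $ i)\<^sup>2)) *
       (\<Sum>j<nodes n. cis (axis i (2 * pi * (b * (real j / real (nodes n)))) \<bullet> s) * (1 / complex_of_real (real (nodes n)))))"
      unfolding box_kernel_vec_def
    proof (rule prod.cong[OF refl])
      fix i
      show "box_kernel n ((b *\<^sub>R s) $ i) = complex_of_real (exp (- c * (s $ i)\<^sup>2)) *
       (\<Sum>j<nodes n. cis (axis i (2 * pi * (b * (real j / real (nodes n)))) \<bullet> s) * (1 / complex_of_real (real (nodes n))))"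
        unfolding vector_scaleR_component real_scaleR_def
        unfolding box_kernel_def scaleR_conv_of_real
        by (simp add: c_def inner_axis' power_mult_distrib sum_divide_distrib mult_ac)
    qed
    also have "\<dots> = (\<Prod>i\<in>UNIV. complex_of_real (exp (- c * (s $ i)\<^sup>2))) *
       (\<Prod>i\<in>UNIV. \<Sum>j<nodes n. cis (axis i (2 * pi * (b * (real j / real (nodes n)))) \<bullet> s) * (1 / complex_of_real (real (nodes n))))"
      by (rule prod.distrib)
    also have "(\<Prod>i\<in>UNIV. complex_of_real (exp (- c * (s $ i)\<^sup>2))) = complex_of_real (exp (- c * (s \<bullet> s)))"
    proof -
      have "- c * (s \<bullet> s) = (\<Sum>i\<in>UNIV. - c * (s $ i)\<^sup>2)"
        by (simp only: inner_vec_def inner_real_def power2_eq_square sum_distrib_left)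
      then show ?thesis
        by (simp only: of_real_prod exp_sum finite)
    qed
    finally show ?thesis
      by (simp add: p_def chr_def mult_ac)
  qed
  have "(\<lambda>s. \<Sum>k\<in>K. (p k s * complex_of_real (exp (- c * (s \<bullet> s)))) *\<^sub>C y k) \<in> gaussian_osc c"
    by (intro gaussian_osc_sum K gaussian_osc_base p)
  then have "test_fun n b K y \<in> gaussian_osc c"
    by (simp only: test_fun_alt[abs_def] eq)
  then show ?thesis
    using c by (rule gaussian_osc_schwartz)
qed

text \<open>Once the exponentials are combined, the integrand factors over the coordinates.
  Substituting \<open>u = b s\<close> in each of them yields a factor \<open>1 / |b|\<close> and the
  frequency \<open>\<xi> $ i / b - k $ i\<close>.\<close>

lemma
  fixes k :: "int^'d"
  assumes b: "b \<noteq> 0"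
  shows integrable_test_kernel: "integrable lborel (\<lambda>s. cis (- 2 * pi * (\<xi> \<bullet> s)) * (box_kernel_vec n (b *\<^sub>R s) * chr k (b *\<^sub>R s)))" (is ?I)
    and integral_test_kernel: "(LINT s|lborel. cis (- 2 * pi * (\<xi> \<bullet> s)) * (box_kernel_vec n (b *\<^sub>R s) * chr k (b *\<^sub>R s))) =
      complex_of_real (box_symbol_vec n (\<xi> /\<^sub>R b - int_vec k) / \<bar>b\<bar> ^ CARD('d))" (is ?E)
proof -
  define F where "F i u = cis (- 2 * pi * ((\<xi> $ i / b - real_of_int (k $ i)) * u)) * box_kernel n u" for i u
  have eq: "cis (- 2 * pi * (\<xi> \<bullet> s)) * (box_kernel_vec n (b *\<^sub>R s) * chr k (b *\<^sub>R s)) = (\<Prod>i\<in>UNIV. F i (0 + b * s $ i))" for s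
  proof -
    have "cis (- 2 * pi * (\<xi> \<bullet> s)) * chr k (b *\<^sub>R s) = (\<Prod>i\<in>UNIV. cis (- 2 * pi * ((\<xi> $ i / b - real_of_int (k $ i)) * (b * s $ i))))"
    proof -
      have "- 2 * pi * (\<xi> \<bullet> s) + 2 * pi * (int_vec k \<bullet> (b *\<^sub>R s)) =
        (\<Sum>i\<in>UNIV. - 2 * pi * ((\<xi> $ i / b - real_of_int (k $ i)) * (b * s $ i)))"
        unfolding inner_vec_def sum_distrib_left sum.distrib[symmetric]
        using b by (intro sum.cong refl) (simp add: int_vec_def field_simps)
      then show ?thesis
        unfolding chr_def cis_mult by (simp only: cis_sum)
    qed
    then have "cis (- 2 * pi * (\<xi> \<bullet> s)) * chr k (b *\<^sub>R s) * box_kernel_vec n (b *\<^sub>R s) = (\<Prod>i\<in>UNIV. F i (b * s $ i))"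
      unfolding box_kernel_vec_def F_def by (simp add: prod.distrib)
    then show ?thesis
      by (simp add: mult_ac)
  qed
  have F: "integrable lborel (F i)" for i
    unfolding F_def by (rule integrable_box_kernel)
  have F': "integrable lborel (\<lambda>s. F i (0 + b * s))" for i
    using F b by (rule lborel_integrable_real_affine)
  have int: "(LINT s|lborel. F i (0 + b * s)) = complex_of_real (box_symbol n (\<xi> $ i / b - real_of_int (k $ i)) / \<bar>b\<bar>)" for i
  proof -
    have "complex_of_real (box_symbol n (\<xi> $ i / b - real_of_int (k $ i))) = integral\<^sup>L lborel (F i)"
      unfolding F_def by (rule integral_box_kernel[symmetric])
    also have "\<dots> = \<bar>b\<bar> *\<^sub>R (LINT s|lborel. F i (0 + b * s))"
      using b by (rule lborel_integral_real_affine)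
    finally show ?thesis
      using b by (simp add: scaleR_conv_of_real field_simps)
  qed
  show ?I
    unfolding eq by (rule integrable_prod_vec[OF F'])
  have "(LINT s|lborel. cis (- 2 * pi * (\<xi> \<bullet> s)) * (box_kernel_vec n (b *\<^sub>R s) * chr k (b *\<^sub>R s))) =
    (\<Prod>i\<in>UNIV. complex_of_real (box_symbol n (\<xi> $ i / b - real_of_int (k $ i)) / \<bar>b\<bar>))"
    unfolding eq by (subst integral_prod_vec[OF F']) (simp only: int)
  also have "\<dots> = complex_of_real (box_symbol_vec n (\<xi> /\<^sub>R b - int_vec k) / \<bar>b\<bar> ^ CARD('d))"
    by (simp add: box_symbol_vec_def int_vec_def prod_dividef divide_inverse_commute[of _ b])
  finally show ?E .
qed

lemma lebesgue_integral_lborel: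
  fixes u :: "'a::euclidean_space \<Rightarrow> 'b::{banach, second_countable_topology}"
  assumes "integrable lborel u"
  shows "integrable lebesgue u" "integral\<^sup>L lebesgue u = integral\<^sup>L lborel u"
proof -
  have "u \<in> borel_measurable lborel" using assms by (rule borel_measurable_integrable)
  then show "integrable lebesgue u" "integral\<^sup>L lebesgue u = integral\<^sup>L lborel u"
    using assms by (auto simp: integrable_completion integral_completion)
qed

lemma fourier_test_fun:
  fixes y :: "int^'d \<Rightarrow> 'b::complex_banach"
  assumes b: "b \<noteq> 0"
  shows "fourier (test_fun n b K y) \<xi> = (\<Sum>k\<in>K. (box_symbol_vec n (\<xi> /\<^sub>R b - int_vec k) / \<bar>b\<bar> ^ CARD('d)) *\<^sub>R y k)"
proof -
  have "has_Bochner_integral lebesgue (\<lambda>s. \<Sum>k\<in>K. (cis (- 2 * pi * (\<xi> \<bullet> s)) * (box_kernel_vec n (b *\<^sub>R s) * chr k (b *\<^sub>R s))) *\<^sub>C y k)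
    (\<Sum>k\<in>K. complex_of_real (box_symbol_vec n (\<xi> /\<^sub>R b - int_vec k) / \<bar>b\<bar> ^ CARD('d)) *\<^sub>C y k)"
  proof (rule completion.has_Bochner_integral_sum)
    fix k
    show "has_Bochner_integral lebesgue (\<lambda>s. (cis (- 2 * pi * (\<xi> \<bullet> s)) * (box_kernel_vec n (b *\<^sub>R s) * chr k (b *\<^sub>R s))) *\<^sub>C y k)
      (complex_of_real (box_symbol_vec n (\<xi> /\<^sub>R b - int_vec k) / \<bar>b\<bar> ^ CARD('d)) *\<^sub>C y k)"
      using Bochner_integral_scaleC_right[OF completion.complete_measure_axioms lebesgue_integral_lborel(1)[OF integrable_test_kernel[OF b, of \<xi> n k]], of "y k"]
      by (simp only: lebesgue_integral_lborel(2)[OF integrable_test_kernel[OF b]] integral_test_kernel[OF b])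
  qed
  then have "has_Bochner_integral lebesgue (\<lambda>s. cis (- 2 * pi * (\<xi> \<bullet> s)) *\<^sub>C test_fun n b K y s)
    (\<Sum>k\<in>K. (box_symbol_vec n (\<xi> /\<^sub>R b - int_vec k) / \<bar>b\<bar> ^ CARD('d)) *\<^sub>R y k)"
    by (simp only: test_fun_alt scaleC.sum_right scaleC_scaleC scaleC_of_real)
  then show ?thesis
    unfolding fourier_def by (rule completion.Bochner_integral_eqI)
qed

lemma inv_fourier_eq_fourier: "inv_fourier f t = fourier f (- t)"
  by (simp add: inv_fourier_def fourier_def inner_commute)

text \<open>The inverse transform is the transform at the reflected frequency, and the sign in
  \<open>- b\<close> undoes the reflection. So input and test function have transforms that are
  smoothed step functions on the same cells.\<close>

lemma inv_fourier_test_fun: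
  fixes y :: "int^'d \<Rightarrow> 'b::complex_banach"
  assumes b: "b \<noteq> 0"
  shows "inv_fourier (test_fun n (- b) K y) \<xi> = (\<Sum>k\<in>K. (box_symbol_vec n (\<xi> /\<^sub>R b - int_vec k) / \<bar>b\<bar> ^ CARD('d)) *\<^sub>R y k)"
  using fourier_test_fun[of "- b" n K y "- \<xi>"] b by (simp add: inv_fourier_eq_fourier)

section \<open>Change of variables for the Bochner integral\<close>

lemma strongly_measurable_distr:
  assumes f: "strongly_measurable N f" and T: "T \<in> M \<rightarrow>\<^sub>M N" and d: "distr M N T = N"
  shows "strongly_measurable M (\<lambda>x. f (T x))"
proof -
  obtain s where s: "\<And>i::nat. simple_function N (s i)" "AE x in N. (\<lambda>i. s i x) \<longlonglongrightarrow> f x"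
    using f unfolding strongly_measurable_def by auto
  have "AE x in distr M N T. (\<lambda>i. s i x) \<longlonglongrightarrow> f x"
    unfolding d by (rule s(2))
  then have "AE x in M. (\<lambda>i. s i (T x)) \<longlonglongrightarrow> f (T x)"
    by (rule AE_distrD[OF T])
  moreover have "simple_function M (\<lambda>x. s i (T x))" for i
    by (rule simple_function_comp[OF T s(1)])
  ultimately show ?thesis
    unfolding strongly_measurable_def by (intro exI[of _ "\<lambda>i x. s i (T x)"]) auto
qed

text \<open>Preimages under \<open>T\<close> preserve the measure of the level sets, hence the
  integrals of simple functions and the L^1 errors. An approximating sequence composed with
  \<open>T\<close> is therefore again approximating, with the same limit.\<close>

lemma has_Bochner_integral_distr:
  fixes f :: "'b \<Rightarrow> 'c::banach"
  assumes N: "complete_measure N" and f: "has_Bochner_integral N f y"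
    and T: "T \<in> M \<rightarrow>\<^sub>M N" and d: "distr M N T = N"
  shows "has_Bochner_integral M (\<lambda>x. f (T x)) y"
proof -
  interpret N: complete_measure N by fact
  obtain s where sm: "strongly_measurable N f"
    and s: "\<And>i. Bochner_Integration.simple_bochner_integrable N (s i)"
    "(\<lambda>i::nat. \<integral>\<^sup>+x. ennreal (norm (f x - s i x)) \<partial>N) \<longlonglongrightarrow> 0"
    "(\<lambda>i. Bochner_Integration.simple_bochner_integral N (s i)) \<longlonglongrightarrow> y"
    using f unfolding has_Bochner_integral_def by auto
  have sf: "simple_function N (s i)" for i
    using s(1)[of i] by (auto elim: simple_bochner_integrable.cases)
  have em: "emeasure M {x\<in>space M. P (s i (T x))} = emeasure N {x\<in>space N. P (s i x)}" for P i
  proof -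
    have A: "{x\<in>space N. P (s i x)} \<in> sets N"
    proof -
      have "s i -` {v. P v} \<inter> space N \<in> sets N"
        by (rule simple_functionD(2)[OF sf])
      also have "s i -` {v. P v} \<inter> space N = {x\<in>space N. P (s i x)}" by auto
      finally show ?thesis .
    qed
    have "emeasure N {x\<in>space N. P (s i x)} = emeasure (distr M N T) {x\<in>space N. P (s i x)}"
      by (simp add: d)
    also have "\<dots> = emeasure M (T -` {x\<in>space N. P (s i x)} \<inter> space M)"
      by (rule emeasure_distr[OF T A])
    also have "T -` {x\<in>space N. P (s i x)} \<inter> space M = {x\<in>space M. P (s i (T x))}"
      using measurable_space[OF T] by auto
    finally show ?thesis ..
  qed
  have me: "measure M {x\<in>space M. P (s i (T x))} = measure N {x\<in>space N. P (s i x)}" for P i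
    by (simp add: measure_def em)
  have int: "Bochner_Integration.simple_bochner_integrable M (\<lambda>x. s i (T x))" for i
    using s(1)[of i] simple_function_comp[OF T sf[of i]] em[of "\<lambda>v. v \<noteq> 0" i]
    by (auto intro!: simple_bochner_integrable.intros elim!: simple_bochner_integrable.cases)
  have sbi: "Bochner_Integration.simple_bochner_integral M (\<lambda>x. s i (T x)) = Bochner_Integration.simple_bochner_integral N (s i)" for i
    unfolding simple_bochner_integral_def
  proof (rule sum.mono_neutral_cong_left)
    show "finite (s i ` space N)"
      using sf[of i] by (simp add: simple_function_def)
    show "(\<lambda>x. s i (T x)) ` space M \<subseteq> s i ` space N"
      using measurable_space[OF T] by auto
    \<comment> \<open>\<open>T\<close> need not be onto, so \<open>s i\<close> may take values that
      its composition with \<open>T\<close> misses, but only on a null set.\<close>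
    show "\<forall>v\<in>s i ` space N - (\<lambda>x. s i (T x)) ` space M. measure N {x \<in> space N. s i x = v} *\<^sub>R v = 0"
    proof
      fix v assume "v \<in> s i ` space N - (\<lambda>x. s i (T x)) ` space M"
      then have empty: "{x\<in>space M. s i (T x) = v} = {}" by (auto simp: image_iff)
      have "measure N {x \<in> space N. s i x = v} = measure M {}"
        unfolding empty[symmetric] by (rule me[of "\<lambda>w. w = v" i, symmetric])
      then show "measure N {x \<in> space N. s i x = v} *\<^sub>R v = 0"
        by simp
    qed
    show "measure M {xa \<in> space M. s i (T xa) = x} *\<^sub>R x = measure N {xa \<in> space N. s i xa = x} *\<^sub>R x" for x
      using me[of "\<lambda>w. w = x" i] by simp
  qed
  have nn: "(\<integral>\<^sup>+x. ennreal (norm (f (T x) - s i (T x))) \<partial>M) = (\<integral>\<^sup>+x. ennreal (norm (f x - s i x)) \<partial>N)" for i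
    using nn_integral_distr[OF T, of "\<lambda>x. ennreal (norm (f x - s i x))"]
      N.measurable_norm_diff_simple[OF sm sf[of i]] by (simp add: d)
  show ?thesis
    unfolding has_Bochner_integral_def
  proof (intro conjI strongly_measurable_distr[OF sm T d] exI[of _ "\<lambda>i x. s i (T x)"] allI int)
    show "(\<lambda>i. \<integral>\<^sup>+x. ennreal (norm (f (T x) - s i (T x))) \<partial>M) \<longlonglongrightarrow> 0"
      unfolding nn by (rule s(2))
    show "(\<lambda>i. Bochner_Integration.simple_bochner_integral M (\<lambda>x. s i (T x))) \<longlonglongrightarrow> y"
      unfolding sbi by (rule s(3))
  qed
qed

lemma strongly_measurable_restrict_space:
  fixes f :: "'a \<Rightarrow> 'b::real_normed_vector"
  assumes f: "strongly_measurable M f" and S: "S \<in> sets M"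
  shows "strongly_measurable (restrict_space M S) f"
proof -
  obtain s where s: "\<And>i::nat. simple_function M (s i)" "AE x in M. (\<lambda>i. s i x) \<longlonglongrightarrow> f x"
    using f unfolding strongly_measurable_def by auto
  have "simple_function M (\<lambda>x. indicator S x *\<^sub>R s i x)" for i
    by (rule simple_function_compose2[OF simple_function_indicator[OF S] s(1)])
  then have "simple_function (restrict_space M S) (s i)" for i
    using S by (simp add: simple_function_restrict_space)
  moreover have "AE x in restrict_space M S. (\<lambda>i. s i x) \<longlonglongrightarrow> f x"
    using s(2) S by (auto simp: AE_restrict_space_iff elim: eventually_mono)
  ultimately show ?thesis
    unfolding strongly_measurable_def by (intro exI[of _ s]) auto
qed

lemma has_Bochner_integral_indicator:
  fixes f :: "'a \<Rightarrow> 'b::banach"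
  assumes f: "has_Bochner_integral (restrict_space M S) f y" and S: "S \<in> sets M"
  shows "has_Bochner_integral M (\<lambda>x. indicator S x *\<^sub>R f x) y"
proof -
  have S': "S \<inter> space M \<in> sets M" using S by simp
  obtain s where sm: "strongly_measurable (restrict_space M S) f"
    and s: "\<And>i. Bochner_Integration.simple_bochner_integrable (restrict_space M S) (s i)"
    "(\<lambda>i::nat. \<integral>\<^sup>+x. ennreal (norm (f x - s i x)) \<partial>restrict_space M S) \<longlonglongrightarrow> 0"
    "(\<lambda>i. Bochner_Integration.simple_bochner_integral (restrict_space M S) (s i)) \<longlonglongrightarrow> y"
    using f unfolding has_Bochner_integral_def by auto
  have nn: "(\<integral>\<^sup>+x. ennreal (norm (indicator S x *\<^sub>R f x - indicator S x *\<^sub>R s i x)) \<partial>M) =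
      (\<integral>\<^sup>+x. ennreal (norm (f x - s i x)) \<partial>restrict_space M S)" for i
    by (subst nn_integral_restrict_space[OF S'], intro nn_integral_cong) (auto simp: indicator_def)
  show ?thesis
    unfolding has_Bochner_integral_def
  proof (intro conjI exI[of _ "\<lambda>i x. indicator S x *\<^sub>R s i x"] allI)
    obtain u where u: "\<And>i::nat. simple_function (restrict_space M S) (u i)" "AE x in restrict_space M S. (\<lambda>i. u i x) \<longlonglongrightarrow> f x"
      using sm unfolding strongly_measurable_def by auto
    have "AE x in M. x \<in> S \<longrightarrow> (\<lambda>i. u i x) \<longlonglongrightarrow> f x"
      using u(2) S' by (simp add: AE_restrict_space_iff)
    then have "AE x in M. (\<lambda>i. indicator S x *\<^sub>R u i x) \<longlonglongrightarrow> indicator S x *\<^sub>R f x"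
      by eventually_elim (auto simp: indicator_def)
    moreover have "simple_function M (\<lambda>x. indicator S x *\<^sub>R u i x)" for i
      using u(1) S' by (simp add: simple_function_restrict_space)
    ultimately show "strongly_measurable M (\<lambda>x. indicator S x *\<^sub>R f x)"
      unfolding strongly_measurable_def by (intro exI[of _ "\<lambda>i x. indicator S x *\<^sub>R u i x"]) auto
    show "Bochner_Integration.simple_bochner_integrable M (\<lambda>x. indicator S x *\<^sub>R s i x)" for i
      using s(1)[of i] by (simp only: simple_bochner_integrable_restrict_space[OF S'])
    show "(\<lambda>i. \<integral>\<^sup>+x. ennreal (norm (indicator S x *\<^sub>R f x - indicator S x *\<^sub>R s i x)) \<partial>M) \<longlonglongrightarrow> 0"
      unfolding nn by (rule s(2))
    show "(\<lambda>i. Bochner_Integration.simple_bochner_integral M (\<lambda>x. indicator S x *\<^sub>R s i x)) \<longlonglongrightarrow> y"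
      using s(3) simple_bochner_integral_restrict_space[OF S' s(1)] by simp
  qed
qed

lemma
  fixes c :: "'a::euclidean_space"
  shows lebesgue_translation_measurable: "(\<lambda>x. c + x) \<in> lebesgue \<rightarrow>\<^sub>M lebesgue"
    and distr_lebesgue_translation: "distr lebesgue lebesgue (\<lambda>x. c + x) = lebesgue"
proof -
  have eq: "(\<lambda>x. c + (\<Sum>j\<in>Basis. (1 * (x \<bullet> j)) *\<^sub>R j)) = (\<lambda>x. c + x)"
    by (simp add: euclidean_representation)
  show "(\<lambda>x. c + x) \<in> lebesgue \<rightarrow>\<^sub>M lebesgue"
    using lebesgue_affine_measurable[of "\<lambda>_. 1" c] unfolding eq by simp
  show "distr lebesgue lebesgue (\<lambda>x. c + x) = lebesgue"
    using lebesgue_affine_euclidean[of "\<lambda>_. 1" c] unfolding eq by (simp add: density_1)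
qed

text \<open>Limits of the smoothed symbols are integrals over the whole space against the indicator
  of a cell, and this is the form of the average that they meet. Local integrability on the compact
  cell guarantees that the integrals exist, so that \<open>Bochner_integral\<close> has its intended
  value.\<close>

lemma cube_average_eq:
  fixes m :: "real^'d \<Rightarrow> ('x::complex_banach, 'y::complex_banach) blinfun"
  assumes a: "0 < a" and loc: "(\<lambda>\<xi>. blinfun_apply (m \<xi>) x) \<in> L1_loc"
  shows "has_Bochner_integral lebesgue (\<lambda>\<xi>. indicator (cbox 0 1) (\<xi> /\<^sub>R a - int_vec k) *\<^sub>R blinfun_apply (m \<xi>) x)
    (a ^ CARD('d) *\<^sub>R cube_average a m k x)"
    and "has_Bochner_integral (lebesgue_on (cbox 0 (\<chi> i. a))) (\<lambda>t. blinfun_apply (m (t + a *\<^sub>R int_vec k)) x)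
    (a ^ CARD('d) *\<^sub>R cube_average a m k x)"
proof -
  define h where "h \<xi> = blinfun_apply (m \<xi>) x" for \<xi>
  define c where "c = a *\<^sub>R (int_vec k :: real^'d)"
  define S where "S = cbox (0::real^'d) (\<chi> i. a)"
  define F where "F \<xi> = (indicator (cbox 0 1) (\<xi> /\<^sub>R a - int_vec k) :: real) *\<^sub>R h \<xi>" for \<xi>
  define K where "K = (\<lambda>t. c + t) ` S"
  have S: "S \<in> sets lebesgue" "S \<inter> space lebesgue \<in> sets lebesgue" by (auto simp: S_def)
  have K: "compact K" unfolding K_def S_def by (intro compact_translation compact_cbox)
  have Kl: "K \<in> sets lebesgue"
    using K by (simp add: compact_imp_closed)
  have ind: "indicator (cbox 0 1) (\<xi> /\<^sub>R a - int_vec k) = (indicator K \<xi> :: real)" for \<xi> :: "real^'d"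
  proof -
    have "\<xi> /\<^sub>R a - int_vec k \<in> cbox 0 1 \<longleftrightarrow> \<xi> \<in> K"
    proof -
      have "\<xi> \<in> K \<longleftrightarrow> \<xi> - c \<in> S"
        unfolding K_def by (metis (no_types, lifting) add.commute diff_add_cancel image_iff add_diff_cancel_left')
      also have "\<dots> \<longleftrightarrow> (\<forall>i. 0 \<le> \<xi> $ i - a * int_vec k $ i \<and> \<xi> $ i - a * int_vec k $ i \<le> a)"
        by (simp add: S_def mem_box_cart c_def)
      also have "\<dots> \<longleftrightarrow> (\<forall>i. 0 \<le> \<xi> $ i / a - int_vec k $ i \<and> \<xi> $ i / a - int_vec k $ i \<le> 1)"
        using a by (simp add: field_simps)
      finally show ?thesis
        by (simp add: mem_box_cart divide_inverse_commute)
    qed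
    then show ?thesis by (simp add: indicator_def)
  qed
  have hm: "strongly_measurable lebesgue h" and hi: "integrable (lebesgue_on K) (\<lambda>t. norm (h t))"
    using loc K unfolding L1_loc_def h_def[symmetric] by auto
  have "strongly_measurable lebesgue (\<lambda>\<xi>. indicator K \<xi> *\<^sub>R h \<xi>)"
    using Kl by (intro strongly_measurable_scaleR hm borel_imp_strongly_measurable) auto
  then have Fm: "strongly_measurable lebesgue F"
    by (simp only: F_def[abs_def] ind)
  have "(\<integral>\<^sup>+\<xi>. ennreal (norm (F \<xi>)) \<partial>lebesgue) = (\<integral>\<^sup>+\<xi>. ennreal (norm (h \<xi>)) \<partial>lebesgue_on K)"
    using Kl unfolding F_def ind by (subst nn_integral_restrict_space) (auto intro!: nn_integral_cong simp: indicator_def)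
  also have "\<dots> < \<infinity>"
    using hi by (simp add: integrable_iff_bounded)
  finally have Ffin: "(\<integral>\<^sup>+\<xi>. ennreal (norm (F \<xi>)) \<partial>lebesgue) < \<infinity>" .
  define z where "z = Bochner_integral lebesgue F"
  have Fz: "has_Bochner_integral lebesgue F z"
    unfolding z_def by (rule completion.has_Bochner_integral_ex[OF Fm Ffin])
  have FT: "F (c + t) = indicator S t *\<^sub>R h (c + t)" for t
  proof -
    have "c + t \<in> K \<longleftrightarrow> t \<in> S" by (auto simp: K_def)
    then show ?thesis unfolding F_def ind by (simp add: indicator_def)
  qed
  have Sz: "has_Bochner_integral lebesgue (\<lambda>t. indicator S t *\<^sub>R h (c + t)) z"
    using has_Bochner_integral_distr[OF completion.complete_measure_axioms Fz lebesgue_translation_measurable[of c] distr_lebesgue_translation]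
    by (simp add: FT)
  have hT: "strongly_measurable (lebesgue_on S) (\<lambda>t. h (c + t))"
    by (intro strongly_measurable_restrict_space S strongly_measurable_distr[OF hm lebesgue_translation_measurable distr_lebesgue_translation])
  have "(\<integral>\<^sup>+t. ennreal (norm (h (c + t))) \<partial>lebesgue_on S) = (\<integral>\<^sup>+t. ennreal (norm (F (c + t))) \<partial>lebesgue)"
    by (subst nn_integral_restrict_space[OF S(2)]) (auto intro!: nn_integral_cong simp: FT indicator_def)
  also have "\<dots> = (\<integral>\<^sup>+t. ennreal (norm (F t)) \<partial>lebesgue)"
  proof -
    have "(\<lambda>\<xi>. ennreal (norm (F \<xi>))) \<in> borel_measurable lebesgue"
      using completion.borel_measurable_norm_strongly_measurable[OF Fm] by measurable
    then show ?thesis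
      using nn_integral_distr[OF lebesgue_translation_measurable[of c], of "\<lambda>\<xi>. ennreal (norm (F \<xi>))"]
      by (simp add: distr_lebesgue_translation)
  qed
  finally have hfin: "(\<integral>\<^sup>+t. ennreal (norm (h (c + t))) \<partial>lebesgue_on S) < \<infinity>"
    using Ffin by simp
  interpret S: complete_measure "lebesgue_on S"
    by (rule complete_measure_restrict_space[OF completion.complete_measure_axioms S(1)])
  have hz: "has_Bochner_integral (lebesgue_on S) (\<lambda>t. h (c + t)) (Bochner_integral (lebesgue_on S) (\<lambda>t. h (c + t)))"
    by (rule S.has_Bochner_integral_ex[OF hT hfin])
  have "z = Bochner_integral (lebesgue_on S) (\<lambda>t. h (c + t))"
    by (rule completion.has_Bochner_integral_unique[OF Sz has_Bochner_integral_indicator[OF hz S(1)]])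
  moreover have "a ^ CARD('d) *\<^sub>R cube_average a m k x = Bochner_integral (lebesgue_on S) (\<lambda>t. h (c + t))"
    using a by (simp add: cube_average_def h_def c_def S_def add.commute)
  ultimately have z: "z = a ^ CARD('d) *\<^sub>R cube_average a m k x" "Bochner_integral (lebesgue_on S) (\<lambda>t. h (c + t)) = a ^ CARD('d) *\<^sub>R cube_average a m k x"
    by simp_all
  show "has_Bochner_integral lebesgue (\<lambda>\<xi>. indicator (cbox 0 1) (\<xi> /\<^sub>R a - int_vec k) *\<^sub>R blinfun_apply (m \<xi>) x)
    (a ^ CARD('d) *\<^sub>R cube_average a m k x)"
    using Fz unfolding z F_def h_def .
  show "has_Bochner_integral (lebesgue_on (cbox 0 (\<chi> i. a))) (\<lambda>t. blinfun_apply (m (t + a *\<^sub>R int_vec k)) x)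
    (a ^ CARD('d) *\<^sub>R cube_average a m k x)"
    using hz unfolding z(2) by (simp add: h_def c_def S_def add.commute)
qed

section \<open>Passing to the limit in the symbol\<close>

text \<open>Since \<open>1 + norm v\<close> is at most the product of the numbers
  \<open>1 + |v $ i|\<close>, the one-dimensional decay in every coordinate multiplies to joint
  decay, still uniformly in \<open>n\<close>.\<close>

lemma box_symbol_vec_decay:
  "\<exists>B\<ge>0. \<forall>n. \<forall>v::real^'d. box_symbol_vec n v * (1 + norm v) ^ N \<le> B"
proof -
  obtain C where C: "\<And>n v. box_symbol n v * (1 + \<bar>v\<bar>) ^ N \<le> C"
    using box_symbol_decay by blast
  have C0: "0 \<le> C"
    using order_trans[OF box_symbol_nonneg C[of _ 0, simplified]] by simp
  have "box_symbol_vec n v * (1 + norm v) ^ N \<le> C ^ CARD('d)" for n and v :: "real^'d"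
  proof -
    have le: "1 + (\<Sum>i\<in>I. \<bar>v $ i\<bar>) \<le> (\<Prod>i\<in>I. 1 + \<bar>v $ i\<bar>)" if "finite I" for I :: "'d set"
      using that
    proof (induction I)
      case (insert i I)
      have "1 \<le> (\<Prod>i\<in>I. 1 + \<bar>v $ i\<bar>)" by (rule prod_ge_1) auto
      then have "\<bar>v $ i\<bar> * 1 \<le> \<bar>v $ i\<bar> * (\<Prod>i\<in>I. 1 + \<bar>v $ i\<bar>)"
        by (intro mult_left_mono) auto
      with insert show ?case by (simp add: distrib_right)
    qed simp
    have "norm v \<le> (\<Sum>i\<in>UNIV. \<bar>v $ i\<bar>)"
      by (rule norm_le_l1_cart)
    then have "1 + norm v \<le> (\<Prod>i\<in>UNIV. 1 + \<bar>v $ i\<bar>)"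
      using le[of UNIV] by simp
    then have "box_symbol_vec n v * (1 + norm v) ^ N \<le> box_symbol_vec n v * (\<Prod>i\<in>UNIV. 1 + \<bar>v $ i\<bar>) ^ N"
      by (intro mult_left_mono power_mono) (auto simp: box_symbol_vec_def intro!: prod_nonneg box_symbol_nonneg)
    also have "\<dots> = (\<Prod>i\<in>UNIV. box_symbol n (v $ i) * (1 + \<bar>v $ i\<bar>) ^ N)"
      by (simp add: box_symbol_vec_def prod.distrib prod_power_distrib)
    also have "\<dots> \<le> (\<Prod>i\<in>(UNIV::'d set). C)"
      by (intro prod_mono conjI C mult_nonneg_nonneg box_symbol_nonneg) auto
    finally show ?thesis by simp
  qed
  with C0 show ?thesis by (intro exI[of _ "C ^ CARD('d)"]) auto
qed

lemma box_symbol_vec_nonneg: "0 \<le> box_symbol_vec n v"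
  by (auto simp: box_symbol_vec_def intro!: prod_nonneg box_symbol_nonneg)

lemma box_symbol_vec_le: "box_symbol_vec n (v::real^'d) \<le> 2 ^ CARD('d)"
proof -
  have "box_symbol_vec n v \<le> (\<Prod>i\<in>(UNIV::'d set). 2)"
    unfolding box_symbol_vec_def by (intro prod_mono conjI box_symbol_nonneg box_symbol_le_2)
  then show ?thesis by simp
qed

lemma box_symbol_vec_borel [measurable]: "box_symbol_vec n \<in> borel_measurable borel"
  unfolding box_symbol_vec_def[abs_def] box_symbol_def gauss_def by measurable

text \<open>Coordinates equal to 0 or 1 are excluded because the corresponding factor tends to 1/2
  there; these points form a null set.\<close>

lemma box_symbol_vec_tendsto:
  assumes "\<And>i. v $ i \<noteq> 0" "\<And>i. v $ i \<noteq> 1"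
  shows "(\<lambda>n. box_symbol_vec n v) \<longlonglongrightarrow> indicator (cbox 0 1) v"
proof -
  have "(\<lambda>n. box_symbol n (v $ i)) \<longlonglongrightarrow> indicator {0..1} (v $ i)" for i
  proof (cases "0 \<le> v $ i \<and> v $ i \<le> 1")
    case True
    then have "0 < v $ i" "v $ i < 1"
      using assms[of i] by (auto simp: less_le)
    with box_symbol_tendsto_1[OF this] show ?thesis by simp
  next
    case False
    then have "v $ i < 0 \<or> 1 < v $ i" by auto
    from box_symbol_tendsto_0[OF this] show ?thesis using False by (auto simp: indicator_def)
  qed
  then show ?thesis
    unfolding box_symbol_vec_def indicator_cbox_01 by (intro tendsto_prod) auto
qed

text \<open>Rounding the exponent up to a natural number matches the power in
  \<open>box_symbol_vec_decay\<close>.\<close>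

lemma moderate_growth_bound:
  fixes m :: "real^'d \<Rightarrow> ('x::complex_banach, 'y::complex_banach) blinfun"
  assumes "moderate_growth m"
  obtains N g where "integrable lebesgue g" "\<And>\<xi>. 0 \<le> g \<xi>" "\<And>\<xi>. norm (m \<xi>) \<le> (1 + norm \<xi>) ^ N * g \<xi>"
proof -
  obtain \<alpha> and g :: "real^'d \<Rightarrow> real" where *: "0 < \<alpha>" "integrable lebesgue g" "\<And>\<xi>. (1 + norm \<xi>) powr (- \<alpha>) * norm (m \<xi>) \<le> g \<xi>"
    using assms unfolding moderate_growth_def by auto
  have g0: "0 \<le> g \<xi>" for \<xi>
    by (rule order_trans[OF _ *(3)[of \<xi>]]) auto
  show ?thesis
  proof
    show "integrable lebesgue g" by fact
    show "0 \<le> g \<xi>" for \<xi> by (rule g0)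
    fix \<xi> :: "real^'d"
    have one: "1 \<le> 1 + norm \<xi>" by simp
    have "norm (m \<xi>) = (1 + norm \<xi>) powr \<alpha> * ((1 + norm \<xi>) powr (- \<alpha>) * norm (m \<xi>))"
    proof -
      have "1 + norm \<xi> \<noteq> 0"
        using norm_ge_zero[of \<xi>] by linarith
      then show ?thesis
        by (simp add: powr_minus)
    qed
    also have "\<dots> \<le> (1 + norm \<xi>) powr \<alpha> * g \<xi>"
      by (intro mult_left_mono *) auto
    also have "\<dots> \<le> (1 + norm \<xi>) powr (real (nat \<lceil>\<alpha>\<rceil>)) * g \<xi>"
      using *(1) by (intro mult_right_mono powr_mono g0) (auto simp: of_nat_ceiling)
    also have "\<dots> = (1 + norm \<xi>) ^ nat \<lceil>\<alpha>\<rceil> * g \<xi>"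
      by (subst powr_realpow) (auto intro: add_pos_nonneg)
    finally show "norm (m \<xi>) \<le> (1 + norm \<xi>) ^ nat \<lceil>\<alpha>\<rceil> * g \<xi>" .
  qed
qed

definition symbol_product :: "nat \<Rightarrow> real \<Rightarrow> int^'d \<Rightarrow> int^'d \<Rightarrow> real^'d \<Rightarrow> real" where
  "symbol_product n a \<kappa> k \<xi> = box_symbol_vec n (\<xi> /\<^sub>R a - int_vec \<kappa>) * box_symbol_vec n (\<xi> /\<^sub>R a - int_vec k)"

lemma symbol_product_borel [measurable]: "symbol_product n a \<kappa> k \<in> borel_measurable borel"
  unfolding symbol_product_def[abs_def] by measurable

text \<open>The factor centred at \<open>\<kappa>\<close> absorbs the growth of \<open>m\<close>:
  the constant \<open>E\<close> compares \<open>1 + norm \<xi>\<close> with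
  \<open>1 + norm v\<close> in the coordinate \<open>v\<close> of that cell. The other factor is
  merely bounded by \<open>2 ^ CARD('d)\<close>. The majorant does not depend on
  \<open>n\<close>.\<close>

lemma symbol_product_dominated:
  fixes m :: "real^'d \<Rightarrow> ('x::complex_banach, 'y::complex_banach) blinfun"
  assumes a: "0 < a" and m: "moderate_growth m"
  shows "\<exists>w. integrable lebesgue w \<and> (\<forall>n \<xi>. norm (symbol_product n a \<kappa> k \<xi> *\<^sub>R blinfun_apply (m \<xi>) x) \<le> w \<xi>)"
proof -
  obtain N g where g: "integrable lebesgue g" "\<And>\<xi>. 0 \<le> g \<xi>" "\<And>\<xi>. norm (m \<xi>) \<le> (1 + norm \<xi>) ^ N * g \<xi>"
    using moderate_growth_bound[OF m] by metis
  obtain B where B: "0 \<le> B" "\<And>n. \<And>v::real^'d. box_symbol_vec n v * (1 + norm v) ^ N \<le> B"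
    using box_symbol_vec_decay by blast
  define E where "E = 1 + a + a * norm (int_vec \<kappa> :: real^'d)"
  have "norm (symbol_product n a \<kappa> k \<xi> *\<^sub>R blinfun_apply (m \<xi>) x) \<le> (B * 2 ^ CARD('d) * E ^ N * norm x) * g \<xi>" for n \<xi>
  proof -
    define v where "v = \<xi> /\<^sub>R a - int_vec \<kappa>"
    have "\<xi> = a *\<^sub>R v + a *\<^sub>R int_vec \<kappa>"
      using a by (simp add: v_def scaleR_diff_right)
    then have "norm \<xi> \<le> a * norm v + a * norm (int_vec \<kappa> :: real^'d)"
      using a norm_triangle_ineq[of "a *\<^sub>R v" "a *\<^sub>R int_vec \<kappa>"] by simp
    then have "1 + norm \<xi> \<le> E * (1 + norm v)"
    proof -
      have "E * (1 + norm v) = 1 + a + a * norm (int_vec \<kappa> :: real^'d) + norm v + a * norm v + a * norm (int_vec \<kappa> :: real^'d) * norm v"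
        by (simp add: E_def algebra_simps)
      moreover have "0 \<le> a * norm (int_vec \<kappa> :: real^'d) * norm v"
        using a by simp
      ultimately show ?thesis
        using a norm_ge_zero[of v] \<open>norm \<xi> \<le> _\<close> by linarith
    qed
    then have E: "(1 + norm \<xi>) ^ N \<le> E ^ N * (1 + norm v) ^ N"
      unfolding power_mult_distrib[symmetric] by (intro power_mono) auto
    have "norm (symbol_product n a \<kappa> k \<xi> *\<^sub>R blinfun_apply (m \<xi>) x) =
      box_symbol_vec n v * box_symbol_vec n (\<xi> /\<^sub>R a - int_vec k) * norm (blinfun_apply (m \<xi>) x)"
      by (simp add: symbol_product_def v_def box_symbol_vec_nonneg)
    also have "\<dots> \<le> box_symbol_vec n v * 2 ^ CARD('d) * ((E ^ N * (1 + norm v) ^ N * g \<xi>) * norm x)"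
    proof (intro mult_mono box_symbol_vec_le order_refl)
      have "norm (blinfun_apply (m \<xi>) x) \<le> norm (m \<xi>) * norm x"
        by (rule norm_blinfun)
      also have "\<dots> \<le> ((1 + norm \<xi>) ^ N * g \<xi>) * norm x"
        by (intro mult_right_mono g) auto
      also have "\<dots> \<le> (E ^ N * (1 + norm v) ^ N * g \<xi>) * norm x"
        by (intro mult_right_mono E g) auto
      finally show "norm (blinfun_apply (m \<xi>) x) \<le> (E ^ N * (1 + norm v) ^ N * g \<xi>) * norm x" .
    qed (auto intro!: mult_nonneg_nonneg box_symbol_vec_nonneg)
    also have "\<dots> = (box_symbol_vec n v * (1 + norm v) ^ N) * (2 ^ CARD('d) * E ^ N * norm x * g \<xi>)"
      by (simp add: mult_ac)
    also have "\<dots> \<le> B * (2 ^ CARD('d) * E ^ N * norm x * g \<xi>)"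
      using a by (intro mult_right_mono B mult_nonneg_nonneg g) (auto simp: E_def)
    finally show ?thesis by (simp add: mult_ac)
  qed
  then show ?thesis
    using g(1) by (intro exI[of _ "\<lambda>\<xi>. (B * 2 ^ CARD('d) * E ^ N * norm x) * g \<xi>"]) auto
qed

lemma strongly_measurable_symbol_product:
  assumes "strongly_measurable lebesgue h"
  shows "strongly_measurable lebesgue (\<lambda>\<xi>. symbol_product n a \<kappa> k \<xi> *\<^sub>R h \<xi>)"
proof (intro strongly_measurable_scaleR assms borel_imp_strongly_measurable)
  show "symbol_product n a \<kappa> k \<in> borel_measurable lebesgue"
    by (intro measurable_completion) simp
qed

text \<open>Off finitely many hyperplanes both factors converge to indicators of closed cells.
  Different cells meet only in those hyperplanes, so a cell average remains on the diagonal and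
  nothing elsewhere.\<close>

lemma symbol_product_integral_tendsto:
  fixes m :: "real^'d \<Rightarrow> ('x::complex_banach, 'y::complex_banach) blinfun"
  assumes a: "0 < a" and m: "moderate_growth m" and loc: "(\<lambda>\<xi>. blinfun_apply (m \<xi>) x) \<in> L1_loc"
  shows "(\<lambda>n. Bochner_integral lebesgue (\<lambda>\<xi>. symbol_product n a \<kappa> k \<xi> *\<^sub>R blinfun_apply (m \<xi>) x)) \<longlonglongrightarrow>
    (if \<kappa> = k then a ^ CARD('d) *\<^sub>R cube_average a m k x else 0)"
proof -
  define h where "h \<xi> = blinfun_apply (m \<xi>) x" for \<xi>
  have hm: "strongly_measurable lebesgue h"
    using m unfolding moderate_growth_def h_def[abs_def] by auto
  define L where "L \<xi> = (if \<kappa> = k then indicator (cbox 0 1) (\<xi> /\<^sub>R a - int_vec k) *\<^sub>R h \<xi> else 0)" for \<xi>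
  obtain w where w: "integrable lebesgue w" "\<And>n \<xi>. norm (symbol_product n a \<kappa> k \<xi> *\<^sub>R h \<xi>) \<le> w \<xi>"
    using symbol_product_dominated[OF a m, of \<kappa> k x] unfolding h_def by auto
  have Lint: "has_Bochner_integral lebesgue L (if \<kappa> = k then a ^ CARD('d) *\<^sub>R cube_average a m k x else 0)"
    using cube_average_eq(1)[OF a loc, of k] completion.has_Bochner_integral_zero
    by (auto simp: L_def[abs_def] h_def[abs_def])
  have plane: "AE \<xi> in lebesgue. \<forall>i. \<xi> $ i \<noteq> c i" for c :: "'d \<Rightarrow> real"
  proof (rule eventually_all_finite)
    fix i
    have "{\<xi>::real^'d. \<xi> $ i = c i} \<in> null_sets lebesgue"
    proof -
      have "{\<xi>::real^'d. \<xi> $ i = c i} = {\<xi>. \<xi> \<bullet> axis i 1 = c i}"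
        by (simp add: inner_axis)
      then show ?thesis
        unfolding negligible_iff_null_sets[symmetric]
        by (simp only:) (rule negligible_standard_hyperplane, auto simp: Basis_vec_def)
    qed
    then show "AE \<xi> in lebesgue. \<xi> $ i \<noteq> c i"
      by (rule AE_I') auto
  qed
  have lim: "AE \<xi> in lebesgue. (\<lambda>n. symbol_product n a \<kappa> k \<xi> *\<^sub>R h \<xi>) \<longlonglongrightarrow> L \<xi>"
    using plane[of "\<lambda>i. a * int_vec \<kappa> $ i"] plane[of "\<lambda>i. a * (int_vec \<kappa> $ i + 1)"]
      plane[of "\<lambda>i. a * int_vec k $ i"] plane[of "\<lambda>i. a * (int_vec k $ i + 1)"]
  proof eventually_elim
    case (elim \<xi>)
    have neq: "(\<xi> /\<^sub>R a - int_vec j) $ i \<noteq> 0" "(\<xi> /\<^sub>R a - int_vec j) $ i \<noteq> 1" if "j = \<kappa> \<or> j = k" for i j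
    proof -
      have ne: "\<xi> $ i \<noteq> a * int_vec j $ i" "\<xi> $ i \<noteq> a * (int_vec j $ i + 1)"
        using elim that by auto
      have eq: "\<xi> $ i = a * ((\<xi> /\<^sub>R a - int_vec j) $ i + int_vec j $ i)"
        using a by simp
      show "(\<xi> /\<^sub>R a - int_vec j) $ i \<noteq> 0" "(\<xi> /\<^sub>R a - int_vec j) $ i \<noteq> 1"
        using ne eq by (metis add.left_neutral, metis add.commute)
    qed
    have "(\<lambda>n. symbol_product n a \<kappa> k \<xi>) \<longlonglongrightarrow> indicator (cbox 0 1) (\<xi> /\<^sub>R a - int_vec \<kappa>) * indicator (cbox 0 1) (\<xi> /\<^sub>R a - int_vec k)"
      unfolding symbol_product_def by (intro tendsto_mult box_symbol_vec_tendsto neq) auto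
    also have "indicator (cbox 0 1) (\<xi> /\<^sub>R a - int_vec \<kappa>) * indicator (cbox 0 1) (\<xi> /\<^sub>R a - int_vec k) =
        (if \<kappa> = k then indicator (cbox 0 1) (\<xi> /\<^sub>R a - int_vec k) else (0::real))"
    proof (cases "\<kappa> = k")
      case False
      then obtain i where i: "\<kappa> $ i \<noteq> k $ i" by (auto simp: vec_eq_iff)
      \<comment> \<open>In a coordinate where \<open>\<kappa>\<close> and \<open>k\<close> differ,
        one number would lie strictly inside two different unit intervals with integer
        endpoints.\<close>
      have "\<not> (\<xi> /\<^sub>R a - int_vec \<kappa> \<in> cbox 0 1 \<and> \<xi> /\<^sub>R a - int_vec k \<in> cbox 0 1)"
      proof
        assume "\<xi> /\<^sub>R a - int_vec \<kappa> \<in> cbox 0 1 \<and> \<xi> /\<^sub>R a - int_vec k \<in> cbox 0 1"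
        then have "0 \<le> (\<xi> /\<^sub>R a) $ i - \<kappa> $ i" "(\<xi> /\<^sub>R a) $ i - \<kappa> $ i \<le> 1" "0 \<le> (\<xi> /\<^sub>R a) $ i - k $ i" "(\<xi> /\<^sub>R a) $ i - k $ i \<le> 1"
          unfolding mem_box_cart by (auto simp: int_vec_def dest!: spec[of _ i])
        moreover have "(\<xi> /\<^sub>R a) $ i - \<kappa> $ i \<noteq> 0" "(\<xi> /\<^sub>R a) $ i - \<kappa> $ i \<noteq> 1" "(\<xi> /\<^sub>R a) $ i - k $ i \<noteq> 0" "(\<xi> /\<^sub>R a) $ i - k $ i \<noteq> 1"
          using neq[of \<kappa> i] neq[of k i] by (simp_all add: int_vec_def)
        ultimately have "real_of_int (\<kappa> $ i) < real_of_int (k $ i) + 1" "real_of_int (k $ i) < real_of_int (\<kappa> $ i) + 1"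
          by linarith+
        with i show False by linarith
      qed
      with False show ?thesis by (auto simp: indicator_def)
    qed (simp add: indicator_def)
    finally have "(\<lambda>n. symbol_product n a \<kappa> k \<xi> *\<^sub>R h \<xi>) \<longlonglongrightarrow> (if \<kappa> = k then indicator (cbox 0 1) (\<xi> /\<^sub>R a - int_vec k) else (0::real)) *\<^sub>R h \<xi>"
      by (intro tendsto_scaleR tendsto_const)
    then show ?case by (simp add: L_def if_distrib[of "\<lambda>r. r *\<^sub>R h \<xi>"] cong: if_cong)
  qed
  have "(\<lambda>n. Bochner_integral lebesgue (\<lambda>\<xi>. symbol_product n a \<kappa> k \<xi> *\<^sub>R h \<xi>)) \<longlonglongrightarrow> Bochner_integral lebesgue L"
  proof (rule completion.Bochner_integral_dominated_convergence[OF _ _ w(1) _ _ lim])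
    show "strongly_measurable lebesgue (\<lambda>\<xi>. symbol_product n a \<kappa> k \<xi> *\<^sub>R h \<xi>)" for n
      by (rule strongly_measurable_symbol_product[OF hm])
    show "strongly_measurable lebesgue L"
      using Lint by (simp add: has_Bochner_integral_def)
    show "AE \<xi> in lebesgue. norm (symbol_product n a \<kappa> k \<xi> *\<^sub>R h \<xi>) \<le> w \<xi>" for n
      using w(2) by auto
    show "AE \<xi> in lebesgue. norm (L \<xi>) \<le> w \<xi>"
      using lim
    proof eventually_elim
      case (elim \<xi>)
      show ?case
        by (rule LIMSEQ_le_const2[OF tendsto_norm[OF elim]]) (use w(2) in auto)
    qed
  qed
  then show ?thesis
    using completion.Bochner_integral_eqI[OF Lint] by (simp add: h_def)
qed

section \<open>Norms of test functions and of trigonometric polynomials\<close>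

definition kappa :: "nat \<Rightarrow> real \<Rightarrow> real" where
  "kappa d s = (4 * (s / (s - 1))) ^ d"

lemma kappa_ge_1: "1 < s \<Longrightarrow> 1 \<le> kappa d s"
  unfolding kappa_def by (intro one_le_power) (simp add: field_simps)

lemma continuous_on_trig_poly [continuous_intros]:
  "continuous_on S f \<Longrightarrow> continuous_on S (\<lambda>t. trig_poly K x (f t))"
  unfolding trig_poly_chr by (intro continuous_intros scaleC.continuous_on) auto

lemma trig_poly_periodic: "trig_poly K x (int_vec k + t) = trig_poly K x t"
  by (simp add: trig_poly_chr chr_add_arg)

lemma continuous_box_kernel_vec [continuous_intros]:
  "continuous_on S f \<Longrightarrow> continuous_on S (\<lambda>t. box_kernel_vec n (f t))"
  unfolding box_kernel_vec_def box_kernel_def using nodes_pos[of n]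
  by (intro continuous_intros) auto

lemma continuous_fejer: "continuous_on UNIV (fejer N)"
  unfolding fejer_def[abs_def] divide_inverse by (intro continuous_intros)

lemma borel_lebesgue: "f \<in> borel_measurable borel \<Longrightarrow> f \<in> borel_measurable lebesgue"
  by (intro measurable_completion) simp

lemma borel_torus: "f \<in> borel_measurable borel \<Longrightarrow> f \<in> borel_measurable torus"
  unfolding torus_def by (intro measurable_restrict_space1 borel_lebesgue)

lemma integrable_torus_continuous:
  fixes f :: "real^'d \<Rightarrow> real"
  assumes "continuous_on UNIV f"
  shows "integrable torus f"
  unfolding torus_def by (intro continuous_imp_integrable continuous_on_subset[OF assms]) auto

lemma continuous_on_norm_powr:
  fixes f :: "'a::topological_space \<Rightarrow> 'b::real_normed_vector"
  assumes "continuous_on S f" "0 < p" shows "continuous_on S (\<lambda>t. norm (f t) powr p)"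
  using assms by (intro continuous_on_powr' continuous_intros) auto

lemma nn_integral_eq_Lp_norm_powr:
  assumes "integrable M (\<lambda>x. norm (f x) powr p)" "0 < p"
  shows "(\<integral>\<^sup>+x. ennreal (norm (f x) powr p) \<partial>M) = ennreal (Lp_norm M p f powr p)"
proof -
  have "(\<integral>\<^sup>+x. ennreal (norm (f x) powr p) \<partial>M) = ennreal (LINT x|M. norm (f x) powr p)"
    by (rule nn_integral_eq_integral[OF assms(1)]) simp
  also have "(LINT x|M. norm (f x) powr p) = Lp_norm M p f powr p"
    using assms(2) by (simp add: Lp_norm_def powr_powr)
  finally show ?thesis .
qed

lemma Lp_norm_nonneg: "0 \<le> Lp_norm M p f"
  by (simp add: Lp_norm_def)

lemma Lp_norm_leI:
  assumes "(\<integral>\<^sup>+x. ennreal (norm (f x) powr p) \<partial>M) \<le> ennreal (B powr p)" "0 < p" "0 \<le> B"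
  shows "Lp_norm M p f \<le> B"
proof -
  have "(LINT x|M. norm (f x) powr p) \<le> B powr p"
    by (rule integral_real_bounded[OF _ assms(1)]) simp
  then have "(LINT x|M. norm (f x) powr p) powr (1 / p) \<le> (B powr p) powr (1 / p)"
    using assms by (intro powr_mono2) auto
  then show ?thesis
    using assms by (simp add: Lp_norm_def powr_powr)
qed

text \<open>\<open>decay_vec\<close> dominates the kernel uniformly in \<open>n\<close>, and
  \<open>periodization\<close> applies to the \<open>p\<close>-th power of the norm of the
  polynomial. The dilation by \<open>a\<close> gives the factor \<open>a^(-d)\<close> before the
  root is taken.\<close>

lemma Lp_norm_test_fun:
  fixes x :: "int^'d \<Rightarrow> 'b::complex_banach"
  assumes p: "1 < p" and a: "0 < a"
  shows "Lp_norm lebesgue p (test_fun n a K x) \<le>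
    kappa CARD('d) p powr (1 / p) * a powr (- real CARD('d) / p) * Lp_norm torus p (trig_poly K x)"
proof (rule Lp_norm_leI)
  let ?P = "trig_poly K x"
  define I where "I = Lp_norm torus p ?P"
  have I0: "0 \<le> I" by (simp add: I_def Lp_norm_nonneg)
  have cP: "continuous_on UNIV (\<lambda>t. norm (?P t) powr p)"
    using p by (intro continuous_on_norm_powr continuous_intros) auto
  have [measurable]: "(\<lambda>t. norm (?P t) powr p) \<in> borel_measurable borel"
    by (rule borel_measurable_continuous_onI[OF cP])
  define g where "g u = ennreal (norm (box_kernel_vec n u *\<^sub>C ?P u) powr p)" for u
  have [measurable]: "g \<in> borel_measurable borel"
  proof -
    have "continuous_on UNIV (\<lambda>u. norm (box_kernel_vec n u *\<^sub>C ?P u) powr p)"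
      using p by (intro continuous_on_norm_powr scaleC.continuous_on continuous_intros) auto
    then show ?thesis
      unfolding g_def[abs_def] by (intro measurable_compose[OF _ measurable_ennreal] borel_measurable_continuous_onI)
  qed
  have "(\<integral>\<^sup>+u. g u \<partial>lborel) \<le> (\<integral>\<^sup>+u. ennreal (decay_vec u powr p) * ennreal (norm (?P u) powr p) \<partial>lborel)"
  proof (rule nn_integral_mono)
    fix u
    have "norm (box_kernel_vec n u *\<^sub>C ?P u) powr p \<le> (decay_vec u * norm (?P u)) powr p"
      using p norm_box_kernel_vec_le[of n u] by (intro powr_mono2) (auto simp: norm_scaleC intro!: mult_right_mono)
    then show "g u \<le> ennreal (decay_vec u powr p) * ennreal (norm (?P u) powr p)"
      by (simp add: g_def powr_mult decay_vec_nonneg ennreal_leI flip: ennreal_mult)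
  qed
  also have "\<dots> \<le> ennreal (kappa CARD('d) p) * (\<integral>\<^sup>+u. ennreal (norm (?P u) powr p) \<partial>torus)"
    unfolding kappa_def by (rule periodization) (use p in \<open>auto simp: trig_poly_periodic\<close>)
  also have "(\<integral>\<^sup>+u. ennreal (norm (?P u) powr p) \<partial>torus) = ennreal (I powr p)"
    unfolding I_def using p by (intro nn_integral_eq_Lp_norm_powr integrable_torus_continuous cP) auto
  finally have le: "(\<integral>\<^sup>+u. g u \<partial>lborel) \<le> ennreal (kappa CARD('d) p * I powr p)"
    using kappa_ge_1[OF p, of "CARD('d)"] by (simp add: ennreal_mult)
  have "(\<integral>\<^sup>+s. ennreal (norm (test_fun n a K x s) powr p) \<partial>lebesgue) = (\<integral>\<^sup>+s. g (a *\<^sub>R s) \<partial>lborel)"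
    by (simp add: nn_integral_completion g_def test_fun_def)
  also have "\<dots> = ennreal (1 / a ^ CARD('d)) * (ennreal (a ^ CARD('d)) * (\<integral>\<^sup>+s. g (a *\<^sub>R s) \<partial>lborel))"
    using a by (simp add: mult.assoc[symmetric] flip: ennreal_mult)
  also have "ennreal (a ^ CARD('d)) * (\<integral>\<^sup>+s. g (a *\<^sub>R s) \<partial>lborel) = (\<integral>\<^sup>+u. g u \<partial>lborel)"
    using a by (intro nn_integral_lborel_scale[symmetric]) auto
  also have "ennreal (1 / a ^ CARD('d)) * (\<integral>\<^sup>+u. g u \<partial>lborel) \<le> ennreal (1 / a ^ CARD('d)) * ennreal (kappa CARD('d) p * I powr p)"
    by (intro mult_left_mono le) auto
  also have "\<dots> = ennreal (1 / a ^ CARD('d) * (kappa CARD('d) p * I powr p))"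
    using a kappa_ge_1[OF p, of "CARD('d)"] by (intro ennreal_mult[symmetric]) auto
  also have "1 / a ^ CARD('d) * (kappa CARD('d) p * I powr p) =
    (kappa CARD('d) p powr (1 / p) * a powr (- real CARD('d) / p) * I) powr p"
  proof -
    have "(a powr (- real CARD('d) / p)) powr p = 1 / a ^ CARD('d)"
    proof -
      have "(a powr (- real CARD('d) / p)) powr p = a powr (- real CARD('d))"
        using p by (simp only: powr_powr) simp
      then show ?thesis
        using a by (simp add: powr_minus_divide powr_realpow)
    qed
    moreover have "(kappa CARD('d) p powr (1 / p)) powr p = kappa CARD('d) p"
      using p kappa_ge_1[OF p, of "CARD('d)"] by (simp add: powr_powr)
    ultimately show ?thesis
      using I0 by (simp add: powr_mult)
  qed
  finally show "(\<integral>\<^sup>+s. ennreal (norm (test_fun n a K x s) powr p) \<partial>lebesgue) \<le>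
    ennreal ((kappa CARD('d) p powr (1 / p) * a powr (- real CARD('d) / p) * Lp_norm torus p ?P) powr p)"
    by (simp add: I_def)
  show "0 \<le> kappa CARD('d) p powr (1 / p) * a powr (- real CARD('d) / p) * Lp_norm torus p ?P"
    by (simp add: Lp_norm_nonneg)
qed (use p in auto)

section \<open>Transference\<close>

definition diffs :: "nat \<Rightarrow> (int^'d) set" where
  "diffs N = (\<lambda>(j, l). j - l) ` (freqs N \<times> freqs N)"

text \<open>The Fourier coefficients of \<open>fejer N\<close>: products of
  \<open>1 - |\<kappa> $ i| / N\<close>, each factor clipped at 0 by truncated subtraction.\<close>

definition fejer_coeff :: "nat \<Rightarrow> int^'d \<Rightarrow> real" where
  "fejer_coeff N \<kappa> = real (\<Prod>i\<in>UNIV. N - nat \<bar>\<kappa> $ i\<bar>) / real N ^ CARD('d)"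

lemma finite_diffs [simp]: "finite (diffs N)"
  by (simp add: diffs_def)

lemma fejer_mean_eq:
  fixes z :: "int^'d \<Rightarrow> 'b::real_normed_vector"
  shows "(\<Sum>j\<in>freqs N. \<Sum>l\<in>freqs N. z (j - l)) /\<^sub>R real N ^ CARD('d) = (\<Sum>\<kappa>\<in>diffs N. fejer_coeff N \<kappa> *\<^sub>R z \<kappa>)"
proof -
  \<comment> \<open>Cutting \<open>z\<close> off outside \<open>diffs N\<close> provides the finite
    support that \<open>sum_freqs_diff\<close> asks for without changing any term of the double
    sum.\<close>
  define z' where "z' \<kappa> = (if \<kappa> \<in> diffs N then z \<kappa> else 0)" for \<kappa>
  have "(\<Sum>j\<in>freqs N. \<Sum>l\<in>freqs N. z (j - l)) = (\<Sum>j\<in>freqs N. \<Sum>l\<in>freqs N. z' (j - l))"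
    by (intro sum.cong refl) (auto simp: z'_def diffs_def)
  also have "\<dots> = (\<Sum>k\<in>diffs N. real (\<Prod>i\<in>UNIV. N - nat \<bar>k $ i\<bar>) *\<^sub>R z' k)"
    by (rule sum_freqs_diff) (auto simp: z'_def)
  also have "\<dots> = (\<Sum>k\<in>diffs N. real (\<Prod>i\<in>UNIV. N - nat \<bar>k $ i\<bar>) *\<^sub>R z k)"
    by (intro sum.cong refl) (simp add: z'_def)
  finally show ?thesis
    by (simp only: scaleR_sum_right scaleR_scaleR fejer_coeff_def divide_inverse_commute)
qed

lemma fejer_eq_sum: "complex_of_real (fejer N t) = (\<Sum>\<kappa>\<in>diffs N. complex_of_real (fejer_coeff N \<kappa>) * chr \<kappa> t)"
proof -
  have "complex_of_real (fejer N t) = (\<Sum>j\<in>freqs N. \<Sum>l\<in>freqs N. chr (j - l) t) /\<^sub>R real N ^ CARD('a)"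
    unfolding fejer_expand by (simp only: scaleR_conv_of_real divide_inverse_commute of_real_inverse)
  also have "\<dots> = (\<Sum>\<kappa>\<in>diffs N. fejer_coeff N \<kappa> *\<^sub>R chr \<kappa> t)"
    by (rule fejer_mean_eq)
  finally show ?thesis
    by (simp only: scaleR_conv_of_real)
qed

text \<open>Expanding the kernel centred at \<open>t\<close> into characters makes the product with
  the box kernel a \<open>test_fun\<close>. It is therefore a Schwartz function with an explicit
  inverse transform, and \<open>t\<close> enters only through the coefficients.\<close>

definition fejer_test :: "nat \<Rightarrow> real \<Rightarrow> nat \<Rightarrow> real^'d \<Rightarrow> real^'d \<Rightarrow> complex" where
  "fejer_test n a N t = test_fun n (- a) (diffs N) (\<lambda>\<kappa>. complex_of_real (fejer_coeff N \<kappa>) * chr \<kappa> t)"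

lemma fejer_test_eq: "fejer_test n a N t s = box_kernel_vec n (- (a *\<^sub>R s)) * complex_of_real (fejer N (t - a *\<^sub>R s))"
proof -
  have "trig_poly (diffs N) (\<lambda>\<kappa>. complex_of_real (fejer_coeff N \<kappa>) * chr \<kappa> t) (- (a *\<^sub>R s)) = complex_of_real (fejer N (t + - (a *\<^sub>R s)))"
    unfolding fejer_eq_sum trig_poly_chr by (simp only: scaleC_complex_def chr_add_arg mult_ac)
  then show ?thesis
    by (simp add: fejer_test_def test_fun_def scaleC_complex_def)
qed

text \<open>The terms with \<open>k \<noteq> \<kappa>\<close> are present because smoothed cells
  overlap; they vanish as \<open>n\<close> grows.\<close>

definition approx_coeff :: "nat \<Rightarrow> real \<Rightarrow> (real^'d \<Rightarrow> ('x::complex_banach, 'y::complex_banach) blinfun) \<Rightarrow>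
    (int^'d) set \<Rightarrow> (int^'d \<Rightarrow> 'x) \<Rightarrow> int^'d \<Rightarrow> 'y" where
  "approx_coeff n a m K x \<kappa> = (\<Sum>k\<in>K. (1 / a ^ CARD('d)) *\<^sub>R
     Bochner_integral lebesgue (\<lambda>\<xi>. symbol_product n a \<kappa> k \<xi> *\<^sub>R blinfun_apply (m \<xi>) (x k)))"

text \<open>Each of the two transforms carries a factor \<open>1 / a ^ CARD('d)\<close>. Multiplying
  by one such power leaves the normalisation of a cell average.\<close>

lemma T_mult_fejer_test:
  fixes m :: "real^'d \<Rightarrow> ('x::complex_banach, 'y::complex_banach) blinfun"
  assumes a: "0 < a" and m: "moderate_growth m"
  shows "a ^ CARD('d) *\<^sub>R T_mult m (test_fun n a K x) (fejer_test n a N t) =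
    (\<Sum>\<kappa>\<in>diffs N. (complex_of_real (fejer_coeff N \<kappa>) * chr \<kappa> t) *\<^sub>C approx_coeff n a m K x \<kappa>)"
proof -
  define c where "c \<kappa> = complex_of_real (fejer_coeff N \<kappa>) * chr \<kappa> t" for \<kappa>
  define I where "I \<kappa> k = Bochner_integral lebesgue (\<lambda>\<xi>. symbol_product n a \<kappa> k \<xi> *\<^sub>R blinfun_apply (m \<xi>) (x k))" for \<kappa> k
  define D where "D = a ^ CARD('d)"
  have D: "0 < D" using a by (simp add: D_def)
  have sm: "strongly_measurable lebesgue (\<lambda>\<xi>. blinfun_apply (m \<xi>) v)" for v
    using m unfolding moderate_growth_def by auto
  have hI: "has_Bochner_integral lebesgue (\<lambda>\<xi>. symbol_product n a \<kappa> k \<xi> *\<^sub>R blinfun_apply (m \<xi>) (x k)) (I \<kappa> k)" for \<kappa> k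
  proof -
    obtain w where w: "integrable lebesgue w" "\<And>n \<xi>. norm (symbol_product n a \<kappa> k \<xi> *\<^sub>R blinfun_apply (m \<xi>) (x k)) \<le> w \<xi>"
      using symbol_product_dominated[OF a m, of \<kappa> k "x k"] by auto
    have "(\<integral>\<^sup>+\<xi>. ennreal (norm (symbol_product n a \<kappa> k \<xi> *\<^sub>R blinfun_apply (m \<xi>) (x k))) \<partial>lebesgue) \<le> (\<integral>\<^sup>+\<xi>. ennreal (norm (w \<xi>)) \<partial>lebesgue)"
      using w(2) by (intro nn_integral_mono ennreal_leI) (metis abs_ge_self order_trans real_norm_def)
    also have "\<dots> < \<infinity>"
      using w(1) by (simp add: integrable_iff_bounded)
    finally show ?thesis
      unfolding I_def by (intro completion.has_Bochner_integral_ex strongly_measurable_symbol_product sm)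
  qed
  have eq: "inv_fourier (fejer_test n a N t) \<xi> *\<^sub>C blinfun_apply (m \<xi>) (fourier (test_fun n a K x) \<xi>) =
    (\<Sum>\<kappa>\<in>diffs N. \<Sum>k\<in>K. c \<kappa> *\<^sub>C ((1 / (D * D)) *\<^sub>R (symbol_product n a \<kappa> k \<xi> *\<^sub>R blinfun_apply (m \<xi>) (x k))))" for \<xi>
  proof -
    have a0: "a \<noteq> 0" using a by simp
    have "inv_fourier (fejer_test n a N t) \<xi> = (\<Sum>\<kappa>\<in>diffs N. (box_symbol_vec n (\<xi> /\<^sub>R a - int_vec \<kappa>) / D) *\<^sub>R c \<kappa>)"
      unfolding fejer_test_def inv_fourier_test_fun[OF a0] using a by (simp add: D_def c_def)
    moreover have "blinfun_apply (m \<xi>) (fourier (test_fun n a K x) \<xi>) =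
      (\<Sum>k\<in>K. (box_symbol_vec n (\<xi> /\<^sub>R a - int_vec k) / D) *\<^sub>R blinfun_apply (m \<xi>) (x k))"
      unfolding fourier_test_fun[OF a0] using a by (simp add: D_def blinfun.sum_right blinfun.scaleR_right)
    ultimately have "inv_fourier (fejer_test n a N t) \<xi> *\<^sub>C blinfun_apply (m \<xi>) (fourier (test_fun n a K x) \<xi>) =
      (\<Sum>\<kappa>\<in>diffs N. \<Sum>k\<in>K. ((box_symbol_vec n (\<xi> /\<^sub>R a - int_vec \<kappa>) / D) *\<^sub>R c \<kappa>) *\<^sub>C
        ((box_symbol_vec n (\<xi> /\<^sub>R a - int_vec k) / D) *\<^sub>R blinfun_apply (m \<xi>) (x k)))"
      by (simp only: scaleC.sum_left scaleC.sum_right) (rule sum.swap)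
    also have "\<dots> = (\<Sum>\<kappa>\<in>diffs N. \<Sum>k\<in>K. c \<kappa> *\<^sub>C ((1 / (D * D)) *\<^sub>R (symbol_product n a \<kappa> k \<xi> *\<^sub>R blinfun_apply (m \<xi>) (x k))))"
      by (intro sum.cong refl) (simp add: scaleC.scaleR_left scaleC.scaleR_right symbol_product_def)
    finally show ?thesis .
  qed
  have "has_Bochner_integral lebesgue
      (\<lambda>\<xi>. \<Sum>\<kappa>\<in>diffs N. \<Sum>k\<in>K. c \<kappa> *\<^sub>C ((1 / (D * D)) *\<^sub>R (symbol_product n a \<kappa> k \<xi> *\<^sub>R blinfun_apply (m \<xi>) (x k))))
      (\<Sum>\<kappa>\<in>diffs N. \<Sum>k\<in>K. c \<kappa> *\<^sub>C ((1 / (D * D)) *\<^sub>R I \<kappa> k))"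
    by (intro completion.has_Bochner_integral_sum
        completion.has_Bochner_integral_bounded_linear[OF scaleC.bounded_linear_right]
        completion.has_Bochner_integral_bounded_linear[OF bounded_linear_scaleR_right] hI)
  then have "T_mult m (test_fun n a K x) (fejer_test n a N t) = (\<Sum>\<kappa>\<in>diffs N. \<Sum>k\<in>K. c \<kappa> *\<^sub>C ((1 / (D * D)) *\<^sub>R I \<kappa> k))"
    unfolding T_mult_def inv_fourier_distr_def distr_of_fun_def eq
    by (rule completion.Bochner_integral_eqI)
  then have "D *\<^sub>R T_mult m (test_fun n a K x) (fejer_test n a N t) = (\<Sum>\<kappa>\<in>diffs N. \<Sum>k\<in>K. c \<kappa> *\<^sub>C ((1 / D) *\<^sub>R I \<kappa> k))"
    using D by (simp add: scaleR_sum_right scaleC.scaleR_right)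
  then show ?thesis
    by (simp add: D_def c_def I_def approx_coeff_def scaleC.sum_right)
qed

lemma approx_coeff_tendsto:
  fixes m :: "real^'d \<Rightarrow> ('x::complex_banach, 'y::complex_banach) blinfun"
  assumes a: "0 < a" and m: "moderate_growth m" and loc: "\<And>x. (\<lambda>\<xi>. blinfun_apply (m \<xi>) x) \<in> L1_loc"
    and K: "finite K"
  shows "(\<lambda>n. approx_coeff n a m K x \<kappa>) \<longlonglongrightarrow> (if \<kappa> \<in> K then cube_average a m \<kappa> (x \<kappa>) else 0)"
proof -
  have "(\<lambda>n. approx_coeff n a m K x \<kappa>) \<longlonglongrightarrow> (\<Sum>k\<in>K. (1 / a ^ CARD('d)) *\<^sub>R (if \<kappa> = k then a ^ CARD('d) *\<^sub>R cube_average a m k (x k) else 0))"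
    unfolding approx_coeff_def by (intro tendsto_sum tendsto_scaleR tendsto_const symbol_product_integral_tendsto a m loc)
  also have "(\<Sum>k\<in>K. (1 / a ^ CARD('d)) *\<^sub>R (if \<kappa> = k then a ^ CARD('d) *\<^sub>R cube_average a m k (x k) else 0)) =
    (\<Sum>k\<in>K. if \<kappa> = k then cube_average a m k (x k) else 0)"
    using a by (intro sum.cong refl) auto
  also have "\<dots> = (if \<kappa> \<in> K then cube_average a m \<kappa> (x \<kappa>) else 0)"
    using K by simp
  finally show ?thesis .
qed

text \<open>The vector inside the norm is the scaled pairing of the output \<open>g\<close> with
  \<open>fejer_test\<close>, so its norm is dominated by a convolution integral to which
  \<open>fejer_convolution_bound\<close> applies. The substitution \<open>u = a s\<close> uses up
  the scaling of the pairing; undoing it in the norm of \<open>g\<close> produces the factor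
  \<open>a ^ CARD('d)\<close>.\<close>

lemma transference_approx:
  fixes m :: "real^'d \<Rightarrow> ('x::complex_banach, 'y::complex_banach) blinfun"
  assumes p: "1 < p" and q: "1 < q" "1 < q'" "1 / q + 1 / q' = 1"
    and m: "moderate_growth m" and a: "0 < a" and C: "T_mult_bound p q m C" and K: "finite K" and N: "0 < N"
  shows "(\<integral>\<^sup>+t. ennreal (norm (\<Sum>\<kappa>\<in>diffs N. (complex_of_real (fejer_coeff N \<kappa>) * chr \<kappa> t) *\<^sub>C approx_coeff n a m K x \<kappa>) powr q) \<partial>torus)
    \<le> ennreal (kappa CARD('d) q' powr (q / q') * (a ^ CARD('d) * (C * Lp_norm lebesgue p (test_fun n a K x)) powr q))"
proof -
  let ?f = "test_fun n a K x"
  have "?f \<in> schwartz"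
    using a by (intro test_fun_schwartz K) auto
  then obtain g where g: "g \<in> Lp lebesgue q" "\<And>\<phi>. \<phi> \<in> schwartz \<Longrightarrow> T_mult m ?f \<phi> = distr_of_fun g \<phi>"
    "Lp_norm lebesgue q g \<le> C * Lp_norm lebesgue p ?f"
    using C unfolding T_mult_bound_def by blast
  have gs: "strongly_measurable lebesgue g" and gi: "integrable lebesgue (\<lambda>s. norm (g s) powr q)"
    using g(1) by (auto simp: Lp_def)
  \<comment> \<open>The norm of \<open>g\<close> is measurable for the completed measure only.
    Tonelli's theorem on \<open>lborel\<close> needs a Borel version, and the absolute value in
    \<open>G\<close> makes it nonnegative everywhere.\<close>
  obtain G0 where G0: "G0 \<in> borel_measurable lborel" "AE s in lborel. norm (g s) = G0 s"
    using completion_ex_borel_measurable_real[OF completion.borel_measurable_norm_strongly_measurable[OF gs]] by auto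
  define G where "G s = \<bar>G0 s\<bar>" for s
  have [measurable]: "G \<in> borel_measurable borel"
    using G0(1) unfolding G_def[abs_def] by simp
  have G: "AE s in lborel. norm (g s) = G s"
    using G0(2) by eventually_elim (metis G_def abs_norm_cancel)
  define V where "V t = norm (a ^ CARD('d) *\<^sub>R T_mult m ?f (fejer_test n a N t))" for t
  have V: "ennreal (V t) \<le> (\<integral>\<^sup>+u. ennreal (decay_vec u * fejer N (t - u) * G (u /\<^sub>R a)) \<partial>lborel)" for t
  proof -
    let ?\<phi> = "fejer_test n a N t"
    have "?\<phi> \<in> schwartz"
      unfolding fejer_test_def using a by (intro test_fun_schwartz) auto
    then have T: "T_mult m ?f ?\<phi> = Bochner_integral lebesgue (\<lambda>s. ?\<phi> s *\<^sub>C g s)"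
      by (simp add: g(2) distr_of_fun_def)
    have "continuous_on UNIV ?\<phi>"
      unfolding fejer_test_eq[abs_def]
      by (intro continuous_intros continuous_on_compose2[OF continuous_fejer]) auto
    then have "?\<phi> \<in> borel_measurable borel"
      by (rule borel_measurable_continuous_onI)
    then have sm: "strongly_measurable lebesgue (\<lambda>s. ?\<phi> s *\<^sub>C g s)"
      by (intro strongly_measurable_scaleC borel_imp_strongly_measurable borel_lebesgue gs)
    have "ennreal (norm (T_mult m ?f ?\<phi>)) \<le> (\<integral>\<^sup>+s. ennreal (norm (?\<phi> s *\<^sub>C g s)) \<partial>lborel)"
      unfolding T using completion.norm_Bochner_integral_le[OF sm] by (simp add: nn_integral_completion)
    also have "\<dots> \<le> (\<integral>\<^sup>+s. ennreal (decay_vec (a *\<^sub>R s) * fejer N (t - a *\<^sub>R s) * G ((a *\<^sub>R s) /\<^sub>R a)) \<partial>lborel)"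
      using G
    proof (intro nn_integral_mono_AE, eventually_elim)
      case (elim s)
      have "norm (?\<phi> s *\<^sub>C g s) = norm (box_kernel_vec n (- (a *\<^sub>R s))) * fejer N (t - a *\<^sub>R s) * norm (g s)"
        by (simp add: norm_scaleC fejer_test_eq norm_mult fejer_nonneg)
      also have "\<dots> \<le> decay_vec (a *\<^sub>R s) * fejer N (t - a *\<^sub>R s) * norm (g s)"
        using norm_box_kernel_vec_le[of n "- (a *\<^sub>R s)"]
        by (intro mult_right_mono) (auto simp: decay_vec_uminus fejer_nonneg)
      finally show ?case
        using elim a by (intro ennreal_leI) simp
    qed
    finally have le: "ennreal (norm (T_mult m ?f ?\<phi>)) \<le> \<dots>" .
    have "ennreal (V t) = ennreal (a ^ CARD('d)) * ennreal (norm (T_mult m ?f ?\<phi>))"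
      using a by (simp add: V_def ennreal_mult)
    also have "\<dots> \<le> ennreal (a ^ CARD('d)) * (\<integral>\<^sup>+s. ennreal (decay_vec (a *\<^sub>R s) * fejer N (t - a *\<^sub>R s) * G ((a *\<^sub>R s) /\<^sub>R a)) \<partial>lborel)"
      by (intro mult_left_mono le) auto
    also have "\<dots> = (\<integral>\<^sup>+u. ennreal (decay_vec u * fejer N (t - u) * G (u /\<^sub>R a)) \<partial>lborel)"
      using a by (intro nn_integral_lborel_scale[symmetric, where f="\<lambda>u. ennreal (decay_vec u * fejer N (t - u) * G (u /\<^sub>R a))"]) measurable
    finally show ?thesis .
  qed
  have "(\<integral>\<^sup>+t. ennreal (V t powr q) \<partial>torus) \<le>
    ennreal (((4 * (q' / (q' - 1))) ^ CARD('d)) powr (q / q')) * (\<integral>\<^sup>+u. ennreal (G (u /\<^sub>R a) powr q) \<partial>lborel)"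
  proof (rule fejer_convolution_bound[OF q(1,2) _ N _ _ _ V])
    show "1 / q' + 1 / q = 1" using q(3) by simp
    show "(\<lambda>u. G (u /\<^sub>R a)) \<in> borel_measurable borel" by measurable
  qed (auto simp: V_def G_def)
  also have "(\<integral>\<^sup>+u. ennreal (G (u /\<^sub>R a) powr q) \<partial>lborel) = ennreal (a ^ CARD('d)) * (\<integral>\<^sup>+s. ennreal (G s powr q) \<partial>lborel)"
    using a by (subst nn_integral_lborel_scale[where a=a]) auto
  also have "(\<integral>\<^sup>+s. ennreal (G s powr q) \<partial>lborel) = (\<integral>\<^sup>+s. ennreal (norm (g s) powr q) \<partial>lborel)"
    using G by (intro nn_integral_cong_AE, eventually_elim) simp
  also have "\<dots> = ennreal (Lp_norm lebesgue q g powr q)"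
    using nn_integral_eq_Lp_norm_powr[OF gi] q by (simp add: nn_integral_completion)
  also have "\<dots> \<le> ennreal ((C * Lp_norm lebesgue p ?f) powr q)"
    using g(3) q by (intro ennreal_leI powr_mono2) (auto simp: Lp_norm_nonneg)
  finally have "(\<integral>\<^sup>+t. ennreal (V t powr q) \<partial>torus) \<le>
    ennreal (kappa CARD('d) q' powr (q / q')) * (ennreal (a ^ CARD('d)) * ennreal ((C * Lp_norm lebesgue p ?f) powr q))"
    unfolding kappa_def by (simp add: mult_left_mono)
  also have "\<dots> = ennreal (kappa CARD('d) q' powr (q / q') * (a ^ CARD('d) * (C * Lp_norm lebesgue p ?f) powr q))"
    using a by (simp flip: ennreal_mult)
  finally show ?thesis
    unfolding V_def T_mult_fejer_test[OF a m] .
qed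

text \<open>For fixed \<open>N\<close> there are finitely many frequencies and their coefficients
  converge as \<open>n\<close> grows, so Fatou's lemma carries the bound to the Fejer mean; a second
  use, as \<open>N\<close> grows, reaches the polynomial. The bound \<open>B\<close> depends on
  neither index.\<close>

lemma transference:
  fixes m :: "real^'d \<Rightarrow> ('x::complex_banach, 'y::complex_banach) blinfun"
  assumes p: "1 < p" and q: "1 < q" "1 < q'" "1 / q + 1 / q' = 1"
    and m: "moderate_growth m" and loc: "\<And>x. (\<lambda>\<xi>. blinfun_apply (m \<xi>) x) \<in> L1_loc"
    and a: "0 < a" and C: "T_mult_bound p q m C" and K: "finite K"
  shows "Lp_norm torus q (trig_poly K (\<lambda>k. cube_average a m k (x k))) \<le>
    kappa CARD('d) q' powr (1 / q') * kappa CARD('d) p powr (1 / p) * a powr (real CARD('d) / q - real CARD('d) / p) * C *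
      Lp_norm torus p (trig_poly K x)"
proof -
  define v where "v \<kappa> = (if \<kappa> \<in> K then cube_average a m \<kappa> (x \<kappa>) else 0)" for \<kappa>
  define B where "B = kappa CARD('d) q' powr (1 / q') * kappa CARD('d) p powr (1 / p) * a powr (real CARD('d) / q - real CARD('d) / p) * C *
      Lp_norm torus p (trig_poly K x)"
  have C0: "0 \<le> C" using C by (simp add: T_mult_bound_def)
  have B0: "0 \<le> B" by (simp add: B_def C0 Lp_norm_nonneg)
  have bnd: "kappa CARD('d) q' powr (q / q') * (a ^ CARD('d) * (C * Lp_norm lebesgue p (test_fun n a K x)) powr q) \<le> B powr q" for n
  proof -
    define D where "D = C * (kappa CARD('d) p powr (1 / p) * a powr (- real CARD('d) / p) * Lp_norm torus p (trig_poly K x))"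
    have D0: "0 \<le> D" by (simp add: D_def C0 Lp_norm_nonneg)
    have "(C * Lp_norm lebesgue p (test_fun n a K x)) powr q \<le> D powr q"
      unfolding D_def using q C0 by (intro powr_mono2 mult_left_mono Lp_norm_test_fun p a) (auto simp: Lp_norm_nonneg)
    then have "kappa CARD('d) q' powr (q / q') * (a ^ CARD('d) * (C * Lp_norm lebesgue p (test_fun n a K x)) powr q) \<le>
      kappa CARD('d) q' powr (q / q') * (a ^ CARD('d) * D powr q)"
      using a by (intro mult_left_mono) auto
    also have "\<dots> = (kappa CARD('d) q' powr (1 / q') * (a powr (real CARD('d) / q) * D)) powr q"
      using q a D0 by (simp add: powr_mult powr_powr powr_realpow)
    also have "kappa CARD('d) q' powr (1 / q') * (a powr (real CARD('d) / q) * D) = B"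
      using a by (simp add: B_def D_def powr_diff powr_minus_divide)
    finally show ?thesis .
  qed
  \<comment> \<open>The successor keeps the Fejer order positive, as the unit mass of the kernel
    requires.\<close>
  have stepN: "(\<integral>\<^sup>+t. ennreal (norm (\<Sum>\<kappa>\<in>diffs (Suc N). (complex_of_real (fejer_coeff (Suc N) \<kappa>) * chr \<kappa> t) *\<^sub>C v \<kappa>) powr q) \<partial>torus) \<le> ennreal (B powr q)" for N
  proof (rule nn_integral_liminf_bound)
    fix n
    let ?Q = "\<lambda>t. norm (\<Sum>\<kappa>\<in>diffs (Suc N). (complex_of_real (fejer_coeff (Suc N) \<kappa>) * chr \<kappa> t) *\<^sub>C approx_coeff n a m K x \<kappa>) powr q"
    have "continuous_on UNIV ?Q"
      using q by (intro continuous_on_norm_powr continuous_on_sum scaleC.continuous_on continuous_intros) auto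
    then show "(\<lambda>t. ennreal (?Q t)) \<in> borel_measurable torus"
      by (intro measurable_compose[OF _ measurable_ennreal] borel_torus borel_measurable_continuous_onI)
    show "(\<integral>\<^sup>+t. ennreal (?Q t) \<partial>torus) \<le> ennreal (B powr q)"
      by (rule order_trans[OF transference_approx[OF p q m a C K] ennreal_leI[OF bnd]]) simp
  next
    show "AE t in torus. (\<lambda>n. ennreal (norm (\<Sum>\<kappa>\<in>diffs (Suc N). (complex_of_real (fejer_coeff (Suc N) \<kappa>) * chr \<kappa> t) *\<^sub>C approx_coeff n a m K x \<kappa>) powr q))
      \<longlonglongrightarrow> ennreal (norm (\<Sum>\<kappa>\<in>diffs (Suc N). (complex_of_real (fejer_coeff (Suc N) \<kappa>) * chr \<kappa> t) *\<^sub>C v \<kappa>) powr q)"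
    proof (rule AE_I2)
      fix t
      have "(\<lambda>n. norm (\<Sum>\<kappa>\<in>diffs (Suc N). (complex_of_real (fejer_coeff (Suc N) \<kappa>) * chr \<kappa> t) *\<^sub>C approx_coeff n a m K x \<kappa>))
        \<longlonglongrightarrow> norm (\<Sum>\<kappa>\<in>diffs (Suc N). (complex_of_real (fejer_coeff (Suc N) \<kappa>) * chr \<kappa> t) *\<^sub>C v \<kappa>)"
        unfolding v_def
        by (intro tendsto_norm tendsto_sum scaleC.tendsto tendsto_const approx_coeff_tendsto a m loc K)
      then show "(\<lambda>n. ennreal (norm (\<Sum>\<kappa>\<in>diffs (Suc N). (complex_of_real (fejer_coeff (Suc N) \<kappa>) * chr \<kappa> t) *\<^sub>C approx_coeff n a m K x \<kappa>) powr q))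
        \<longlonglongrightarrow> ennreal (norm (\<Sum>\<kappa>\<in>diffs (Suc N). (complex_of_real (fejer_coeff (Suc N) \<kappa>) * chr \<kappa> t) *\<^sub>C v \<kappa>) powr q)"
        using q by (intro tendsto_ennrealI tendsto_powr') auto
    qed
  qed
  have "(\<integral>\<^sup>+t. ennreal (norm (trig_poly K (\<lambda>k. cube_average a m k (x k)) t) powr q) \<partial>torus) \<le> ennreal (B powr q)"
  proof (rule nn_integral_liminf_bound[OF _ _ stepN])
    fix N
    let ?Q = "\<lambda>t. norm (\<Sum>\<kappa>\<in>diffs (Suc N). (complex_of_real (fejer_coeff (Suc N) \<kappa>) * chr \<kappa> t) *\<^sub>C v \<kappa>) powr q"
    have "continuous_on UNIV ?Q"
      using q by (intro continuous_on_norm_powr continuous_on_sum scaleC.continuous_on continuous_intros) auto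
    then show "(\<lambda>t. ennreal (?Q t)) \<in> borel_measurable torus"
      by (intro measurable_compose[OF _ measurable_ennreal] borel_torus borel_measurable_continuous_onI)
  next
    show "AE t in torus. (\<lambda>N. ennreal (norm (\<Sum>\<kappa>\<in>diffs (Suc N). (complex_of_real (fejer_coeff (Suc N) \<kappa>) * chr \<kappa> t) *\<^sub>C v \<kappa>) powr q))
      \<longlonglongrightarrow> ennreal (norm (trig_poly K (\<lambda>k. cube_average a m k (x k)) t) powr q)"
    proof (rule AE_I2)
      fix t
      have "(\<lambda>N. (\<Sum>j\<in>freqs N. \<Sum>l\<in>freqs N. chr (j - l) t *\<^sub>C v (j - l)) /\<^sub>R real N ^ CARD('d)) \<longlonglongrightarrow> (\<Sum>k\<in>K. chr k t *\<^sub>C v k)"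
        by (rule fejer_mean_tendsto[OF K, where z="\<lambda>k. chr k t *\<^sub>C v k"]) (simp add: v_def scaleC.zero_right)
      then have "(\<lambda>N. \<Sum>\<kappa>\<in>diffs N. fejer_coeff N \<kappa> *\<^sub>R (chr \<kappa> t *\<^sub>C v \<kappa>)) \<longlonglongrightarrow> (\<Sum>k\<in>K. chr k t *\<^sub>C v k)"
        unfolding fejer_mean_eq[where z="\<lambda>k. chr k t *\<^sub>C v k"] .
      then have "(\<lambda>N. \<Sum>\<kappa>\<in>diffs (Suc N). (complex_of_real (fejer_coeff (Suc N) \<kappa>) * chr \<kappa> t) *\<^sub>C v \<kappa>) \<longlonglongrightarrow> (\<Sum>k\<in>K. chr k t *\<^sub>C v k)"
        by (intro LIMSEQ_Suc) (simp add: scaleC_of_real flip: scaleC_scaleC)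
      moreover have "(\<Sum>k\<in>K. chr k t *\<^sub>C v k) = trig_poly K (\<lambda>k. cube_average a m k (x k)) t"
        unfolding trig_poly_chr by (intro sum.cong refl) (simp add: v_def)
      ultimately have "(\<lambda>N. norm (\<Sum>\<kappa>\<in>diffs (Suc N). (complex_of_real (fejer_coeff (Suc N) \<kappa>) * chr \<kappa> t) *\<^sub>C v \<kappa>)) \<longlonglongrightarrow>
          norm (trig_poly K (\<lambda>k. cube_average a m k (x k)) t)"
        by (intro tendsto_norm) simp
      then show "(\<lambda>N. ennreal (norm (\<Sum>\<kappa>\<in>diffs (Suc N). (complex_of_real (fejer_coeff (Suc N) \<kappa>) * chr \<kappa> t) *\<^sub>C v \<kappa>) powr q))
        \<longlonglongrightarrow> ennreal (norm (trig_poly K (\<lambda>k. cube_average a m k (x k)) t) powr q)"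
        using q by (intro tendsto_ennrealI tendsto_powr') auto
    qed
  qed
  then show ?thesis
    unfolding B_def[symmetric] using q B0 by (intro Lp_norm_leI) auto
qed

section \<open>Density of trigonometric polynomials\<close>

definition trigs :: "(real^'d \<Rightarrow> 'b::complex_banach) set" where
  "trigs = {f. \<exists>K y. finite K \<and> f = trig_poly K y}"

lemma trig_poly_superset:
  assumes "K \<subseteq> L" "finite L" shows "trig_poly K y t = trig_poly L (\<lambda>k. if k \<in> K then y k else 0) t"
proof -
  have "(\<Sum>k\<in>L. chr k t *\<^sub>C (if k \<in> K then y k else 0)) = (\<Sum>k\<in>K. chr k t *\<^sub>C (if k \<in> K then y k else 0))"
    using assms by (intro sum.mono_neutral_right) (auto simp: scaleC.zero_right)
  then show ?thesis
    by (simp add: trig_poly_chr)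
qed

lemma trigs_add:
  assumes "f \<in> trigs" "g \<in> trigs" shows "(\<lambda>t. f t + g t) \<in> trigs"
proof -
  obtain K y where f: "finite K" "f = trig_poly K y" using assms(1) by (auto simp: trigs_def)
  obtain L z where g: "finite L" "g = trig_poly L z" using assms(2) by (auto simp: trigs_def)
  have "f t + g t = trig_poly (K \<union> L) (\<lambda>k. (if k \<in> K then y k else 0) + (if k \<in> L then z k else 0)) t" for t
    using trig_poly_superset[of K "K \<union> L" y t] trig_poly_superset[of L "K \<union> L" z t] f g
    by (simp add: trig_poly_chr scaleC.add_right sum.distrib)
  then show ?thesis
    using f g by (auto simp: trigs_def fun_eq_iff intro!: exI[of _ "K \<union> L"])
qed

lemma trigs_monomial: "(\<lambda>t. chr k t *\<^sub>C c) \<in> trigs"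
  by (auto simp: trigs_def trig_poly_chr fun_eq_iff intro!: exI[of _ "{k}"] exI[of _ "\<lambda>_. c"])

lemma trigs_const: "(\<lambda>t. c) \<in> trigs"
  using trigs_monomial[of 0 c] by simp

lemma trigs_sum: "(\<And>i. i \<in> I \<Longrightarrow> f i \<in> trigs) \<Longrightarrow> (\<lambda>t. \<Sum>i\<in>I. f i t) \<in> trigs"
  by (induction I rule: infinite_finite_induct) (auto intro: trigs_const trigs_add)

lemma trigs_scaleC:
  assumes "u \<in> trigs" "f \<in> trigs" shows "(\<lambda>t. u t *\<^sub>C f t) \<in> trigs"
proof -
  obtain K c where u: "finite K" "u = trig_poly K c" using assms(1) by (auto simp: trigs_def)
  obtain L z where f: "finite L" "f = trig_poly L z" using assms(2) by (auto simp: trigs_def)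
  have "chr k t * chr l t = chr (k + l) t" for k l :: "int^'a" and t
    by (simp add: chr_def int_vec_add inner_add_left distrib_left cis_mult)
  then have "u t *\<^sub>C f t = (\<Sum>k\<in>K. \<Sum>l\<in>L. chr (k + l) t *\<^sub>C (c k *\<^sub>C z l))" for t
    unfolding u f trig_poly_chr scaleC.sum_left scaleC.sum_right
    by (subst sum.swap) (intro sum.cong refl, simp add: scaleC_scaleC scaleC_complex_def mult_ac)
  then have "(\<lambda>t. u t *\<^sub>C f t) = (\<lambda>t. \<Sum>k\<in>K. \<Sum>l\<in>L. chr (k + l) t *\<^sub>C (c k *\<^sub>C z l))"
    by (simp add: fun_eq_iff)
  also have "\<dots> \<in> trigs"
    by (intro trigs_sum trigs_monomial)
  finally show ?thesis .
qed

lemma trigs_mult: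
  fixes u v :: "real^'d \<Rightarrow> complex"
  shows "u \<in> trigs \<Longrightarrow> v \<in> trigs \<Longrightarrow> (\<lambda>t. u t * v t) \<in> trigs"
  using trigs_scaleC[of u v] by (simp add: scaleC_complex_def)

lemma trigs_continuous: "f \<in> trigs \<Longrightarrow> continuous_on UNIV f"
  by (auto simp: trigs_def intro!: continuous_intros)

lemma strongly_measurable_trigs: "f \<in> trigs \<Longrightarrow> strongly_measurable torus f"
  unfolding trigs_def trig_poly_chr[abs_def]
  by (auto intro!: strongly_measurable_sum strongly_measurable_scaleC strongly_measurable_const
      borel_imp_strongly_measurable borel_torus)

lemma trigs_in_Lp:
  assumes "f \<in> trigs" "0 < p" shows "f \<in> Lp torus p"
  using assms unfolding Lp_def
  by (auto intro!: strongly_measurable_trigs integrable_torus_continuous continuous_on_norm_powr trigs_continuous)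

section \<open>Stone-Weierstrass on the torus, realised as a product of unit circles\<close>

definition unit_circles :: "real^'d \<Rightarrow> complex^'d" where
  "unit_circles t = (\<chi> i. cis (2 * pi * t $ i))"

lemma chr_axis: "chr (axis i m) t = cis (2 * pi * (real_of_int m * t $ i))"
proof -
  have "int_vec (axis i m) = axis i (real_of_int m)"
    by (simp add: int_vec_def axis_def vec_eq_iff)
  then show ?thesis
    by (simp add: chr_def inner_axis')
qed

text \<open>Coordinates with the same image differ by an integer, and a nonzero integer difference
  inside \<open>[0,1]\<close> forces the values 0 and 1.\<close>

lemma unit_circles_eq:
  assumes "unit_circles s = unit_circles t" "s \<in> cbox 0 1" "t \<in> cbox 0 1" "s \<noteq> t"
  shows "s \<notin> box 0 1 \<and> t \<notin> box 0 1"
proof -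
  obtain i where i: "s $ i \<noteq> t $ i" using assms(4) by (auto simp: vec_eq_iff)
  have "cis (2 * pi * s $ i) = cis (2 * pi * t $ i)"
    using assms(1) by (simp add: unit_circles_def vec_eq_iff)
  then have "cis (2 * pi * s $ i - 2 * pi * t $ i) = 1"
    by (simp flip: cis_divide)
  then have "cos (2 * pi * (s $ i - t $ i)) = 1"
    by (metis cis.sel(1) one_complex.sel(1) right_diff_distrib)
  then obtain n :: int where "2 * pi * (s $ i - t $ i) = of_int n * 2 * pi"
    using cos_one_2pi_int by (metis mult.assoc)
  then have n: "s $ i - t $ i = real_of_int n" by simp
  have st: "0 \<le> s $ i" "s $ i \<le> 1" "0 \<le> t $ i" "t $ i \<le> 1"
    using assms(2,3) by (auto simp: mem_box_cart)
  have "n \<noteq> 0" using n i by auto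
  then have "1 \<le> \<bar>real_of_int n\<bar>" by linarith
  with n st have "(s $ i = 0 \<or> s $ i = 1) \<and> (t $ i = 0 \<or> t $ i = 1)"
    by linarith
  then have "\<not> (0 < s $ i \<and> s $ i < 1)" "\<not> (0 < t $ i \<and> t $ i < 1)"
    by auto
  then show ?thesis
    unfolding mem_box_cart by (metis one_index zero_index)
qed

text \<open>The real coordinates of \<open>unit_circles t\<close> are cosines and sines, hence
  combinations of \<open>chr (axis i 1) t\<close> and \<open>chr (axis i (-1)) t\<close>;
  polynomials follow because \<open>trigs\<close> is closed under sums and products.\<close>

lemma real_polynomial_unit_circles:
  assumes "real_polynomial_function h"
  shows "(\<lambda>t::real^'d. complex_of_real (h (unit_circles t))) \<in> trigs"
  using assms
proof induction
  case (linear h)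
  interpret h: bounded_linear h by fact
  have "complex_of_real (h (unit_circles t)) = (\<Sum>i\<in>UNIV.
      (chr (axis i 1) t * (1/2) + chr (axis i (-1)) t * (1/2)) * complex_of_real (h (axis i 1))
    + (chr (axis i 1) t * (- \<i>/2) + chr (axis i (-1)) t * (\<i>/2)) * complex_of_real (h (axis i \<i>)))" for t
  proof -
    have "unit_circles t = (\<Sum>i\<in>UNIV. cos (2 * pi * t $ i) *\<^sub>R axis i 1 + sin (2 * pi * t $ i) *\<^sub>R axis i \<i>)"
    proof (rule vec_eq_iff[THEN iffD2], rule allI)
      fix j
      have "(\<Sum>i\<in>UNIV. cos (2 * pi * t $ i) *\<^sub>R axis i 1 + sin (2 * pi * t $ i) *\<^sub>R axis i \<i>) $ j =
        (\<Sum>i\<in>UNIV. if i = j then cos (2 * pi * t $ i) *\<^sub>R 1 + sin (2 * pi * t $ i) *\<^sub>R \<i> else 0)"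
        unfolding sum_component by (intro sum.cong refl) (auto simp: axis_def)
      also have "\<dots> = cis (2 * pi * t $ j)"
        by (simp add: complex_eq_iff)
      finally show "unit_circles t $ j = (\<Sum>i\<in>UNIV. cos (2 * pi * t $ i) *\<^sub>R axis i 1 + sin (2 * pi * t $ i) *\<^sub>R axis i \<i>) $ j"
        by (simp add: unit_circles_def)
    qed
    then have "h (unit_circles t) = (\<Sum>i\<in>UNIV. cos (2 * pi * t $ i) * h (axis i 1) + sin (2 * pi * t $ i) * h (axis i \<i>))"
      by (simp add: h.sum h.add h.scaleR)
    moreover have "complex_of_real (cos (2 * pi * t $ i)) = chr (axis i 1) t * (1/2) + chr (axis i (-1)) t * (1/2)"
      "complex_of_real (sin (2 * pi * t $ i)) = chr (axis i 1) t * (- \<i>/2) + chr (axis i (-1)) t * (\<i>/2)" for i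
      by (simp_all add: chr_axis complex_eq_iff)
    ultimately show ?thesis
      by simp
  qed
  moreover have "chr k \<in> trigs" for k :: "int^'d"
    using trigs_monomial[of k "1::complex"] by (simp add: scaleC_complex_def)
  ultimately show ?case
    by (simp only:) (intro trigs_sum trigs_add trigs_mult trigs_const)
next
  case (const c)
  show ?case by (rule trigs_const)
next
  case (add f g)
  then show ?case using trigs_add[OF add.IH] by simp
next
  case (mult f g)
  then show ?case using trigs_mult[OF mult.IH] by simp
qed

text \<open>Zero boundary values make \<open>G\<close> constant on the fibres of
  \<open>unit_circles\<close>, so it descends to \<open>H\<close> on the compact image. Continuity
  of \<open>H\<close> holds because closed subsets of the cube have closed images. A polynomial
  approximation of \<open>H\<close> then pulls back.\<close>

lemma uniform_approx_trigs:
  fixes G :: "real^'d \<Rightarrow> real"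
  assumes G: "continuous_on (cbox 0 1) G" and G0: "\<And>t. t \<in> cbox 0 1 - box 0 1 \<Longrightarrow> G t = 0" and e: "0 < e"
  shows "\<exists>P\<in>trigs. \<forall>t\<in>cbox 0 1. norm (complex_of_real (G t) - P t) < e"
proof -
  define Q where "Q = cbox (0::real^'d) 1"
  define \<Gamma> where "\<Gamma> = unit_circles ` Q"
  have cE: "continuous_on S unit_circles" for S :: "(real^'d) set"
    unfolding unit_circles_def by (intro continuous_intros)
  have comp: "compact \<Gamma>"
    unfolding \<Gamma>_def by (intro compact_continuous_image cE) (simp add: Q_def)
  have wd: "G s = G t" if "s \<in> Q" "t \<in> Q" "unit_circles s = unit_circles t" for s t
    using unit_circles_eq[of s t] G0[of s] G0[of t] that by (cases "s = t") (auto simp: Q_def)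
  define H where "H y = G (SOME t. t \<in> Q \<and> unit_circles t = y)" for y
  have H: "H (unit_circles t) = G t" if "t \<in> Q" for t
  proof -
    have "(SOME s. s \<in> Q \<and> unit_circles s = unit_circles t) \<in> Q \<and> unit_circles (SOME s. s \<in> Q \<and> unit_circles s = unit_circles t) = unit_circles t"
      by (rule someI[of "\<lambda>s. s \<in> Q \<and> unit_circles s = unit_circles t" t]) (use that in simp)
    with that show ?thesis
      unfolding H_def by (intro wd) auto
  qed
  have "continuous_on \<Gamma> H"
  proof (subst continuous_on_closed_vimage[OF compact_imp_closed[OF comp]], intro allI impI)
    fix B :: "real set" assume B: "closed B"
    have eq: "H -` B \<inter> \<Gamma> = unit_circles ` (G -` B \<inter> Q)"
      using H by (auto simp: \<Gamma>_def)
    have "closed (G -` B \<inter> Q)"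
      using G B continuous_on_closed_vimage[of Q G] by (auto simp: Q_def)
    then have "compact (G -` B \<inter> Q)"
      by (metis Q_def compact_cbox closed_Int_compact inf.assoc inf.idem)
    then show "closed (H -` B \<inter> \<Gamma>)"
      unfolding eq by (intro compact_imp_closed compact_continuous_image cE)
  qed
  then obtain h where h: "polynomial_function h" "\<forall>y\<in>\<Gamma>. norm (H y - h y) < e"
    using Stone_Weierstrass_polynomial_function[OF comp _ e, of H] by auto
  have hr: "real_polynomial_function h"
    using h(1) by (simp add: real_polynomial_function_eq)
  show ?thesis
  proof (rule bexI[OF _ real_polynomial_unit_circles[OF hr]], rule ballI)
    fix t assume "t \<in> cbox (0::real^'d) 1"
    then have t: "t \<in> Q" by (simp add: Q_def)
    then have "norm (H (unit_circles t) - h (unit_circles t)) < e"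
      using h(2) by (auto simp: \<Gamma>_def)
    then show "norm (complex_of_real (G t) - complex_of_real (h (unit_circles t))) < e"
      using H[OF t] by (metis norm_of_real of_real_diff real_norm_def)
  qed
qed

section \<open>Approximation measured by the p-th power of the norm\<close>

lemma powr_add_le:
  fixes x y :: real
  assumes "0 \<le> x" "0 \<le> y" "0 < p" shows "(x + y) powr p \<le> 2 powr p * (x powr p + y powr p)"
proof -
  have "(x + y) powr p \<le> (2 * max x y) powr p"
    using assms by (intro powr_mono2) auto
  also have "\<dots> = 2 powr p * max x y powr p"
    using assms by (simp add: powr_mult)
  also have "\<dots> \<le> 2 powr p * (x powr p + y powr p)"
    by (intro mult_left_mono) (auto simp: max_def)
  finally show ?thesis .
qed

text \<open>An extended-valued p-th power needs no integrability, and its triangle inequality with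
  constant \<open>2 powr p\<close> is enough for all limits below.\<close>

definition Np :: "real \<Rightarrow> (real^'d \<Rightarrow> 'b::real_normed_vector) \<Rightarrow> ennreal" where
  "Np p f = (\<integral>\<^sup>+t. ennreal (norm (f t) powr p) \<partial>torus)"

lemma norm_powr_measurable:
  "strongly_measurable torus f \<Longrightarrow> (\<lambda>t. ennreal (norm (f t) powr p)) \<in> borel_measurable torus"
  using torus.borel_measurable_norm_strongly_measurable[of f] by measurable

lemma Np_add_le:
  fixes f g :: "real^'d \<Rightarrow> 'b::real_normed_vector"
  assumes "strongly_measurable torus f" "strongly_measurable torus g" "0 < p"
  shows "Np p (\<lambda>t. f t + g t) \<le> ennreal (2 powr p) * (Np p f + Np p g)"
proof -
  have "Np p (\<lambda>t. f t + g t) \<le> (\<integral>\<^sup>+t. ennreal (2 powr p) * (ennreal (norm (f t) powr p) + ennreal (norm (g t) powr p)) \<partial>torus)"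
    unfolding Np_def
  proof (rule nn_integral_mono)
    fix t
    have "norm (f t + g t) powr p \<le> (norm (f t) + norm (g t)) powr p"
      using assms(3) by (intro powr_mono2 norm_triangle_ineq) auto
    also have "\<dots> \<le> 2 powr p * (norm (f t) powr p + norm (g t) powr p)"
      using assms(3) by (intro powr_add_le) auto
    finally show "ennreal (norm (f t + g t) powr p) \<le> ennreal (2 powr p) * (ennreal (norm (f t) powr p) + ennreal (norm (g t) powr p))"
      by (simp add: ennreal_leI flip: ennreal_mult ennreal_plus)
  qed
  also have "\<dots> = ennreal (2 powr p) * (Np p f + Np p g)"
    unfolding Np_def using norm_powr_measurable[OF assms(1)] norm_powr_measurable[OF assms(2)]
    by (simp add: nn_integral_cmult nn_integral_add)
  finally show ?thesis .
qed

lemma Np_commute: "Np p (\<lambda>t. f t - g t) = Np p (\<lambda>t. g t - f t)"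
  by (simp add: Np_def norm_minus_commute)

lemma Np_scaleC: "Np p (\<lambda>t. c *\<^sub>C f t) = ennreal (cmod c powr p) * Np p f" if "strongly_measurable torus f"
  unfolding Np_def using norm_powr_measurable[OF that]
  by (simp add: norm_scaleC powr_mult ennreal_mult nn_integral_cmult)

lemma emeasure_torus: "emeasure (torus::(real^'d) measure) (space torus) = 1"
proof -
  have "emeasure (torus::(real^'d) measure) (space torus) = (\<integral>\<^sup>+t. 1 \<partial>(torus::(real^'d) measure))"
    by simp
  also have "\<dots> = emeasure lborel (cbox (0::real^'d) 1)"
    unfolding nn_integral_torus by simp
  also have "\<dots> = ennreal (\<Prod>b\<in>Basis. ((1::real^'d) - 0) \<bullet> b)"
    by (rule emeasure_lborel_cbox) (auto simp: Basis_vec_def inner_axis)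
  also have "(\<Prod>b\<in>Basis. ((1::real^'d) - 0) \<bullet> b) = 1"
    by (intro prod.neutral) (auto simp: Basis_vec_def inner_axis)
  finally show ?thesis by simp
qed

definition approx_trig :: "real \<Rightarrow> (real^'d \<Rightarrow> 'b::complex_banach) \<Rightarrow> bool" where
  "approx_trig p f \<longleftrightarrow> (\<forall>e>0. \<exists>P\<in>trigs. Np p (\<lambda>t. f t - P t) \<le> ennreal e)"

lemma approx_trig_limit:
  fixes f :: "real^'d \<Rightarrow> 'b::complex_banach"
  assumes p: "0 < p" and f: "strongly_measurable torus f"
    and s: "\<And>i. strongly_measurable torus (s i)" "\<And>i. approx_trig p (s i)"
    and lim: "(\<lambda>i. Np p (\<lambda>t. f t - s i t)) \<longlonglongrightarrow> 0"
  shows "approx_trig p f"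
  unfolding approx_trig_def
proof (intro allI impI)
  fix e :: real assume e: "0 < e"
  define d where "d = e / (2 * 2 powr p)"
  have d: "0 < d" using e by (simp add: d_def)
  have "\<forall>\<^sub>F i in sequentially. Np p (\<lambda>t. f t - s i t) < ennreal d"
    by (rule order_tendstoD(2)[OF lim]) (use d in simp)
  then obtain i where i: "Np p (\<lambda>t. f t - s i t) < ennreal d"
    by (auto simp: eventually_sequentially)
  obtain P where P: "P \<in> trigs" "Np p (\<lambda>t. s i t - P t) \<le> ennreal d"
    using s(2)[of i] d unfolding approx_trig_def by auto
  have "Np p (\<lambda>t. f t - P t) = Np p (\<lambda>t. (f t - s i t) + (s i t - P t))"
    by simp
  also have "\<dots> \<le> ennreal (2 powr p) * (Np p (\<lambda>t. f t - s i t) + Np p (\<lambda>t. s i t - P t))"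
    by (intro Np_add_le strongly_measurable_diff f s strongly_measurable_trigs P p)
  also have "\<dots> \<le> ennreal (2 powr p) * (ennreal d + ennreal d)"
    using i P(2) by (intro mult_left_mono add_mono) auto
  also have "\<dots> = ennreal e"
    using d by (simp add: d_def flip: ennreal_plus ennreal_mult)
  finally show "\<exists>P\<in>trigs. Np p (\<lambda>t. f t - P t) \<le> ennreal e"
    using P(1) by blast
qed

lemma approx_trig_add:
  fixes f g :: "real^'d \<Rightarrow> 'b::complex_banach"
  assumes p: "0 < p" and f: "strongly_measurable torus f" "approx_trig p f"
    and g: "strongly_measurable torus g" "approx_trig p g"
  shows "approx_trig p (\<lambda>t. f t + g t)"
  unfolding approx_trig_def
proof (intro allI impI)
  fix e :: real assume e: "0 < e"
  define d where "d = e / (2 * 2 powr p)"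
  have d: "0 < d" using e by (simp add: d_def)
  obtain P where P: "P \<in> trigs" "Np p (\<lambda>t. f t - P t) \<le> ennreal d"
    using f(2) d unfolding approx_trig_def by auto
  obtain R where R: "R \<in> trigs" "Np p (\<lambda>t. g t - R t) \<le> ennreal d"
    using g(2) d unfolding approx_trig_def by auto
  have "Np p (\<lambda>t. f t + g t - (P t + R t)) = Np p (\<lambda>t. (f t - P t) + (g t - R t))"
    by (simp add: algebra_simps)
  also have "\<dots> \<le> ennreal (2 powr p) * (Np p (\<lambda>t. f t - P t) + Np p (\<lambda>t. g t - R t))"
    by (intro Np_add_le strongly_measurable_diff f g strongly_measurable_trigs P R p)
  also have "\<dots> \<le> ennreal (2 powr p) * (ennreal d + ennreal d)"
    using R P by (intro mult_left_mono add_mono) auto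
  also have "\<dots> = ennreal e"
    using d by (simp add: d_def flip: ennreal_plus ennreal_mult)
  finally show "\<exists>P\<in>trigs. Np p (\<lambda>t. f t + g t - P t) \<le> ennreal e"
    by (rule bexI[OF _ trigs_add[OF P(1) R(1)]])
qed

lemma approx_trig_zero: "approx_trig p (\<lambda>t. 0)"
  unfolding approx_trig_def by (auto simp: Np_def intro!: bexI[OF _ trigs_const[of 0]])

lemma approx_trig_sum:
  fixes f :: "'i \<Rightarrow> real^'d \<Rightarrow> 'b::complex_banach"
  assumes "0 < p" "finite I" "\<And>i. i \<in> I \<Longrightarrow> strongly_measurable torus (f i)" "\<And>i. i \<in> I \<Longrightarrow> approx_trig p (f i)"
  shows "approx_trig p (\<lambda>t. \<Sum>i\<in>I. f i t)"
  using assms(2,3,4)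
proof (induction I rule: finite_induct)
  case (insert i I)
  have "approx_trig p (\<lambda>t. f i t + (\<Sum>i\<in>I. f i t))"
    by (rule approx_trig_add[OF assms(1)]) (use insert in \<open>auto intro: strongly_measurable_sum\<close>)
  with insert show ?case by simp
qed (simp add: approx_trig_zero)

lemma approx_trig_scaleC_const:
  assumes p: "0 < p" and u: "strongly_measurable torus u" "approx_trig p u"
  shows "approx_trig p (\<lambda>t. u t *\<^sub>C (x::'b::complex_banach))"
  unfolding approx_trig_def
proof (intro allI impI)
  fix e :: real assume e: "0 < e"
  \<comment> \<open>The summand 1 keeps the denominator positive when \<open>x = 0\<close>.\<close>
  define d where "d = e / (1 + norm x powr p)"
  have d: "0 < d" using e by (simp add: d_def add_pos_nonneg)
  obtain P where P: "P \<in> trigs" "Np p (\<lambda>t. u t - P t) \<le> ennreal d"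
    using u(2) d unfolding approx_trig_def by auto
  have "Np p (\<lambda>t. u t *\<^sub>C x - P t *\<^sub>C x) = (\<integral>\<^sup>+t. ennreal (norm x powr p) * ennreal (norm (u t - P t) powr p) \<partial>torus)"
    unfolding Np_def by (intro nn_integral_cong) (simp add: norm_scaleC powr_mult ennreal_mult mult.commute flip: scaleC.diff_left)
  also have "\<dots> = ennreal (norm x powr p) * Np p (\<lambda>t. u t - P t)"
    unfolding Np_def by (intro nn_integral_cmult norm_powr_measurable strongly_measurable_diff u strongly_measurable_trigs P)
  also have "\<dots> \<le> ennreal (norm x powr p) * ennreal d"
    by (intro mult_left_mono P) auto
  also have "\<dots> = ennreal (norm x powr p * d)"
    using d by (simp flip: ennreal_mult)
  also have "\<dots> \<le> ennreal e"
  proof (rule ennreal_leI)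
    have "1 + norm x powr p \<noteq> 0"
      using powr_ge_zero[of "norm x" p] by linarith
    then have "(1 + norm x powr p) * d = e"
      by (simp add: d_def)
    then show "norm x powr p * d \<le> e"
      using d by (simp add: distrib_right)
  qed
  finally show "\<exists>Q\<in>trigs. Np p (\<lambda>t. u t *\<^sub>C x - Q t) \<le> ennreal e"
    by (rule bexI[OF _ trigs_scaleC[OF P(1) trigs_const]])
qed

lemma approx_trig_continuous:
  fixes G :: "real^'d \<Rightarrow> real"
  assumes p: "0 < p" and G: "continuous_on (cbox 0 1) G" and G0: "\<And>t. t \<in> cbox 0 1 - box 0 1 \<Longrightarrow> G t = 0"
  shows "approx_trig p (\<lambda>t. complex_of_real (G t))"
  unfolding approx_trig_def
proof (intro allI impI)
  fix e :: real assume e: "0 < e"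
  obtain P where P: "P \<in> trigs" "\<forall>t\<in>cbox 0 1. norm (complex_of_real (G t) - P t) < e powr (1 / p)"
    using uniform_approx_trigs[OF G G0, of "e powr (1 / p)"] e by auto
  have "Np p (\<lambda>t. complex_of_real (G t) - P t) \<le> (\<integral>\<^sup>+t. ennreal e \<partial>(torus::(real^'d) measure))"
    unfolding Np_def
  proof (intro nn_integral_mono ennreal_leI)
    fix t :: "real^'d" assume "t \<in> space torus"
    then have "t \<in> cbox 0 1" by (simp add: torus_def)
    then have "norm (complex_of_real (G t) - P t) powr p \<le> (e powr (1 / p)) powr p"
      using P(2) p by (intro powr_mono2) (auto simp: less_imp_le)
    then show "norm (complex_of_real (G t) - P t) powr p \<le> e"
      using p e by (simp add: powr_powr)
  qed
  also have "\<dots> = ennreal e"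
    using emeasure_torus[where 'd='d] by simp
  finally show "\<exists>P\<in>trigs. Np p (\<lambda>t. complex_of_real (G t) - P t) \<le> ennreal e"
    using P(1) by blast
qed

lemma AE_torus_box: "AE t in torus. t \<in> box 0 1"
proof -
  have "AE t in lebesgue. t \<notin> cbox 0 1 - box (0::real^'d) 1"
    using negligible_frontier_interval[of "0::real^'d" 1] by (intro AE_not_in) (simp add: negligible_iff_null_sets)
  then show ?thesis
    unfolding torus_def by (subst AE_restrict_space_iff) (auto elim: eventually_mono)
qed

lemma AE_torusI: "AE t in lebesgue. P t \<Longrightarrow> AE t in torus. P t"
  unfolding torus_def by (subst AE_restrict_space_iff) (auto elim: eventually_mono)

lemma indicator_borel_measurable_torus:
  assumes "S \<in> sets lebesgue"
  shows "(\<lambda>t. complex_of_real (indicator S t)) \<in> borel_measurable torus"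
proof -
  have "complex_of_real \<in> borel_measurable borel"
    by (intro borel_measurable_continuous_onI continuous_intros)
  then have "(\<lambda>t. complex_of_real (indicator S t)) \<in> borel_measurable lebesgue"
    by (rule measurable_compose[OF borel_measurable_indicator[OF assms]])
  then show ?thesis
    unfolding torus_def by (rule measurable_restrict_space1)
qed

text \<open>Measurable functions are limits almost everywhere of continuous ones. Clamping to
  \<open>[0,1]\<close> supplies the majorant for dominated convergence, and the factor
  \<open>cut n\<close> supplies the zero boundary values needed for uniform approximation.\<close>

lemma approx_trig_indicator:
  fixes S :: "(real^'d) set"
  assumes p: "0 < p" and S: "S \<in> sets lebesgue"
  shows "approx_trig p (\<lambda>t. complex_of_real (indicator S t))"
proof -
  obtain N g where N: "negligible N" and g: "\<And>n. continuous_on UNIV (g n)"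
    "\<And>t. t \<notin> N \<Longrightarrow> (\<lambda>n. g n t) \<longlonglongrightarrow> (if t \<in> S then 1 else (0::real))"
    using measurable_on_const[OF S, of "1::real"] unfolding measurable_on_def by blast
  \<comment> \<open>A product of ramps of slope \<open>n\<close>, vanishing on the boundary and
    eventually equal to 1 at each interior point.\<close>
  define cut where "cut n t = (\<Prod>i\<in>UNIV. min 1 (real n * max 0 (min (t $ i) (1 - t $ i))))" for n and t :: "real^'d"
  define G where "G n t = max 0 (min 1 (g n t)) * cut n t" for n t
  have ccut: "continuous_on A (cut n)" for n A
    unfolding cut_def by (intro continuous_intros)
  have cG: "continuous_on UNIV (G n)" for n
    unfolding G_def by (intro continuous_intros ccut g continuous_on_max continuous_on_min)
  have cut01: "0 \<le> cut n t" "cut n t \<le> 1" for n t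
    unfolding cut_def by (auto intro!: prod_nonneg prod_le_1)
  have G01: "0 \<le> G n t" "G n t \<le> 1" for n t
    unfolding G_def using cut01[of n t] by (auto intro!: mult_le_one)
  have G0: "G n t = 0" if "t \<in> cbox 0 1 - box 0 1" for n t
  proof -
    have "t \<notin> box 0 1"
      using that by simp
    then obtain i where "\<not> (0 < t $ i \<and> t $ i < 1)"
      unfolding mem_box_cart zero_index one_index by blast
    moreover have "0 \<le> t $ i" "t $ i \<le> 1"
      using that by (auto simp: mem_box_cart)
    ultimately have "t $ i = 0 \<or> t $ i = 1" by linarith
    then have "min 1 (real n * max 0 (min (t $ i) (1 - t $ i))) = 0" by auto
    then have "cut n t = 0"
      unfolding cut_def by (intro prod_zero) auto
    then show ?thesis by (simp add: G_def)
  qed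
  have bG: "(\<lambda>t. complex_of_real (G n t)) \<in> borel_measurable torus" for n
    by (intro borel_torus borel_measurable_continuous_onI continuous_intros cG)
  have bS: "(\<lambda>t. complex_of_real (indicator S t)) \<in> borel_measurable torus"
    by (rule indicator_borel_measurable_torus[OF S])
  have lim_cut: "(\<lambda>n. cut n t) \<longlonglongrightarrow> 1" if "t \<in> box 0 1" for t
  proof -
    have "(\<lambda>n. min 1 (real n * max 0 (min (t $ i) (1 - t $ i)))) \<longlonglongrightarrow> 1" for i
    proof -
      define r where "r = max 0 (min (t $ i) (1 - t $ i))"
      have r: "0 < r" using that by (auto simp: r_def mem_box_cart)
      obtain n0 where n0: "1 / r < real n0" using reals_Archimedean2 by blast
      have "\<forall>\<^sub>F n in sequentially. min 1 (real n * r) = 1"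
        using eventually_ge_at_top[of n0]
      proof eventually_elim
        case (elim n)
        have "1 \<le> real n0 * r" using n0 r by (simp add: field_simps)
        also have "\<dots> \<le> real n * r" using elim r by (intro mult_right_mono) auto
        finally show ?case by simp
      qed
      then show ?thesis unfolding r_def by (rule tendsto_eventually)
    qed
    then have "(\<lambda>n. cut n t) \<longlonglongrightarrow> (\<Prod>i\<in>(UNIV::'d set). 1)"
      unfolding cut_def by (intro tendsto_prod)
    then show ?thesis by simp
  qed
  have AEN: "AE t in torus. t \<notin> N"
    using N by (intro AE_torusI AE_not_in) (simp add: negligible_iff_null_sets)
  have "(\<lambda>n. Np p (\<lambda>t. complex_of_real (indicator S t) - complex_of_real (G n t))) \<longlonglongrightarrow> (\<integral>\<^sup>+t. 0 \<partial>(torus::(real^'d) measure))"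
    unfolding Np_def
  proof (rule nn_integral_dominated_convergence[where w="\<lambda>_. 1"])
    show "(\<lambda>t. ennreal (norm (complex_of_real (indicator S t) - complex_of_real (G n t)) powr p)) \<in> borel_measurable torus" for n
      using bG[of n] bS by measurable
    show "AE t in torus. ennreal (norm (complex_of_real (indicator S t) - complex_of_real (G n t)) powr p) \<le> 1" for n
    proof (rule AE_I2)
      fix t :: "real^'d"
      have "norm (complex_of_real (indicator S t) - complex_of_real (G n t)) = \<bar>indicator S t - G n t\<bar>"
        by (metis norm_of_real of_real_diff)
      also have "\<dots> \<le> 1"
        using G01[of n t] by (auto simp: indicator_def)
      finally have "norm (complex_of_real (indicator S t) - complex_of_real (G n t)) powr p \<le> 1 powr p"
        using p by (intro powr_mono2) auto
      then show "ennreal (norm (complex_of_real (indicator S t) - complex_of_real (G n t)) powr p) \<le> 1"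
        by simp
    qed
    show "AE t in torus. (\<lambda>n. ennreal (norm (complex_of_real (indicator S t) - complex_of_real (G n t)) powr p)) \<longlonglongrightarrow> 0"
      using AE_torus_box AEN
    proof eventually_elim
      case (elim t)
      have ind: "(if t \<in> S then 1 else (0::real)) = indicator S t" by simp
      have "(\<lambda>n. G n t) \<longlonglongrightarrow> max 0 (min 1 (indicator S t)) * 1"
        unfolding G_def using g(2)[of t] elim
        by (intro tendsto_intros lim_cut tendsto_max tendsto_min) (auto simp: ind)
      then have "(\<lambda>n. G n t) \<longlonglongrightarrow> indicator S t"
        by (simp add: indicator_def split: if_splits)
      then have "(\<lambda>n. norm (complex_of_real (indicator S t) - complex_of_real (G n t))) \<longlonglongrightarrow> norm (complex_of_real (indicator S t) - complex_of_real (indicator S t))"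
        by (intro tendsto_intros)
      then have "(\<lambda>n. norm (complex_of_real (indicator S t) - complex_of_real (G n t)) powr p) \<longlonglongrightarrow> 0 powr p"
        using p by (intro tendsto_powr') auto
      then have "(\<lambda>n. ennreal (norm (complex_of_real (indicator S t) - complex_of_real (G n t)) powr p)) \<longlonglongrightarrow> ennreal (0 powr p)"
        by (rule tendsto_ennrealI)
      then show ?case by simp
    qed
  qed (use emeasure_torus[where 'd='d] in auto)
  then have lim: "(\<lambda>n. Np p (\<lambda>t. complex_of_real (indicator S t) - complex_of_real (G n t))) \<longlonglongrightarrow> 0"
    by simp
  show ?thesis
  proof (rule approx_trig_limit[OF p _ _ _ lim])
    show "approx_trig p (\<lambda>t. complex_of_real (G n t))" for n
      by (rule approx_trig_continuous[OF p]) (auto intro: continuous_on_subset[OF cG] G0)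
  qed (auto intro: borel_imp_strongly_measurable bS bG)
qed

text \<open>The decomposition into level sets holds on the cube only, since a function that is
  simple on the torus is arbitrary outside; \<open>Np\<close> does not see the difference.\<close>

lemma approx_trig_simple:
  fixes s :: "real^'d \<Rightarrow> 'b::complex_banach"
  assumes p: "0 < p" and s: "simple_function torus s"
  shows "approx_trig p s"
proof -
  define A where "A y = s -` {y} \<inter> cbox 0 1" for y
  have sp: "space torus = cbox (0::real^'d) 1" by (simp add: torus_def)
  have A: "A y \<in> sets lebesgue" for y
  proof -
    have "A y \<in> sets torus"
      using simple_functionD(2)[OF s, of "{y}"] by (simp add: A_def sp)
    then show ?thesis
      unfolding torus_def by (subst (asm) sets_restrict_space_iff) auto
  qed
  have fin: "finite (s ` cbox 0 1)"
    using simple_functionD(1)[OF s] by (simp add: sp)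
  have eq: "s t = (\<Sum>y\<in>s ` cbox 0 1. complex_of_real (indicator (A y) t) *\<^sub>C y)" if "t \<in> cbox 0 1" for t
  proof -
    have "(\<Sum>y\<in>s ` cbox 0 1. complex_of_real (indicator (A y) t) *\<^sub>C y) = (\<Sum>y\<in>s ` cbox 0 1. if y = s t then y else 0)"
      using that by (intro sum.cong refl) (auto simp: A_def indicator_def scaleC.zero_left)
    then show ?thesis
      using fin that by simp
  qed
  have smA: "strongly_measurable torus (\<lambda>t. complex_of_real (indicator (A y) t))" for y
    by (intro borel_imp_strongly_measurable indicator_borel_measurable_torus A)
  have "approx_trig p (\<lambda>t. \<Sum>y\<in>s ` cbox 0 1. complex_of_real (indicator (A y) t) *\<^sub>C y)"
    by (intro approx_trig_sum p fin strongly_measurable_scaleC strongly_measurable_const smA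
        approx_trig_scaleC_const approx_trig_indicator A)
  moreover have "Np p (\<lambda>t. s t - P t) = Np p (\<lambda>t. (\<Sum>y\<in>s ` cbox 0 1. complex_of_real (indicator (A y) t) *\<^sub>C y) - P t)" for P
    unfolding Np_def
  proof (rule nn_integral_cong)
    fix t :: "real^'d" assume "t \<in> space torus"
    then show "ennreal (norm (s t - P t) powr p) =
        ennreal (norm ((\<Sum>y\<in>s ` cbox 0 1. complex_of_real (indicator (A y) t) *\<^sub>C y) - P t) powr p)"
      using eq[of t] by (simp only: sp)
  qed
  ultimately show ?thesis
    unfolding approx_trig_def by (simp only:)
qed

lemma approx_trig_Lp:
  fixes f :: "real^'d \<Rightarrow> 'b::complex_banach"
  assumes p: "0 < p" and f: "f \<in> Lp torus p"
  shows "approx_trig p f"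
proof -
  have sm: "strongly_measurable torus f" and int: "integrable torus (\<lambda>t. norm (f t) powr p)"
    using f by (auto simp: Lp_def)
  obtain s where s: "\<And>i::nat. simple_function torus (s i)" "AE t in torus. (\<lambda>i. s i t) \<longlonglongrightarrow> f t"
    "\<And>i t. t \<in> space torus \<Longrightarrow> norm (s i t) \<le> 2 * norm (f t)"
    using torus.strongly_measurable_dominated_approx[OF sm] by auto
  have ss: "strongly_measurable torus (s i)" for i
    by (rule strongly_measurable_simple[OF s(1)])
  have "(\<lambda>i. Np p (\<lambda>t. f t - s i t)) \<longlonglongrightarrow> (\<integral>\<^sup>+t. 0 \<partial>(torus::(real^'d) measure))"
    unfolding Np_def
  proof (rule nn_integral_dominated_convergence[where w="\<lambda>t. ennreal (3 powr p * norm (f t) powr p)"])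
    show "(\<lambda>t. ennreal (norm (f t - s i t) powr p)) \<in> borel_measurable torus" for i
      by (intro norm_powr_measurable strongly_measurable_diff sm ss)
    show "(\<lambda>t. ennreal (3 powr p * norm (f t) powr p)) \<in> borel_measurable torus"
      using int by measurable
    show "AE t in torus. ennreal (norm (f t - s i t) powr p) \<le> ennreal (3 powr p * norm (f t) powr p)" for i
    proof (intro AE_I2 ennreal_leI)
      fix t :: "real^'d" assume "t \<in> space torus"
      then have "norm (f t - s i t) \<le> 3 * norm (f t)"
        using s(3)[of t i] norm_triangle_ineq4[of "f t" "s i t"] by linarith
      then have "norm (f t - s i t) powr p \<le> (3 * norm (f t)) powr p"
        using p by (intro powr_mono2) auto
      then show "norm (f t - s i t) powr p \<le> 3 powr p * norm (f t) powr p"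
        by (simp add: powr_mult)
    qed
    have "integrable torus (\<lambda>t. 3 powr p * norm (f t) powr p)"
      using int by simp
    then have "(\<integral>\<^sup>+t. ennreal (norm (3 powr p * norm (f t) powr p)) \<partial>torus) < \<infinity>"
      unfolding integrable_iff_bounded by blast
    then show "(\<integral>\<^sup>+t. ennreal (3 powr p * norm (f t) powr p) \<partial>torus) < \<infinity>"
      by simp
    show "AE t in torus. (\<lambda>i. ennreal (norm (f t - s i t) powr p)) \<longlonglongrightarrow> 0"
      using s(2)
    proof eventually_elim
      case (elim t)
      have "(\<lambda>i. norm (f t - s i t)) \<longlonglongrightarrow> norm (f t - f t)"
        by (intro tendsto_intros elim)
      then have "(\<lambda>i. norm (f t - s i t) powr p) \<longlonglongrightarrow> 0 powr p"
        using p by (intro tendsto_powr') auto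
      then have "(\<lambda>i. ennreal (norm (f t - s i t) powr p)) \<longlonglongrightarrow> ennreal (0 powr p)"
        by (rule tendsto_ennrealI)
      then show ?case by simp
    qed
  qed simp
  then have lim: "(\<lambda>i. Np p (\<lambda>t. f t - s i t)) \<longlonglongrightarrow> 0"
    by simp
  show ?thesis
    by (rule approx_trig_limit[OF p sm ss approx_trig_simple[OF p s(1)] lim])
qed

section \<open>Extension of multipliers from trigonometric polynomials\<close>

text \<open>Finitely supported families on all frequencies replace pairs of a finite set and
  coefficients, so that differences of polynomials need no common frequency set.\<close>

definition fsupp :: "('i \<Rightarrow> 'b::zero) \<Rightarrow> bool" where
  "fsupp y \<longleftrightarrow> finite {k. y k \<noteq> 0}"

definition tp :: "(int^'d \<Rightarrow> 'b::complex_banach) \<Rightarrow> real^'d \<Rightarrow> 'b" where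
  "tp y = trig_poly {k. y k \<noteq> 0} y"

lemma tp_eq:
  assumes "finite K" "{k. y k \<noteq> 0} \<subseteq> K" shows "tp y t = trig_poly K y t"
  unfolding tp_def trig_poly_chr using assms
  by (intro sum.mono_neutral_left) (auto simp: scaleC.zero_right)

lemma fsupp_diff: "fsupp y \<Longrightarrow> fsupp z \<Longrightarrow> fsupp (\<lambda>k. y k - z k :: 'b::group_add)"
  unfolding fsupp_def by (rule finite_subset[of _ "{k. y k \<noteq> 0} \<union> {k. z k \<noteq> 0}"]) auto

lemma fsupp_scaleC: "fsupp y \<Longrightarrow> fsupp (\<lambda>k. c *\<^sub>C y k)"
  unfolding fsupp_def by (rule finite_subset[of _ "{k. y k \<noteq> 0}"]) (auto simp: scaleC.zero_right)

lemma tp_diff: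
  assumes "fsupp y" "fsupp z" shows "tp (\<lambda>k. y k - z k) t = tp y t - tp z t"
proof -
  let ?K = "{k. y k \<noteq> 0} \<union> {k. z k \<noteq> 0}"
  have fin: "finite ?K" using assms by (simp add: fsupp_def)
  have "tp (\<lambda>k. y k - z k) t = trig_poly ?K (\<lambda>k. y k - z k) t"
    by (rule tp_eq[OF fin]) auto
  also have "\<dots> = trig_poly ?K y t - trig_poly ?K z t"
    by (simp add: trig_poly_chr scaleC.diff_right sum_subtractf)
  also have "\<dots> = tp y t - tp z t"
    by (subst (1 2) tp_eq[OF fin]) auto
  finally show ?thesis .
qed

lemma tp_scaleC:
  assumes "fsupp y" shows "tp (\<lambda>k. c *\<^sub>C y k) t = c *\<^sub>C tp y t"
proof -
  have "tp (\<lambda>k. c *\<^sub>C y k) t = trig_poly {k. y k \<noteq> 0} (\<lambda>k. c *\<^sub>C y k) t"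
    by (rule tp_eq) (use assms in \<open>auto simp: fsupp_def scaleC.zero_right\<close>)
  then show ?thesis
    by (simp add: tp_def trig_poly_chr scaleC.sum_right scaleC_scaleC mult.commute)
qed

lemma tp_trigs: "fsupp y \<Longrightarrow> tp y \<in> trigs"
  by (auto simp: trigs_def tp_def fsupp_def)

lemma trig_poly_eq_tp:
  assumes "finite K"
  shows "fsupp (\<lambda>k. if k \<in> K then y k else 0)" "trig_poly K y = tp (\<lambda>k. if k \<in> K then y k else 0)"
proof -
  show "fsupp (\<lambda>k. if k \<in> K then y k else 0)"
    unfolding fsupp_def by (rule finite_subset[OF _ assms]) auto
  have "tp (\<lambda>k. if k \<in> K then y k else 0) t = trig_poly K y t" for t
  proof -
    have "tp (\<lambda>k. if k \<in> K then y k else 0) t = trig_poly K (\<lambda>k. if k \<in> K then y k else 0) t"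
      by (rule tp_eq[OF assms]) auto
    then show ?thesis by (simp add: trig_poly_chr)
  qed
  then show "trig_poly K y = tp (\<lambda>k. if k \<in> K then y k else 0)" by (simp add: fun_eq_iff)
qed

lemma trigs_obtain_tp:
  assumes "P \<in> trigs" obtains y where "fsupp y" "P = tp y"
  using assms trig_poly_eq_tp unfolding trigs_def by blast

text \<open>On the cube, rounding down to a grid of mesh \<open>1 / N\<close> takes finitely many
  values, so any function composed with it is simple.\<close>

lemma simple_function_grid:
  assumes N: "0 < N"
  shows "simple_function torus (\<lambda>t::real^'d. \<chi> i. real_of_int \<lfloor>real N * t $ i\<rfloor> / real N)" (is "simple_function _ ?r")
  unfolding simple_function_def
proof (intro conjI ballI)
  have sp: "space torus = cbox (0::real^'d) 1" by (simp add: torus_def)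
  have "?r ` space torus \<subseteq> {v. \<forall>i. v $ i \<in> (\<lambda>j. real_of_int j / real N) ` {0..int N}}"
  proof (clarsimp simp: sp mem_box_cart)
    fix t :: "real^'d" and i assume "\<forall>i. 0 \<le> t $ i \<and> t $ i \<le> 1"
    then have "0 \<le> real N * t $ i" "real N * t $ i \<le> real N * 1"
      using N by (auto intro: mult_nonneg_nonneg mult_left_mono simp del: mult_1_right)
    then have "\<lfloor>real N * t $ i\<rfloor> \<in> {0..int N}" by (simp add: floor_le_iff)
    then show "real_of_int \<lfloor>real N * t $ i\<rfloor> / real N \<in> (\<lambda>j. real_of_int j / real N) ` {0..int N}"
      by blast
  qed
  moreover have "finite {v::real^'d. \<forall>i. v $ i \<in> (\<lambda>j. real_of_int j / real N) ` {0..int N}}"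
    by (rule finite_vec_box) auto
  ultimately show "finite (?r ` space torus)"
    by (rule finite_subset)
  fix x :: "real^'d"
  have "?r \<in> borel_measurable borel"
  proof (rule borel_measurable_euclidean_space[THEN iffD2], rule ballI)
    fix b :: "real^'d" assume "b \<in> Basis"
    then obtain i where b: "b = axis i 1" by (auto simp: Basis_vec_def)
    have "(\<lambda>t. ?r t \<bullet> b) = (\<lambda>t. real_of_int \<lfloor>real N * t $ i\<rfloor> / real N)"
      by (simp add: b inner_axis)
    then show "(\<lambda>t. ?r t \<bullet> b) \<in> borel_measurable borel"
      by simp
  qed
  then have "?r \<in> borel_measurable torus" by (rule borel_torus)
  then show "?r -` {x} \<inter> space torus \<in> sets torus"
    by (rule measurable_sets) simp
qed

text \<open>Continuous functions are uniformly close to simple ones on the compact torus, so an almost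
  everywhere limit of continuous functions is strongly measurable without an Egorov argument.\<close>

lemma strongly_measurable_limit_continuous:
  fixes F :: "nat \<Rightarrow> real^'d \<Rightarrow> 'b::real_normed_vector"
  assumes F: "\<And>n. continuous_on UNIV (F n)" and lim: "AE t in torus. (\<lambda>n. F n t) \<longlonglongrightarrow> f t"
  shows "strongly_measurable torus f"
proof -
  define r where "r N t = (\<chi> i. real_of_int \<lfloor>real N * t $ i\<rfloor> / real N)" for N and t :: "real^'d"
  have "\<exists>N>0. \<forall>t\<in>cbox 0 1. norm (F n (r N t) - F n t) < 1 / real (Suc n)" for n
  proof -
    have "uniformly_continuous_on (cbox 0 1) (F n)"
      by (intro compact_uniformly_continuous continuous_on_subset[OF F]) auto
    then obtain d where d: "0 < d" "\<And>s t. s \<in> cbox 0 1 \<Longrightarrow> t \<in> cbox 0 1 \<Longrightarrow> dist t s < d \<Longrightarrow> dist (F n t) (F n s) < 1 / real (Suc n)"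
      unfolding uniformly_continuous_on_def by (metis of_nat_0_less_iff zero_less_Suc zero_less_divide_1_iff)
    \<comment> \<open>Each coordinate is moved by at most \<open>1 / N\<close>, so the point is
      moved by at most \<open>CARD('d) / N\<close>.\<close>
    obtain N where N: "real CARD('d) / d < real N" using reals_Archimedean2 by blast
    have N0: "0 < real N" by (rule le_less_trans[OF _ N]) (use d in simp)
    have "norm (F n (r N t) - F n t) < 1 / real (Suc n)" if t: "t \<in> cbox 0 1" for t
    proof -
      have c: "0 \<le> r N t $ i \<and> r N t $ i \<le> 1 \<and> \<bar>r N t $ i - t $ i\<bar> \<le> 1 / real N" for i
      proof -
        have t01: "0 \<le> t $ i" "t $ i \<le> 1" using t by (auto simp: mem_box_cart)
        have "0 \<le> real_of_int \<lfloor>real N * t $ i\<rfloor>"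
          using t01 N0 by auto
        moreover have "real_of_int \<lfloor>real N * t $ i\<rfloor> \<le> real N * t $ i"
          "real N * t $ i < real_of_int \<lfloor>real N * t $ i\<rfloor> + 1"
          by linarith+
        ultimately have a: "0 \<le> real_of_int \<lfloor>real N * t $ i\<rfloor>" "real_of_int \<lfloor>real N * t $ i\<rfloor> \<le> real N * t $ i"
          "real N * t $ i < real_of_int \<lfloor>real N * t $ i\<rfloor> + 1"
          by auto
        have "real N * t $ i \<le> real N * 1"
          using t01 by (intro mult_left_mono) auto
        then have "real_of_int \<lfloor>real N * t $ i\<rfloor> \<le> real N" using a by linarith
        moreover have "t $ i = (real N * t $ i) / real N" using N0 by simp
        then have "r N t $ i - t $ i = (real_of_int \<lfloor>real N * t $ i\<rfloor> - real N * t $ i) / real N"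
          by (simp add: r_def diff_divide_distrib)
        then have "\<bar>r N t $ i - t $ i\<bar> = \<bar>real_of_int \<lfloor>real N * t $ i\<rfloor> - real N * t $ i\<bar> / real N"
          by simp
        moreover have "\<bar>real_of_int \<lfloor>real N * t $ i\<rfloor> - real N * t $ i\<bar> / real N \<le> 1 / real N"
        proof (rule divide_right_mono)
          show "\<bar>real_of_int \<lfloor>real N * t $ i\<rfloor> - real N * t $ i\<bar> \<le> 1"
            using a by linarith
        qed simp
        ultimately show ?thesis
          using a N0 by (simp add: r_def)
      qed
      have "norm (r N t - t) \<le> (\<Sum>i\<in>UNIV. \<bar>(r N t - t) $ i\<bar>)"
        by (rule norm_le_l1_cart)
      also have "\<dots> \<le> (\<Sum>i\<in>(UNIV::'d set). 1 / real N)"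
        using c by (intro sum_mono) simp
      also have "\<dots> < d"
        using N N0 d by (simp add: field_simps)
      finally have "dist (r N t) t < d" by (simp add: dist_norm)
      then have "dist (F n (r N t)) (F n t) < 1 / real (Suc n)"
        using c by (intro d(2) t) (auto simp: mem_box_cart)
      then show ?thesis by (simp add: dist_norm)
    qed
    with N0 show ?thesis by auto
  qed
  then obtain N where N: "\<And>n. 0 < N n" "\<And>n t. t \<in> cbox 0 1 \<Longrightarrow> norm (F n (r (N n) t) - F n t) < 1 / real (Suc n)"
    by metis
  have "simple_function torus (\<lambda>t. F n (r (N n) t))" for n
    unfolding r_def by (rule simple_function_compose1[OF simple_function_grid[OF N(1)]])
  moreover have "AE t in torus. (\<lambda>n. F n (r (N n) t)) \<longlonglongrightarrow> f t"
    using lim AE_space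
  proof eventually_elim
    case (elim t)
    then have t: "t \<in> cbox 0 1" by (simp add: torus_def)
    have "(\<lambda>n. 1 / real (Suc n)) \<longlonglongrightarrow> 0" by real_asymp
    then have "(\<lambda>n. F n (r (N n) t) - F n t) \<longlonglongrightarrow> 0"
      by (rule Lim_null_comparison[rotated]) (use N(2)[OF t] in \<open>auto intro!: always_eventually less_imp_le\<close>)
    from tendsto_add[OF this elim(1)] show ?case by simp
  qed
  ultimately show ?thesis
    unfolding strongly_measurable_def by (intro exI[of _ "\<lambda>n t. F n (r (N n) t)"]) auto
qed

lemma LpI:
  assumes "strongly_measurable torus f" "Np p f < \<infinity>" shows "f \<in> Lp torus p"
proof -
  have "(\<lambda>t. norm (f t) powr p) \<in> borel_measurable torus"
    using torus.borel_measurable_norm_strongly_measurable[OF assms(1)] by measurable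
  then show ?thesis
    using assms by (auto simp: Lp_def Np_def integrable_iff_bounded)
qed

lemma Lp_strongly_measurable: "f \<in> Lp M p \<Longrightarrow> strongly_measurable M f"
  by (simp add: Lp_def)

lemma Np_eq_Lp_norm: "f \<in> Lp torus p \<Longrightarrow> 0 < p \<Longrightarrow> Np p f = ennreal (Lp_norm torus p f powr p)"
  unfolding Np_def Lp_def by (intro nn_integral_eq_Lp_norm_powr) auto

lemma Lp_add:
  assumes "f \<in> Lp torus p" "g \<in> Lp torus p" "0 < p" shows "(\<lambda>t. f t + g t) \<in> Lp torus p"
proof (rule LpI)
  show "strongly_measurable torus (\<lambda>t. f t + g t)"
    using assms by (intro strongly_measurable_add Lp_strongly_measurable)
  have "Np p (\<lambda>t. f t + g t) \<le> ennreal (2 powr p) * (Np p f + Np p g)"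
    using assms by (intro Np_add_le Lp_strongly_measurable)
  also have "\<dots> < \<infinity>"
    using assms by (simp add: Np_eq_Lp_norm flip: ennreal_plus ennreal_mult)
  finally show "Np p (\<lambda>t. f t + g t) < \<infinity>" .
qed

lemma Lp_scaleC:
  assumes "f \<in> Lp torus p" "0 < p" shows "(\<lambda>t. c *\<^sub>C f t) \<in> Lp torus p"
proof (rule LpI)
  show "strongly_measurable torus (\<lambda>t. c *\<^sub>C f t)"
    using assms by (intro strongly_measurable_scaleC strongly_measurable_const Lp_strongly_measurable)
  show "Np p (\<lambda>t. c *\<^sub>C f t) < \<infinity>"
    using assms by (simp add: Np_scaleC[OF Lp_strongly_measurable[OF assms(1)]] Np_eq_Lp_norm flip: ennreal_mult)
qed

section \<open>Construction of the extended operator from the bound on polynomials\<close>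

context
  fixes \<mu> :: "int^'d \<Rightarrow> 'x::complex_banach \<Rightarrow> 'y::complex_banach" and p q C :: real
  assumes \<mu>_add: "\<And>k x z. \<mu> k (x + z) = \<mu> k x + \<mu> k z"
    and \<mu>_scaleC: "\<And>k c x. \<mu> k (c *\<^sub>C x) = c *\<^sub>C \<mu> k x"
    and p: "0 < p" and q: "0 < q" and C: "0 \<le> C"
    and bound: "\<And>K x. finite K \<Longrightarrow> Lp_norm torus q (trig_poly K (\<lambda>k. \<mu> k (x k))) \<le> C * Lp_norm torus p (trig_poly K x)"
begin

lemma \<mu>_zero: "\<mu> k 0 = 0"
  using \<mu>_scaleC[of k 0 0] by (simp add: scaleC.zero_left)

lemma \<mu>_diff: "\<mu> k (x - z) = \<mu> k x - \<mu> k z"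
  using \<mu>_add[of k "x - z" z] by (simp add: algebra_simps)

definition mult_tp :: "(int^'d \<Rightarrow> 'x) \<Rightarrow> real^'d \<Rightarrow> 'y" where
  "mult_tp y = tp (\<lambda>k. \<mu> k (y k))"

lemma fsupp_mult: "fsupp y \<Longrightarrow> fsupp (\<lambda>k. \<mu> k (y k))"
  unfolding fsupp_def by (rule finite_subset[of _ "{k. y k \<noteq> 0}"]) (auto simp: \<mu>_zero)

lemma mult_tp_diff: "fsupp y \<Longrightarrow> fsupp z \<Longrightarrow> mult_tp (\<lambda>k. y k - z k) t = mult_tp y t - mult_tp z t"
  using tp_diff[OF fsupp_mult fsupp_mult] by (simp add: mult_tp_def \<mu>_diff)

lemma mult_tp_scaleC: "fsupp y \<Longrightarrow> mult_tp (\<lambda>k. c *\<^sub>C y k) t = c *\<^sub>C mult_tp y t"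
  using tp_scaleC[OF fsupp_mult] by (simp add: mult_tp_def \<mu>_scaleC)

lemma mult_tp_trigs: "fsupp y \<Longrightarrow> mult_tp y \<in> trigs"
  unfolding mult_tp_def by (intro tp_trigs fsupp_mult)

lemma Np_mult_tp_le:
  assumes y: "fsupp y" and r: "0 \<le> r" "Np p (tp y) \<le> ennreal r"
  shows "Np q (mult_tp y) \<le> ennreal (C powr q * r powr (q / p))"
proof -
  let ?K = "{k. y k \<noteq> 0}"
  have K: "finite ?K" using y by (simp add: fsupp_def)
  have "Lp_norm torus p (tp y) \<le> r powr (1 / p)"
    using r p by (intro Lp_norm_leI) (auto simp: Np_def powr_powr)
  then have "C * Lp_norm torus p (tp y) \<le> C * r powr (1 / p)"
    using C by (rule mult_left_mono)
  moreover have "mult_tp y = trig_poly ?K (\<lambda>k. \<mu> k (y k))"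
    unfolding mult_tp_def fun_eq_iff by (intro allI tp_eq[OF K]) (auto simp: \<mu>_zero)
  ultimately have le: "Lp_norm torus q (mult_tp y) \<le> C * r powr (1 / p)"
    using bound[OF K, of y] by (simp add: tp_def)
  have "Np q (mult_tp y) = ennreal (Lp_norm torus q (mult_tp y) powr q)"
    using q by (intro Np_eq_Lp_norm trigs_in_Lp mult_tp_trigs y)
  also have "\<dots> \<le> ennreal ((C * r powr (1 / p)) powr q)"
    using le q by (intro ennreal_leI powr_mono2) (auto simp: Lp_norm_nonneg)
  finally show ?thesis
    using C p by (simp add: powr_mult powr_powr)
qed

text \<open>Fatou's lemma needs only convergence almost everywhere on the output side. For general
  \<open>r0\<close> this bounds the extension; for \<open>r0 = 0\<close> it shows that a limit
  vanishes.\<close>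

lemma Np_limit_mult_tp_le:
  assumes w: "\<And>n. fsupp (w n)" and r: "\<And>n. 0 \<le> r n" "\<And>n. Np p (tp (w n)) \<le> ennreal (r n)" "r \<longlonglongrightarrow> r0"
    and h: "AE t in torus. (\<lambda>n. mult_tp (w n) t) \<longlonglongrightarrow> h t"
  shows "Np q h \<le> ennreal (C powr q * r0 powr (q / p))"
proof -
  have "Np q h = (\<integral>\<^sup>+t. liminf (\<lambda>n. ennreal (norm (mult_tp (w n) t) powr q)) \<partial>torus)"
    unfolding Np_def
  proof (rule nn_integral_cong_AE)
    show "AE t in torus. ennreal (norm (h t) powr q) = liminf (\<lambda>n. ennreal (norm (mult_tp (w n) t) powr q))"
      using h
    proof eventually_elim
      case (elim t)
      have "(\<lambda>n. ennreal (norm (mult_tp (w n) t) powr q)) \<longlonglongrightarrow> ennreal (norm (h t) powr q)"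
        using q by (intro tendsto_ennrealI tendsto_powr' tendsto_norm elim tendsto_const) auto
      then show ?case by (intro lim_imp_Liminf[symmetric]) simp
    qed
  qed
  also have "\<dots> \<le> liminf (\<lambda>n. Np q (mult_tp (w n)))"
    unfolding Np_def by (intro nn_integral_liminf norm_powr_measurable strongly_measurable_trigs mult_tp_trigs w)
  also have "\<dots> \<le> liminf (\<lambda>n. ennreal (C powr q * r n powr (q / p)))"
    by (intro Liminf_mono always_eventually allI Np_mult_tp_le w r)
  also have "\<dots> = ennreal (C powr q * r0 powr (q / p))"
  proof (rule lim_imp_Liminf)
    have "(\<lambda>n. r n powr (q / p)) \<longlonglongrightarrow> r0 powr (q / p)"
      using r p q by (intro tendsto_powr' tendsto_const) auto
    then show "(\<lambda>n. ennreal (C powr q * r n powr (q / p))) \<longlonglongrightarrow> ennreal (C powr q * r0 powr (q / p))"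
      by (intro tendsto_ennrealI tendsto_mult tendsto_const)
  qed simp
  finally show ?thesis .
qed

text \<open>The ratio \<open>(1 / 4) powr p\<close> leaves room for a weight \<open>2 ^ n\<close> in
  the convergence proof, and the divisor \<open>2 powr (p + 1)\<close> cancels the constant lost
  when consecutive approximations are compared.\<close>

definition err :: "nat \<Rightarrow> real" where
  "err n = ((1 / 4) powr p) ^ n / 2 powr (p + 1)"

lemma err_pos: "0 < err n"
  by (simp add: err_def)

lemma err_tendsto: "err \<longlonglongrightarrow> 0"
proof -
  have "((1 / 4 :: real) powr p) < 1"
    using p powr_less_mono2[of p "1 / 4" 1] by simp
  then have "(\<lambda>n. ((1 / 4 :: real) powr p) ^ n) \<longlonglongrightarrow> 0"
    by (intro LIMSEQ_power_zero) simp
  then have "(\<lambda>n. ((1 / 4 :: real) powr p) ^ n / 2 powr (p + 1)) \<longlonglongrightarrow> 0 / 2 powr (p + 1)"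
    by (intro tendsto_divide tendsto_const) auto
  then show ?thesis
    by (simp add: err_def[abs_def])
qed

text \<open>The choice is made separately for every function and is not linear; linearity reappears
  only in the limit, almost everywhere.\<close>

definition coeffs :: "(real^'d \<Rightarrow> 'x) \<Rightarrow> nat \<Rightarrow> int^'d \<Rightarrow> 'x" where
  "coeffs f n = (SOME y. fsupp y \<and> Np p (\<lambda>t. f t - tp y t) \<le> ennreal (err n))"

lemma coeffs:
  assumes "f \<in> Lp torus p"
  shows "fsupp (coeffs f n)" "Np p (\<lambda>t. f t - tp (coeffs f n) t) \<le> ennreal (err n)"
proof -
  obtain P where P: "P \<in> trigs" "Np p (\<lambda>t. f t - P t) \<le> ennreal (err n)"
    using approx_trig_Lp[OF p assms] err_pos[of n] unfolding approx_trig_def by blast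
  obtain y where "fsupp y" "P = tp y"
    using trigs_obtain_tp[OF P(1)] by blast
  with P(2) have "\<exists>y. fsupp y \<and> Np p (\<lambda>t. f t - tp y t) \<le> ennreal (err n)"
    by auto
  from someI_ex[OF this] show "fsupp (coeffs f n)" "Np p (\<lambda>t. f t - tp (coeffs f n) t) \<le> ennreal (err n)"
    unfolding coeffs_def by auto
qed

text \<open>For \<open>f\<close> in L^p the sequence may diverge on a null set, where
  \<open>lim\<close> is unspecified; all claims about the extension hold up to null sets.\<close>

definition extend :: "(real^'d \<Rightarrow> 'x) \<Rightarrow> real^'d \<Rightarrow> 'y" where
  "extend f t = lim (\<lambda>n. mult_tp (coeffs f n) t)"

lemma Np_coeffs_diff_le:
  assumes f: "f \<in> Lp torus p"
  shows "Np p (tp (\<lambda>k. coeffs f (Suc n) k - coeffs f n k)) \<le> ennreal (((1 / 4) powr p) ^ n)"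
proof -
  note sm = Lp_strongly_measurable[OF f]
  let ?P = "\<lambda>n. tp (coeffs f n)"
  have sP: "strongly_measurable torus (?P n)" for n
    by (intro strongly_measurable_trigs tp_trigs coeffs f)
  have "Np p (tp (\<lambda>k. coeffs f (Suc n) k - coeffs f n k)) = Np p (\<lambda>t. (?P (Suc n) t - f t) + (f t - ?P n t))"
    by (simp add: tp_diff[OF coeffs(1)[OF f] coeffs(1)[OF f]] Np_def)
  also have "\<dots> \<le> ennreal (2 powr p) * (Np p (\<lambda>t. ?P (Suc n) t - f t) + Np p (\<lambda>t. f t - ?P n t))"
    by (intro Np_add_le strongly_measurable_diff sm sP p)
  also have "\<dots> \<le> ennreal (2 powr p) * (ennreal (err (Suc n)) + ennreal (err n))"
    using coeffs(2)[OF f] by (intro mult_left_mono add_mono) (auto simp: Np_commute[of p _ f])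
  also have "\<dots> = ennreal (2 powr p * (err (Suc n) + err n))"
    using err_pos[of n] err_pos[of "Suc n"] by (simp flip: ennreal_plus ennreal_mult)
  also have "\<dots> \<le> ennreal (2 powr p * (2 * err n))"
  proof (intro ennreal_leI mult_left_mono)
    have "(1 / 4 :: real) powr p \<le> 1"
      using p by (simp add: powr_le1)
    then have "err (Suc n) \<le> err n"
      unfolding err_def by (intro divide_right_mono) (auto simp: mult_left_le_one_le)
    then show "err (Suc n) + err n \<le> 2 * err n" by simp
  qed simp
  also have "2 powr p * (2 * err n) = ((1 / 4) powr p) ^ n"
    by (simp add: err_def powr_add)
  finally show ?thesis .
qed

text \<open>The series of the \<open>W n\<close> has finite integral, bounded by a geometric series
  with ratio \<open>\<rho> = (1 / 2) powr q\<close>, so it converges at almost every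
  \<open>t\<close>. There its terms tend to 0, hence \<open>norm (D n t)\<close> is eventually at
  most \<open>(1 / 2) ^ n\<close>, and the telescoping series of the \<open>D n t\<close> converges
  absolutely.\<close>

lemma extend_lim:
  assumes f: "f \<in> Lp torus p"
  shows "AE t in torus. (\<lambda>n. mult_tp (coeffs f n) t) \<longlonglongrightarrow> extend f t"
proof -
  define D where "D n t = mult_tp (coeffs f (Suc n)) t - mult_tp (coeffs f n) t" for n t
  have fs: "fsupp (\<lambda>k. coeffs f (Suc n) k - coeffs f n k)" for n
    by (intro fsupp_diff coeffs f)
  have Deq: "D n = mult_tp (\<lambda>k. coeffs f (Suc n) k - coeffs f n k)" for n
    by (simp add: fun_eq_iff D_def mult_tp_diff[OF coeffs(1)[OF f] coeffs(1)[OF f]])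
  have sD: "strongly_measurable torus (D n)" for n
    unfolding Deq by (intro strongly_measurable_trigs mult_tp_trigs fs)
  define \<rho> where "\<rho> = (1 / 2 :: real) powr q"
  have \<rho>: "0 \<le> \<rho>" "\<rho> < 1" using q powr_less_mono2[of q "1 / 2" 1] by (auto simp: \<rho>_def)
  define W where "W n t = ennreal ((2 ^ n) powr q * norm (D n t) powr q)" for n t
  have Wm: "W n \<in> borel_measurable torus" for n
    unfolding W_def using torus.borel_measurable_norm_strongly_measurable[OF sD[of n]] by measurable
  have Wi: "(\<integral>\<^sup>+t. W n t \<partial>torus) \<le> ennreal (C powr q * \<rho> ^ n)" for n
  proof -
    have "(\<integral>\<^sup>+t. W n t \<partial>torus) = ennreal ((2 ^ n) powr q) * Np q (D n)"
      unfolding W_def Np_def using norm_powr_measurable[OF sD[of n], of q]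
      by (simp add: ennreal_mult nn_integral_cmult)
    also have "\<dots> \<le> ennreal ((2 ^ n) powr q) * ennreal (C powr q * (((1 / 4) powr p) ^ n) powr (q / p))"
      unfolding Deq by (intro mult_left_mono Np_mult_tp_le fs Np_coeffs_diff_le f) auto
    also have "\<dots> = ennreal ((2 ^ n) powr q * (C powr q * (((1 / 4) powr p) ^ n) powr (q / p)))"
      by (simp flip: ennreal_mult)
    also have "(2 ^ n) powr q * (C powr q * (((1 / 4) powr p) ^ n) powr (q / p)) = C powr q * \<rho> ^ n"
    proof -
      have "(((1 / 4 :: real) powr p) ^ n) powr (q / p) = ((1 / 4) powr q) ^ n"
        using p by (simp add: powr_realpow[symmetric] powr_powr mult_ac)
      moreover have "(2 ^ n :: real) powr q = (2 powr q) ^ n"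
        by (simp add: powr_realpow[symmetric] powr_powr mult_ac)
      moreover have "2 powr q * (1 / 4) powr q = \<rho>"
        by (simp add: \<rho>_def flip: powr_mult)
      ultimately show ?thesis
        by (simp add: mult_ac flip: power_mult_distrib)
    qed
    finally show ?thesis .
  qed
  have "(\<integral>\<^sup>+t. (\<Sum>n. W n t) \<partial>torus) = (\<Sum>n. \<integral>\<^sup>+t. W n t \<partial>torus)"
    by (rule nn_integral_suminf[OF Wm])
  also have "\<dots> \<le> (\<Sum>n. ennreal (C powr q * \<rho> ^ n))"
    by (intro suminf_le Wi) auto
  also have "\<dots> = ennreal (\<Sum>n. C powr q * \<rho> ^ n)"
    using \<rho> by (intro suminf_ennreal2 summable_mult summable_geometric) auto
  also have "\<dots> < \<infinity>" by simp
  finally have "AE t in torus. (\<Sum>n. W n t) \<noteq> \<infinity>"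
    by (intro nn_integral_noteq_infinite borel_measurable_suminf_order Wm) auto
  then show ?thesis
  proof eventually_elim
    case (elim t)
    then have "summable (\<lambda>n. (2 ^ n) powr q * norm (D n t) powr q)"
      unfolding W_def by (intro summable_suminf_not_top) auto
    then have "(\<lambda>n. (2 ^ n) powr q * norm (D n t) powr q) \<longlonglongrightarrow> 0"
      by (rule summable_LIMSEQ_zero)
    then have "\<forall>\<^sub>F n in sequentially. (2 ^ n) powr q * norm (D n t) powr q < 1"
      by (rule order_tendstoD(2)) simp
    then have ev: "\<forall>\<^sub>F n in sequentially. norm (D n t) \<le> (1 / 2) ^ n"
    proof eventually_elim
      case (elim n)
      then have "(2 ^ n * norm (D n t)) powr q < 1 powr q"
        by (simp add: powr_mult)
      then have "2 ^ n * norm (D n t) < 1"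
        using q powr_mono2[of q 1 "2 ^ n * norm (D n t)"] by (cases "2 ^ n * norm (D n t) < 1") auto
      then show ?case
        by (simp add: field_simps power_one_over less_imp_le)
    qed
    have "summable (\<lambda>n. D n t)"
      by (rule summable_comparison_test_ev[OF ev]) (intro summable_geometric, simp)
    then have "(\<lambda>n. \<Sum>i<n. D i t) \<longlonglongrightarrow> (\<Sum>i. D i t)"
      by (rule summable_LIMSEQ)
    moreover have "(\<Sum>i<n. D i t) = mult_tp (coeffs f n) t - mult_tp (coeffs f 0) t" for n
      unfolding D_def by (rule sum_lessThan_telescope)
    ultimately have "(\<lambda>n. mult_tp (coeffs f n) t - mult_tp (coeffs f 0) t + mult_tp (coeffs f 0) t) \<longlonglongrightarrow> (\<Sum>i. D i t) + mult_tp (coeffs f 0) t"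
      by (intro tendsto_add tendsto_const) simp
    then have "convergent (\<lambda>n. mult_tp (coeffs f n) t)"
      by (auto simp: convergent_def)
    then show ?case
      unfolding extend_def by (simp add: convergent_LIMSEQ_iff)
  qed
qed

lemma strongly_measurable_extend:
  assumes f: "f \<in> Lp torus p" shows "strongly_measurable torus (extend f)"
  by (rule strongly_measurable_limit_continuous[OF _ extend_lim[OF f]])
    (intro trigs_continuous mult_tp_trigs coeffs f)

text \<open>The factor 2 is the p-th root of the constant in \<open>Np_add_le\<close>, used to
  compare the approximating polynomials with \<open>f\<close>. Only boundedness of the extension is
  at stake.\<close>

lemma extend_bound:
  assumes f: "f \<in> Lp torus p"
  shows "Np q (extend f) \<le> ennreal ((2 * C * Lp_norm torus p f) powr q)"
proof -
  let ?I = "Lp_norm torus p f powr p"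
  note sm = Lp_strongly_measurable[OF f]
  have "Np q (extend f) \<le> ennreal (C powr q * (2 powr p * (?I + 0)) powr (q / p))"
  proof (rule Np_limit_mult_tp_le[OF _ _ _ _ extend_lim[OF f]])
    show "fsupp (coeffs f n)" for n by (rule coeffs[OF f])
    show "0 \<le> 2 powr p * (?I + err n)" for n
      using err_pos[of n] by (simp add: less_imp_le)
    show "Np p (tp (coeffs f n)) \<le> ennreal (2 powr p * (?I + err n))" for n
    proof -
      let ?P = "tp (coeffs f n)"
      have sP: "strongly_measurable torus ?P"
        by (intro strongly_measurable_trigs tp_trigs coeffs f)
      have "Np p ?P = Np p (\<lambda>t. f t + (?P t - f t))" by simp
      also have "\<dots> \<le> ennreal (2 powr p) * (Np p f + Np p (\<lambda>t. ?P t - f t))"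
        by (intro Np_add_le strongly_measurable_diff sm sP p)
      also have "\<dots> \<le> ennreal (2 powr p) * (ennreal ?I + ennreal (err n))"
        using coeffs(2)[OF f, of n] by (intro mult_left_mono add_mono) (auto simp: Np_commute[of p _ f] Np_eq_Lp_norm[OF f p])
      also have "\<dots> = ennreal (2 powr p * (?I + err n))"
        using err_pos[of n] by (simp flip: ennreal_plus ennreal_mult)
      finally show ?thesis .
    qed
    show "(\<lambda>n. 2 powr p * (?I + err n)) \<longlonglongrightarrow> 2 powr p * (?I + 0)"
      by (intro tendsto_intros err_tendsto)
  qed
  also have "C powr q * (2 powr p * (?I + 0)) powr (q / p) = (2 * C * Lp_norm torus p f) powr q"
    using p C Lp_norm_nonneg[of torus p f] by (simp add: powr_mult powr_powr)
  finally show ?thesis .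
qed

lemma AE_zero_of_Np:
  assumes "strongly_measurable torus h" "Np q h \<le> 0"
  shows "AE t in torus. h t = 0"
proof -
  have "AE t in torus. ennreal (norm (h t) powr q) = 0"
    using assms(2) nn_integral_0_iff_AE[OF norm_powr_measurable[OF assms(1), of q]] by (simp add: Np_def)
  then show ?thesis
    by eventually_elim auto
qed

text \<open>Additivity, homogeneity and agreement with the multiplier all reduce to this: a suitable
  combination of coefficient families has polynomials tending to 0 in L^p, so the same combination
  of outputs vanishes almost everywhere.\<close>

lemma AE_zero_of_limit:
  assumes w: "\<And>n. fsupp (w n)" and r: "\<And>n. 0 \<le> r n" "\<And>n. Np p (tp (w n)) \<le> ennreal (r n)" "r \<longlonglongrightarrow> 0"
    and h: "AE t in torus. (\<lambda>n. mult_tp (w n) t) \<longlonglongrightarrow> h t" and sm: "strongly_measurable torus h"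
  shows "AE t in torus. h t = 0"
proof (rule AE_zero_of_Np[OF sm])
  have "Np q h \<le> ennreal (C powr q * 0 powr (q / p))"
    by (rule Np_limit_mult_tp_le[OF w r h])
  then show "Np q h \<le> 0" by simp
qed

lemma extend_add:
  assumes f: "f \<in> Lp torus p" and g: "g \<in> Lp torus p"
  shows "AE t in torus. extend (\<lambda>s. f s + g s) t = extend f t + extend g t"
proof -
  let ?fg = "\<lambda>s. f s + g s"
  have fg: "?fg \<in> Lp torus p" by (rule Lp_add[OF f g p])
  \<comment> \<open>The polynomial of \<open>w n\<close> is a combination of three approximation
    errors and tends to 0 however the coefficients were chosen.\<close>
  define w where "w n k = coeffs ?fg n k - coeffs f n k - coeffs g n k" for n k
  have "AE t in torus. extend ?fg t - extend f t - extend g t = 0"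
  proof (rule AE_zero_of_limit)
    show "fsupp (w n)" for n
      unfolding w_def by (intro fsupp_diff coeffs f g fg)
    let ?r = "\<lambda>n. 2 powr p * (2 powr p * (err n + err n) + err n)"
    show "0 \<le> ?r n" for n
      using err_pos[of n] by simp
    show "Np p (tp (w n)) \<le> ennreal (?r n)" for n
    proof -
      have sP: "strongly_measurable torus (tp (coeffs u n))" if "u \<in> Lp torus p" for u
        by (intro strongly_measurable_trigs tp_trigs coeffs that)
      have "tp (w n) t = ((f t - tp (coeffs f n) t) + (g t - tp (coeffs g n) t)) + (tp (coeffs ?fg n) t - ?fg t)" for t
        unfolding w_def by (subst tp_diff, (intro fsupp_diff coeffs f g fg)+)+ simp
      then have "Np p (tp (w n)) = Np p (\<lambda>t. ((f t - tp (coeffs f n) t) + (g t - tp (coeffs g n) t)) + (tp (coeffs ?fg n) t - ?fg t))"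
        by (simp only: Np_def)
      also have "\<dots> \<le> ennreal (2 powr p) * (Np p (\<lambda>t. (f t - tp (coeffs f n) t) + (g t - tp (coeffs g n) t)) + Np p (\<lambda>t. tp (coeffs ?fg n) t - ?fg t))"
        by (intro Np_add_le strongly_measurable_add strongly_measurable_diff Lp_strongly_measurable[OF f] Lp_strongly_measurable[OF g] sP f g fg p)
      also have "\<dots> \<le> ennreal (2 powr p) * (ennreal (2 powr p) * (Np p (\<lambda>t. f t - tp (coeffs f n) t) + Np p (\<lambda>t. g t - tp (coeffs g n) t)) + Np p (\<lambda>t. tp (coeffs ?fg n) t - ?fg t))"
        by (intro mult_left_mono add_mono order_refl Np_add_le strongly_measurable_diff Lp_strongly_measurable[OF f] Lp_strongly_measurable[OF g] sP f g p) auto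
      also have "\<dots> \<le> ennreal (2 powr p) * (ennreal (2 powr p) * (ennreal (err n) + ennreal (err n)) + ennreal (err n))"
        using coeffs(2)[OF fg, of n] Np_commute[of p ?fg "tp (coeffs ?fg n)"]
        by (intro mult_left_mono add_mono coeffs f g) auto
      also have "\<dots> = ennreal (?r n)"
        using err_pos[of n] by (simp flip: ennreal_plus ennreal_mult)
      finally show ?thesis .
    qed
    have "?r \<longlonglongrightarrow> 2 powr p * (2 powr p * (0 + 0) + 0)"
      by (intro tendsto_intros err_tendsto)
    then show "?r \<longlonglongrightarrow> 0" by simp
    show "AE t in torus. (\<lambda>n. mult_tp (w n) t) \<longlonglongrightarrow> extend ?fg t - extend f t - extend g t"
      using extend_lim[OF fg] extend_lim[OF f] extend_lim[OF g]
    proof eventually_elim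
      case (elim t)
      have "mult_tp (w n) t = mult_tp (coeffs ?fg n) t - mult_tp (coeffs f n) t - mult_tp (coeffs g n) t" for n
        unfolding w_def by (subst mult_tp_diff, (intro fsupp_diff coeffs f g fg)+)+ simp
      then show ?case
        using tendsto_diff[OF tendsto_diff[OF elim(1,2)] elim(3)] by simp
    qed
    show "strongly_measurable torus (\<lambda>t. extend ?fg t - extend f t - extend g t)"
      by (intro strongly_measurable_diff strongly_measurable_extend f g fg)
  qed
  then show ?thesis
    by eventually_elim (simp add: algebra_simps)
qed

lemma extend_scaleC:
  assumes f: "f \<in> Lp torus p"
  shows "AE t in torus. extend (\<lambda>s. c *\<^sub>C f s) t = c *\<^sub>C extend f t"
proof -
  let ?cf = "\<lambda>s. c *\<^sub>C f s"
  have cf: "?cf \<in> Lp torus p" by (rule Lp_scaleC[OF f p])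
  define w where "w n k = coeffs ?cf n k - c *\<^sub>C coeffs f n k" for n k
  have "AE t in torus. extend ?cf t - c *\<^sub>C extend f t = 0"
  proof (rule AE_zero_of_limit)
    show "fsupp (w n)" for n
      unfolding w_def by (intro fsupp_diff fsupp_scaleC coeffs f cf)
    let ?r = "\<lambda>n. 2 powr p * (err n + cmod c powr p * err n)"
    show "0 \<le> ?r n" for n
      using err_pos[of n] by simp
    show "Np p (tp (w n)) \<le> ennreal (?r n)" for n
    proof -
      have sP: "strongly_measurable torus (tp (coeffs u n))" if "u \<in> Lp torus p" for u
        by (intro strongly_measurable_trigs tp_trigs coeffs that)
      have "tp (w n) t = (tp (coeffs ?cf n) t - ?cf t) + c *\<^sub>C (f t - tp (coeffs f n) t)" for t
        unfolding w_def using tp_diff[OF coeffs(1)[OF cf] fsupp_scaleC[OF coeffs(1)[OF f]], of n c n t] tp_scaleC[OF coeffs(1)[OF f], of c n t]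
        by (simp add: scaleC.diff_right)
      then have "Np p (tp (w n)) = Np p (\<lambda>t. (tp (coeffs ?cf n) t - ?cf t) + c *\<^sub>C (f t - tp (coeffs f n) t))"
        by (simp only: Np_def)
      also have "\<dots> \<le> ennreal (2 powr p) * (Np p (\<lambda>t. tp (coeffs ?cf n) t - ?cf t) + Np p (\<lambda>t. c *\<^sub>C (f t - tp (coeffs f n) t)))"
        by (intro Np_add_le strongly_measurable_scaleC strongly_measurable_const strongly_measurable_diff Lp_strongly_measurable[OF f] sP f cf p)
      also have "Np p (\<lambda>t. c *\<^sub>C (f t - tp (coeffs f n) t)) = ennreal (cmod c powr p) * Np p (\<lambda>t. f t - tp (coeffs f n) t)"
        by (rule Np_scaleC) (intro strongly_measurable_diff Lp_strongly_measurable[OF f] sP f)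
      also have "ennreal (2 powr p) * (Np p (\<lambda>t. tp (coeffs ?cf n) t - ?cf t) + ennreal (cmod c powr p) * Np p (\<lambda>t. f t - tp (coeffs f n) t))
        \<le> ennreal (2 powr p) * (ennreal (err n) + ennreal (cmod c powr p) * ennreal (err n))"
        using coeffs(2)[OF cf, of n] Np_commute[of p ?cf "tp (coeffs ?cf n)"]
        by (intro mult_left_mono add_mono coeffs f) auto
      also have "\<dots> = ennreal (?r n)"
        using err_pos[of n] by (simp flip: ennreal_plus ennreal_mult)
      finally show ?thesis .
    qed
    have "?r \<longlonglongrightarrow> 2 powr p * (0 + cmod c powr p * 0)"
      by (intro tendsto_intros err_tendsto)
    then show "?r \<longlonglongrightarrow> 0" by simp
    show "AE t in torus. (\<lambda>n. mult_tp (w n) t) \<longlonglongrightarrow> extend ?cf t - c *\<^sub>C extend f t"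
      using extend_lim[OF cf] extend_lim[OF f]
    proof eventually_elim
      case (elim t)
      have "mult_tp (w n) t = mult_tp (coeffs ?cf n) t - c *\<^sub>C mult_tp (coeffs f n) t" for n
        unfolding w_def using mult_tp_diff[OF coeffs(1)[OF cf] fsupp_scaleC[OF coeffs(1)[OF f]], of n c n t] mult_tp_scaleC[OF coeffs(1)[OF f], of c n t]
        by simp
      then show ?case
        using tendsto_diff[OF elim(1) scaleC.tendsto[OF tendsto_const elim(2)]] by simp
    qed
    show "strongly_measurable torus (\<lambda>t. extend ?cf t - c *\<^sub>C extend f t)"
      by (intro strongly_measurable_diff strongly_measurable_scaleC strongly_measurable_const strongly_measurable_extend f cf)
  qed
  then show ?thesis
    by eventually_elim simp
qed

lemma extend_trig_poly:
  assumes K: "finite K"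
  shows "AE t in torus. extend (trig_poly K x) t = trig_poly K (\<lambda>k. \<mu> k (x k)) t"
proof -
  define y where "y k = (if k \<in> K then x k else 0)" for k
  have y: "fsupp y" "trig_poly K x = tp y"
    using trig_poly_eq_tp[OF K, of x] by (auto simp: y_def[abs_def])
  have f: "tp y \<in> Lp torus p"
    by (intro trigs_in_Lp tp_trigs y p)
  have My: "mult_tp y = trig_poly K (\<lambda>k. \<mu> k (x k))"
  proof -
    have "(\<lambda>k. \<mu> k (y k)) = (\<lambda>k. if k \<in> K then \<mu> k (x k) else 0)"
      by (auto simp: y_def \<mu>_zero)
    then show ?thesis
      using trig_poly_eq_tp(2)[OF K, of "\<lambda>k. \<mu> k (x k)"] by (simp add: mult_tp_def)
  qed
  have "AE t in torus. extend (tp y) t - mult_tp y t = 0"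
  proof (rule AE_zero_of_limit)
    let ?w = "\<lambda>n k. coeffs (tp y) n k - y k"
    show "fsupp (?w n)" for n
      by (intro fsupp_diff coeffs f y)
    show "0 \<le> err n" for n using err_pos[of n] by simp
    show "Np p (tp (?w n)) \<le> ennreal (err n)" for n
      using coeffs(2)[OF f, of n] Np_commute[of p "tp y" "tp (coeffs (tp y) n)"]
      by (simp add: tp_diff[OF coeffs(1)[OF f] y(1)] Np_def)
    show "err \<longlonglongrightarrow> 0" by (rule err_tendsto)
    show "AE t in torus. (\<lambda>n. mult_tp (?w n) t) \<longlonglongrightarrow> extend (tp y) t - mult_tp y t"
      using extend_lim[OF f]
    proof eventually_elim
      case (elim t)
      then show ?case
        using tendsto_diff[OF elim tendsto_const[of "mult_tp y t"]] by (simp add: mult_tp_diff[OF coeffs(1)[OF f] y(1)])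
    qed
    show "strongly_measurable torus (\<lambda>t. extend (tp y) t - mult_tp y t)"
      by (intro strongly_measurable_diff strongly_measurable_extend strongly_measurable_trigs mult_tp_trigs f y)
  qed
  then show ?thesis
    unfolding y(2) My[symmetric] by eventually_elim simp
qed

lemma torus_multiplier_boundedI: "torus_multiplier_bounded p q \<mu>"
  unfolding torus_multiplier_bounded_def
proof (rule exI[of _ extend], rule exI[of _ "2 * C"], intro conjI ballI allI impI)
  fix f :: "real^'d \<Rightarrow> 'x" assume f: "f \<in> Lp torus p"
  note b = extend_bound[OF f]
  show "extend f \<in> Lp torus q"
    by (rule LpI[OF strongly_measurable_extend[OF f] le_less_trans[OF b]]) simp
  show "Lp_norm torus q (extend f) \<le> 2 * C * Lp_norm torus p f"
    using b q C by (intro Lp_norm_leI) (auto simp: Np_def Lp_norm_nonneg)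
qed (auto intro: extend_add extend_scaleC extend_trig_poly)

end

section \<open>Linearity of the averages, and the conclusion\<close>

lemma cube_average_add:
  fixes m :: "real^'d \<Rightarrow> ('x::complex_banach, 'y::complex_banach) blinfun"
  assumes a: "0 < a" and loc: "\<And>x. (\<lambda>\<xi>. blinfun_apply (m \<xi>) x) \<in> L1_loc"
  shows "cube_average a m k (x + z) = cube_average a m k x + cube_average a m k z"
proof -
  have "a ^ CARD('d) *\<^sub>R cube_average a m k (x + z) = a ^ CARD('d) *\<^sub>R cube_average a m k x + a ^ CARD('d) *\<^sub>R cube_average a m k z"
    using completion.has_Bochner_integral_unique[OF cube_average_eq(1)[OF a loc, of k "x + z", unfolded blinfun.add_right scaleR_add_right]
        completion.has_Bochner_integral_add[OF cube_average_eq(1)[OF a loc, of k x] cube_average_eq(1)[OF a loc, of k z]]] .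
  then have "a ^ CARD('d) *\<^sub>R cube_average a m k (x + z) = a ^ CARD('d) *\<^sub>R (cube_average a m k x + cube_average a m k z)"
    by (simp add: scaleR_add_right)
  then show ?thesis
    using a by (simp only: scaleR_cancel_left) auto
qed

lemma cube_average_scaleC:
  fixes m :: "real^'d \<Rightarrow> ('x::complex_banach, 'y::complex_banach) blinfun"
  assumes a: "0 < a" and loc: "\<And>x. (\<lambda>\<xi>. blinfun_apply (m \<xi>) x) \<in> L1_loc" and cl: "\<And>\<xi>. complex_linear_op (m \<xi>)"
  shows "cube_average a m k (c *\<^sub>C x) = c *\<^sub>C cube_average a m k x"
proof -
  have eq: "indicator (cbox 0 1) (\<xi> /\<^sub>R a - int_vec k) *\<^sub>R blinfun_apply (m \<xi>) (c *\<^sub>C x) =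
    c *\<^sub>C (indicator (cbox 0 1) (\<xi> /\<^sub>R a - int_vec k) *\<^sub>R blinfun_apply (m \<xi>) x)" for \<xi>
    using cl[of \<xi>] by (simp add: complex_linear_op_def scaleC.scaleR_right)
  have "has_Bochner_integral lebesgue (\<lambda>\<xi>. c *\<^sub>C (indicator (cbox 0 1) (\<xi> /\<^sub>R a - int_vec k) *\<^sub>R blinfun_apply (m \<xi>) x))
      (c *\<^sub>C (a ^ CARD('d) *\<^sub>R cube_average a m k x))"
    by (rule completion.has_Bochner_integral_bounded_linear[OF scaleC.bounded_linear_right cube_average_eq(1)[OF a loc]])
  with cube_average_eq(1)[OF a loc, of k "c *\<^sub>C x", unfolded eq]
  have "a ^ CARD('d) *\<^sub>R cube_average a m k (c *\<^sub>C x) = c *\<^sub>C (a ^ CARD('d) *\<^sub>R cube_average a m k x)"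
    by (rule completion.has_Bochner_integral_unique)
  then have "a ^ CARD('d) *\<^sub>R cube_average a m k (c *\<^sub>C x) = a ^ CARD('d) *\<^sub>R (c *\<^sub>C cube_average a m k x)"
    by (simp add: scaleC.scaleR_right)
  then show ?thesis
    using a by (simp only: scaleR_cancel_left) auto
qed

lemma finite_int_vec_ball: "finite {k::int^'d. norm (int_vec k) \<le> real n}"
proof (rule finite_subset)
  show "{k::int^'d. norm (int_vec k) \<le> real n} \<subseteq> {k. \<forall>i. k $ i \<in> {- int n..int n}}"
  proof (clarify)
    fix k :: "int^'d" and i assume "norm (int_vec k) \<le> real n"
    then have "\<bar>int_vec k $ i\<bar> \<le> real n"
      using component_le_norm_cart[of "int_vec k" i] by linarith
    then have "\<bar>real_of_int (k $ i)\<bar> \<le> real n"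
      by (simp add: int_vec_def)
    then show "k $ i \<in> {- int n..int n}"
      by (simp add: abs_le_iff)
  qed
  show "finite {k::int^'d. \<forall>i. k $ i \<in> {- int n..int n}}"
    by (rule finite_vec_box) simp
qed

text \<open>Both constants are at least 1, so dropping the roots \<open>1 / q'\<close> and
  \<open>1 / p\<close> only enlarges them; the two factors 4 combine to 16.\<close>

lemma kappa_transference_const:
  assumes "1 < p" "1 < q'"
  shows "kappa d q' powr (1 / q') * kappa d p powr (1 / p) \<le> transference_const d p q'"
proof -
  have le: "kappa d s powr (1 / s) \<le> kappa d s" if s: "1 < s" for s
  proof -
    have "kappa d s powr (1 / s) \<le> kappa d s powr 1"
      using s kappa_ge_1[OF s, of d] by (intro powr_mono) auto
    then show ?thesis
      using kappa_ge_1[OF s, of d] by simp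
  qed
  have "kappa d q' powr (1 / q') * kappa d p powr (1 / p) \<le> kappa d q' * kappa d p"
    using assms kappa_ge_1[of q' d] by (intro mult_mono le) auto
  also have "\<dots> = transference_const d p q'"
    by (simp add: kappa_def transference_const_def mult_ac flip: power_mult_distrib)
  finally show ?thesis .
qed

theorem proposition3p4:
  fixes m :: "(real^'d) \<Rightarrow> ('x::complex_banach, 'y::complex_banach) blinfun"
    and p q q' r a :: real
  assumes X_nonzero: "\<exists>x::'x. x \<noteq> 0" and Y_nonzero: "\<exists>y::'y. y \<noteq> 0"
    and p: "1 < p" and q: "1 < q" and r: "1 < r"
    and r_eq: "1 / r = 1 / p - 1 / q"
    and q'_conjugate: "1 / q + 1 / q' = 1"
    and m_complex_linear: "\<And>\<xi>. complex_linear_op (m \<xi>)"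
    and m_growth: "moderate_growth m"
    and m_L1_loc: "\<And>x. (\<lambda>\<xi>. blinfun_apply (m \<xi>) x) \<in> L1_loc"
    and a: "0 < a"
    and T_m_bounded: "T_mult_bounded p q m"
  shows "0 \<le> transference_const CARD('d) p q' \<and>
    (\<forall>(n::nat) (x :: int^'d \<Rightarrow> 'x).
       a powr (real CARD('d) / r) *
         Lp_norm torus q (trig_poly {k. norm (int_vec k) \<le> real n} (\<lambda>k. cube_average a m k (x k)))
       \<le> transference_const CARD('d) p q' * T_mult_norm p q m *
         Lp_norm torus p (trig_poly {k. norm (int_vec k) \<le> real n} x)) \<and>
    torus_multiplier_bounded p q (cube_average a m)"
proof -
  let ?c = "transference_const CARD('d) p q'"
  have "1 / q' = 1 - 1 / q" using q'_conjugate by simp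
  then have "0 < 1 / q'" "1 / q' < 1" using q by auto
  then have q': "1 < q'"
    by (metis less_divide_eq_1_pos zero_less_divide_1_iff divide_less_eq_1_pos)
  have c0: "0 \<le> ?c"
    using order_trans[OF _ kappa_transference_const[OF p q', of "CARD('d)"]] by simp
  \<comment> \<open>Stated for every admissible bound \<open>C\<close>, so that the infimum can be
    taken afterwards, and for every finite \<open>K\<close>, because the extension to L^p needs all
    finite frequency sets and not just balls.\<close>
  have main: "a powr (real CARD('d) / r) * Lp_norm torus q (trig_poly K (\<lambda>k. cube_average a m k (x k)))
      \<le> ?c * C * Lp_norm torus p (trig_poly K x)"
    if K: "finite K" and C: "T_mult_bound p q m C" for K and x :: "int^'d \<Rightarrow> 'x" and C
  proof -
    let ?\<kappa> = "kappa CARD('d) q' powr (1 / q') * kappa CARD('d) p powr (1 / p)"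
    let ?P = "Lp_norm torus p (trig_poly K x)"
    have C0: "0 \<le> C" using C by (simp add: T_mult_bound_def)
    have "a powr (real CARD('d) / r) * Lp_norm torus q (trig_poly K (\<lambda>k. cube_average a m k (x k))) \<le>
      a powr (real CARD('d) / r) * (?\<kappa> * a powr (real CARD('d) / q - real CARD('d) / p) * C * ?P)"
      by (intro mult_left_mono transference p q q' q'_conjugate m_growth m_L1_loc a C K) simp
    also have "\<dots> = (a powr (real CARD('d) / r) * a powr (real CARD('d) / q - real CARD('d) / p)) * (?\<kappa> * C * ?P)"
      by (simp only: mult_ac)
    \<comment> \<open>The powers of \<open>a\<close> cancel because
      \<open>d / r = d / p - d / q\<close>.\<close>
    also have "a powr (real CARD('d) / r) * a powr (real CARD('d) / q - real CARD('d) / p) = 1"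
    proof -
      have "real CARD('d) / r = real CARD('d) * (1 / r)" by simp
      also have "\<dots> = real CARD('d) / p - real CARD('d) / q"
        unfolding r_eq by (simp add: right_diff_distrib)
      finally show ?thesis
        using a by (simp flip: powr_add)
    qed
    also have "1 * (?\<kappa> * C * ?P) \<le> ?c * C * ?P"
      using kappa_transference_const[OF p q', of "CARD('d)"] C0
      by (simp only: mult_1) (intro mult_right_mono, auto simp: Lp_norm_nonneg)
    finally show ?thesis .
  qed
  obtain C where C: "T_mult_bound p q m C"
    using T_m_bounded by (auto simp: T_mult_bounded_def)
  have C0: "0 \<le> C" using C by (simp add: T_mult_bound_def)
  \<comment> \<open>Passing to the infimum over \<open>C\<close> uses division by
    \<open>?c * ?P\<close>; if this product is 0, the estimate for a single \<open>C\<close> already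
    has right-hand side 0.\<close>
  have least: "a powr (real CARD('d) / r) *
         Lp_norm torus q (trig_poly {k. norm (int_vec k) \<le> real n} (\<lambda>k. cube_average a m k (x k)))
       \<le> ?c * T_mult_norm p q m * Lp_norm torus p (trig_poly {k. norm (int_vec k) \<le> real n} x)"
    (is "?L \<le> ?c * _ * ?P") for n and x :: "int^'d \<Rightarrow> 'x"
  proof (cases "?c * ?P = 0")
    case True
    then have zero: "?c * D * ?P = 0" for D by auto
    show ?thesis
      using main[OF finite_int_vec_ball C, of n x] unfolding zero .
  next
    case False
    then have pos: "0 < ?c * ?P"
      using c0 Lp_norm_nonneg[of torus p "trig_poly {k. norm (int_vec k) \<le> real n} x"]
      by (metis less_eq_real_def mult_nonneg_nonneg)
    have "?L / (?c * ?P) \<le> T_mult_norm p q m"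
      unfolding T_mult_norm_def
    proof (rule cInf_greatest)
      show "{C. T_mult_bound p q m C} \<noteq> {}" using C by auto
      fix D assume "D \<in> {C. T_mult_bound p q m C}"
      then have "?L \<le> ?c * D * ?P"
        by (intro main finite_int_vec_ball) simp
      then show "?L / (?c * ?P) \<le> D"
        using pos by (simp add: pos_divide_le_eq mult_ac)
    qed
    then show ?thesis
      using pos by (simp add: pos_divide_le_eq mult_ac)
  qed
  have "torus_multiplier_bounded p q (cube_average a m)"
  proof (rule torus_multiplier_boundedI)
    \<comment> \<open>For the extension any admissible \<open>C\<close> will do; the fixed power of
      \<open>a\<close> is moved into the constant.\<close>
    show "0 \<le> ?c * C / a powr (real CARD('d) / r)"
      using c0 C0 by simp
    show "Lp_norm torus q (trig_poly K (\<lambda>k. cube_average a m k (x k))) \<le>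
        ?c * C / a powr (real CARD('d) / r) * Lp_norm torus p (trig_poly K x)"
      if "finite K" for K and x :: "int^'d \<Rightarrow> 'x"
      using main[OF that C, of x] a by (simp add: field_simps)
  qed (use p q in \<open>auto intro: cube_average_add cube_average_scaleC a m_L1_loc m_complex_linear\<close>)
  with c0 least show ?thesis by blast
qed

end
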